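(* Let $T>0$, $\nu>0$, $\alpha\in\,]0,1[$ and $v_0\in H$. Let $v$ be a (space-periodic) Leray-Hopf weak solution on $(0,T)\times\mathbb{T}^3$ of the Navier-Stokes equations $$\partial_t v+(v\cdot\nabla)v-\nu\Delta v+\nabla p=0,\qquad \operatorname{div} v=0,\qquad v(0,x)=v_0(x),$$ such that for all $\lambda\in\,]0,T[$ $$v\in L^{\frac{2}{1+\alpha}}(\lambda,T;\dot C^{\alpha}(\mathbb{T}^3)).$$ Then $v$ satisfies the energy equality in $[0,T]$, i.e. $$\frac12\|v(t)\|^2+\nu\int_0^t\|\nabla v(\tau)\|^2\,d\tau=\frac12\|v_0\|^2\qquad\text{for all }t\in[0,T].$$
   Context: $\mathbb{T}^3$ is the three-dimensional torus; functions on $\mathbb{T}^3$ are functions on $\mathbb{R}^3$ that are $2\pi$-periodic in each coordinate. $(\cdot,\cdot)$ and $\|\cdot\|$ denote the scalar product and norm of $L^2(\mathbb{T}^3)$. $H$ and $V$ are the closures in $L^2(\mathbb{T}^3)$ and $W^{1,2}(\mathbb{T}^3)$, respectively, of the smooth, periodic, divergence-free vector fields with zero mean value. Test functions: $\mathcal{D}_T:=\{\varphi\in C_0^\infty([0,T[\times\mathbb{T}^3):\operatorname{div}\varphi=0\}$ (vector-valued). Leray-Hopf weak solution: given $v_0\in H$, a measurable function $v:(0,T)\times\mathbb{T}^3\to\mathbb{R}^3$ is a Leray-Hopf weak solution if $v\in L^\infty(0,T;H)\cap L^2(0,T;V)$ and the following hold: (i) $\displaystyle\int_0^T\Big[(v,\partial_t\varphi)-\nu(\nabla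 v,\nabla\varphi)-((v\cdot\nabla)v,\varphi)\Big]\,dt=-(v_0,\varphi(0))$ for all $\varphi\in\mathcal{D}_T$; (ii) $\displaystyle\frac12\|v(t)\|^2+\nu\int_0^t\|\nabla v(\tau)\|^2\,d\tau\le\frac12\|v_0\|^2$ for all $t\in[0,T]$; (iii) $\lim_{t\to0^+}\|v(t)-v_0\|=0$. As usual, $v$ is identified with its representative that is weakly continuous from $[0,T]$ into $L^2(\mathbb{T}^3)$, with $v(0)=v_0$. Hölder spaces: for $0<\alpha\le1$, $[u]_\alpha:=\sup_{x\ne y}\frac{|u(x)-u(y)|}{|x-y|^\alpha}$, and $\dot C^\alpha(\mathbb{T}^3)$ is the space of measurable functions with $[u]_\alpha<\infty$. The hypothesis means: there exists $f_\alpha:[0,T]\to\mathbb{R}^+$ such that $|v(t,x)-v(t,y)|\le f_\alpha(t)|x-y|^\alpha$ for all $x,y\in\mathbb{T}^3$ and a.e. $t\in\,]0,T]$, and $f_\alpha\in L^{\frac{2}{1+\alpha}}(\lambda,T)$ for all $\lambda\in\,]0,T[$ (it is not required that $f_\alpha\in L^{\frac{2}{1+\alpha}}(0,T)$). *)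

theory Defs
  imports "HOL-Analysis.Analysis"
begin

section \<open>Periodic functions and $L^2$ of the torus\<close>

text \<open>Functions on the torus are functions on the whole space that are \<open>2\<pi>\<close>-periodic in each
  coordinate; integrals over the torus are integrals over the period cell.\<close>

definition periodic :: "(real^3 \<Rightarrow> 'a) \<Rightarrow> bool"
  where "periodic u \<longleftrightarrow> (\<forall>x i. u (x + axis i (2 * pi)) = u x)"

abbreviation torus :: "(real^3) measure"
  where "torus \<equiv> lebesgue_on (cbox 0 (vec (2 * pi)))"

definition L2 :: "(real^3 \<Rightarrow> 'a::euclidean_space) set"
  where "L2 = {u. periodic u \<and> u \<in> borel_measurable lebesgue \<and>
                  integrable torus (\<lambda>x. (norm (u x))\<^sup>2)}"

definition L2_inner :: "(real^3 \<Rightarrow> 'a::euclidean_space) \<Rightarrow> (real^3 \<Rightarrow> 'a) \<Rightarrow> real"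
  where "L2_inner u w = (LINT x|torus. u x \<bullet> w x)"

definition L2_norm :: "(real^3 \<Rightarrow> 'a::euclidean_space) \<Rightarrow> real"
  where "L2_norm u = sqrt (L2_inner u u)"

definition Lp_on :: "real \<Rightarrow> real set \<Rightarrow> (real \<Rightarrow> real) \<Rightarrow> bool"
  where "Lp_on p I f \<longleftrightarrow> f \<in> borel_measurable (lebesgue_on I) \<and>
                        integrable (lebesgue_on I) (\<lambda>t. \<bar>f t\<bar> powr p)"

section \<open>Smooth functions and classical derivatives\<close>

text \<open>Derivatives are taken within \<open>S\<close>, so that on \<open>[0,T[ \<times> \<real>\<^sup>3\<close> smoothness
  includes the boundary \<open>t = 0\<close>, where time derivatives are one-sided.\<close>

primrec Ck_on :: "nat \<Rightarrow> 'a::euclidean_space set \<Rightarrow> ('a \<Rightarrow> 'b::real_normed_vector) \<Rightarrow> bool"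
  where
    "Ck_on 0 S f \<longleftrightarrow> continuous_on S f"
  | "Ck_on (Suc k) S f \<longleftrightarrow> (\<forall>x\<in>S. f differentiable (at x within S)) \<and>
       (\<forall>h. Ck_on k S (\<lambda>x. frechet_derivative f (at x within S) h))"

definition smooth_on :: "'a::euclidean_space set \<Rightarrow> ('a \<Rightarrow> 'b::real_normed_vector) \<Rightarrow> bool"
  where "smooth_on S f \<longleftrightarrow> (\<forall>k. Ck_on k S f)"

definition cgrad :: "(real^3 \<Rightarrow> real^3) \<Rightarrow> real^3 \<Rightarrow> real^3^3"
  where "cgrad u x = jacobian u (at x)"

definition divergence :: "(real^3 \<Rightarrow> real^3) \<Rightarrow> real^3 \<Rightarrow> real"
  where "divergence u x = trace (cgrad u x)"

section \<open>Weak gradient, $W^{1,2}$ and the spaces $H$ and $V$\<close>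

text \<open>As for the Jacobian matrix, the entry \<open>G x $ i $ j\<close> is the derivative of the \<open>i\<close>-th
  component in direction \<open>j\<close>. On \<open>real^3^3\<close> the library's inner product is the Frobenius one.\<close>

definition has_weak_gradient :: "(real^3 \<Rightarrow> real^3) \<Rightarrow> (real^3 \<Rightarrow> real^3^3) \<Rightarrow> bool"
  where "has_weak_gradient u G \<longleftrightarrow> G \<in> L2 \<and>
    (\<forall>\<psi> :: real^3 \<Rightarrow> real. smooth_on UNIV \<psi> \<and> periodic \<psi> \<longrightarrow>
      (\<forall>i j. (LINT x|torus. u x $ i * frechet_derivative \<psi> (at x) (axis j 1)) =
             - (LINT x|torus. G x $ i $ j * \<psi> x)))"

text \<open>The weak gradient is unique up to null sets; everything below depends only on its
  almost-everywhere class.\<close>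

definition wgrad :: "(real^3 \<Rightarrow> real^3) \<Rightarrow> real^3 \<Rightarrow> real^3^3"
  where "wgrad u = (SOME G. has_weak_gradient u G)"

definition W12 :: "(real^3 \<Rightarrow> real^3) set"
  where "W12 = {u \<in> L2. \<exists>G. has_weak_gradient u G}"

definition W12_norm :: "(real^3 \<Rightarrow> real^3) \<Rightarrow> real"
  where "W12_norm u = sqrt ((L2_norm u)\<^sup>2 + (L2_norm (wgrad u))\<^sup>2)"

definition solenoidal :: "(real^3 \<Rightarrow> real^3) set"
  where "solenoidal = {\<phi>. smooth_on UNIV \<phi> \<and> periodic \<phi> \<and> (\<forall>x. divergence \<phi> x = 0) \<and>
                           (LINT x|torus. \<phi> x) = 0}"

definition H_space :: "(real^3 \<Rightarrow> real^3) set"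
  where "H_space = {u \<in> L2. \<forall>\<epsilon>>0. \<exists>\<phi>\<in>solenoidal. L2_norm (\<lambda>x. u x - \<phi> x) < \<epsilon>}"

definition V_space :: "(real^3 \<Rightarrow> real^3) set"
  where "V_space = {u \<in> W12. \<forall>\<epsilon>>0. \<exists>\<phi>\<in>solenoidal. W12_norm (\<lambda>x. u x - \<phi> x) < \<epsilon>}"

section \<open>Leray-Hopf weak solutions\<close>

text \<open>Only the values of a test function on \<open>[0,T[ \<times> \<real>\<^sup>3\<close> matter. Since the torus is compact,
  a compact support in \<open>[0,T[ \<times> \<T>\<^sup>3\<close> means vanishing for times close to \<open>T\<close>.\<close>

definition test_functions :: "real \<Rightarrow> (real \<Rightarrow> real^3 \<Rightarrow> real^3) set"
  where "test_functions T = {\<phi>.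
    smooth_on ({0..<T} \<times> UNIV) (\<lambda>(t, x). \<phi> t x) \<and>
    (\<forall>t\<in>{0..<T}. periodic (\<phi> t) \<and> (\<forall>x. divergence (\<phi> t) x = 0)) \<and>
    (\<exists>T'\<in>{0..<T}. \<forall>t\<in>{T'..<T}. \<forall>x. \<phi> t x = 0)}"

definition time_deriv :: "(real \<Rightarrow> real^3 \<Rightarrow> real^3) \<Rightarrow> real \<Rightarrow> real^3 \<Rightarrow> real^3"
  where "time_deriv \<phi> t x = vector_derivative (\<lambda>s. \<phi> s x) (at t)"

definition convection :: "(real^3 \<Rightarrow> real^3) \<Rightarrow> real^3 \<Rightarrow> real^3"
  where "convection u x = wgrad u x *v u x"

definition Linfty_H :: "real \<Rightarrow> (real \<Rightarrow> real^3 \<Rightarrow> real^3) \<Rightarrow> bool"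
  where "Linfty_H T v \<longleftrightarrow> (AE t in lebesgue_on {0<..<T}. v t \<in> H_space) \<and>
                         (\<exists>M. AE t in lebesgue_on {0<..<T}. L2_norm (v t) \<le> M)"

definition L2_V :: "real \<Rightarrow> (real \<Rightarrow> real^3 \<Rightarrow> real^3) \<Rightarrow> bool"
  where "L2_V T v \<longleftrightarrow> (AE t in lebesgue_on {0<..<T}. v t \<in> V_space) \<and>
                     Lp_on 2 {0<..<T} (\<lambda>t. W12_norm (v t))"

definition leray_hopf ::
    "real \<Rightarrow> real \<Rightarrow> (real^3 \<Rightarrow> real^3) \<Rightarrow> (real \<Rightarrow> real^3 \<Rightarrow> real^3) \<Rightarrow> bool"
  where "leray_hopf T \<nu> v0 v \<longleftrightarrow>
    (\<lambda>(t, x). v t x) \<in> borel_measurable (lebesgue_on ({0<..<T} \<times> UNIV)) \<and>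
    (\<forall>t\<in>{0<..<T}. periodic (v t)) \<and>
    Linfty_H T v \<and> L2_V T v \<and>
    (\<forall>\<phi>\<in>test_functions T.
       (LINT t|lebesgue_on {0<..<T}.
          L2_inner (v t) (time_deriv \<phi> t)
          - \<nu> * L2_inner (wgrad (v t)) (cgrad (\<phi> t))
          - L2_inner (convection (v t)) (\<phi> t)) = - L2_inner v0 (\<phi> 0)) \<and>
    (\<forall>t\<in>{0..T}.
       1/2 * (L2_norm (v t))\<^sup>2 + \<nu> * (LINT \<tau>|lebesgue_on {0..t}. (L2_norm (wgrad (v \<tau>)))\<^sup>2)
         \<le> 1/2 * (L2_norm v0)\<^sup>2) \<and>
    ((\<lambda>t. L2_norm (\<lambda>x. v t x - v0 x)) \<longlongrightarrow> 0) (at_right 0)"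

text \<open>The equality \<open>v(0) = v\<^sub>0\<close> is one in \<open>L\<^sup>2\<close>, i.e. almost everywhere in space.\<close>

definition weakly_continuous_representative ::
    "real \<Rightarrow> (real^3 \<Rightarrow> real^3) \<Rightarrow> (real \<Rightarrow> real^3 \<Rightarrow> real^3) \<Rightarrow> bool"
  where "weakly_continuous_representative T v0 v \<longleftrightarrow>
    (\<forall>t\<in>{0..T}. v t \<in> L2) \<and>
    (\<forall>w\<in>L2. continuous_on {0..T} (\<lambda>t. L2_inner (v t) w)) \<and>
    (AE x in lebesgue. v 0 x = v0 x)"

section \<open>The Hoelder condition\<close>

text \<open>One function \<open>f\<close> serves for all \<open>l\<close>, and it need not be in \<open>L\<^sup>p(0,T)\<close>.\<close>

definition holder_away_from_0 ::
    "real \<Rightarrow> real \<Rightarrow> real \<Rightarrow> (real \<Rightarrow> real^3 \<Rightarrow> real^3) \<Rightarrow> bool"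
  where "holder_away_from_0 T p \<alpha> v \<longleftrightarrow>
    (\<exists>f :: real \<Rightarrow> real. (\<forall>t\<in>{0..T}. 0 \<le> f t) \<and>
       (AE t in lebesgue_on {0<..T}. \<forall>x y. norm (v t x - v t y) \<le> f t * norm (x - y) powr \<alpha>) \<and>
       (\<forall>l\<in>{0<..<T}. Lp_on p {l<..<T} f))"

end

theory Submission
  imports Defs "HOL-Computational_Algebra.Polynomial"
begin

text \<open>One half of the energy equality, the inequality \<open>\<le>\<close>, is part of the notion of a Leray--Hopf
  solution. The other half says that the nonlinear term does not dissipate energy, and this is where the Hoelder
  condition is used.

  Let \<open>J\<close> be an even trigonometric polynomial. Testing the equation with plane waves
  \<open>cos (k \<bullet> x + c) a\<close>, where \<open>a\<close> is orthogonal to \<open>k\<close>, shows that the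
  Fourier moments of \<open>v\<close> are absolutely continuous in time. Adding the equations for the squares of these
  moments, weighted by the finitely many coefficients of \<open>J\<close>, gives (\<open>mollified_energy\<close>)
  \<open>1/2 (v(t), J * v(t)) - 1/2 (v(s), J * v(s)) = - \<integral>\<^sub>s\<^sup>t [\<nu> (\<nabla>v, J * \<nabla>v) + ((v \<cdot> \<nabla>)v, J * v)] d\<tau>\<close>.
  A trigonometric kernel has the advantage that this is a statement about finitely many scalar functions of time,
  and that the test functions are explicit. The kernel is the product of three normalised powers of
  \<open>cos\<^sup>2 (z\<^sub>i / 2)\<close>. It is nonnegative with mass one, hence \<open>(w, J * w)\<close> is at
  most the squared norm of \<open>w\<close> (\<open>conv_form_le_square\<close>). The energy at the time
  \<open>t\<close> and the dissipation are thus estimated in the right direction, and only at the initial time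
  \<open>s\<close> the mollified energy has to converge. It does if \<open>v(s)\<close> is Hoelder continuous.

  The nonlinear term is expressed by the increments \<open>\<delta>\<^sub>z v(x) = v(x + z) - v(x)\<close>; up to
  the factor \<open>1/4\<close> it is the integral of
  \<open>\<nabla>J(z) \<cdot> \<delta>\<^sub>z v |\<delta>\<^sub>z v|\<^sup>2\<close>
  (\<open>transfer_eq_increments\<close>, an identity of Duchon and Robert). One factor is estimated by
  \<open>f |z|\<^sup>\<alpha>\<close>. The \<open>L\<^sup>2\<close> norm of the other two is at most
  \<open>|z| |\<nabla>v|\<close> and at most \<open>2 |v|\<close>, and interpolation of its square gives the bound
  \<open>|z|\<^sup>\<alpha> (|z| |\<nabla>v|)\<^sup>1\<^sup>-\<^sup>\<alpha> (2 |v|)\<^sup>1\<^sup>+\<^sup>\<alpha> f = |z| (2 |v|)\<^sup>1\<^sup>+\<^sup>\<alpha> f |\<nabla>v|\<^sup>1\<^sup>-\<^sup>\<alpha>\<close>.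
  As the integral of \<open>|\<nabla>J(z)| |z|\<close> is bounded uniformly in the kernel, the nonlinear term is at
  most a constant times
  \<open>f |\<nabla>v|\<^sup>1\<^sup>-\<^sup>\<alpha> \<le> f\<^sup>p + |\<nabla>v|\<^sup>2\<close> with
  \<open>p = 2 / (1 + \<alpha>)\<close>, which is integrable in time on \<open>(s, T)\<close>
  (\<open>transfer_bound_integrable\<close>). At a fixed time the nonlinear term tends to zero as the kernel
  concentrates (\<open>transfer_bound_small\<close>), and so does its time integral, by dominated convergence
  (\<open>energy_from_good_time\<close>). Letting \<open>s\<close> tend to zero along times at which
  \<open>v(s)\<close> is Hoelder continuous, where \<open>v(s)\<close> converges strongly to
  \<open>v\<^sub>0\<close>, finishes the proof.\<close>

section \<open>The Cauchy--Schwarz inequality\<close>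

lemma integrable_inner_L2:
  fixes f g :: "'x \<Rightarrow> 'a::euclidean_space"
  assumes "f \<in> borel_measurable M" "g \<in> borel_measurable M"
    and "integrable M (\<lambda>x. (norm (f x))\<^sup>2)" "integrable M (\<lambda>x. (norm (g x))\<^sup>2)"
  shows "integrable M (\<lambda>x. f x \<bullet> g x)"
proof (rule Bochner_Integration.integrable_bound)
  show "integrable M (\<lambda>x. (norm (f x))\<^sup>2 + (norm (g x))\<^sup>2)" using assms by simp
  show "(\<lambda>x. f x \<bullet> g x) \<in> borel_measurable M" using assms by measurable
  show "AE x in M. norm (f x \<bullet> g x) \<le> norm ((norm (f x))\<^sup>2 + (norm (g x))\<^sup>2)"
  proof (rule AE_I2)
    fix x
    have "\<bar>f x \<bullet> g x\<bar> \<le> norm (f x) * norm (g x)" by (rule Cauchy_Schwarz_ineq2)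
    moreover have "2 * (norm (f x) * norm (g x)) \<le> (norm (f x))\<^sup>2 + (norm (g x))\<^sup>2"
      using sum_squares_bound[of "norm (f x)" "norm (g x)"] by (simp add: mult.assoc)
    moreover have "0 \<le> norm (f x) * norm (g x)" by simp
    ultimately show "norm (f x \<bullet> g x) \<le> norm ((norm (f x))\<^sup>2 + (norm (g x))\<^sup>2)" 
      unfolding real_norm_def by linarith
  qed
qed

text \<open>The square norm of \<open>f - r g\<close> is a nonnegative quadratic polynomial in \<open>r\<close>.\<close>

lemma Cauchy_Schwarz_L2:
  fixes f g :: "'x \<Rightarrow> 'a::euclidean_space"
  assumes f: "f \<in> borel_measurable M" and g: "g \<in> borel_measurable M"
    and f2: "integrable M (\<lambda>x. (norm (f x))\<^sup>2)" and g2: "integrable M (\<lambda>x. (norm (g x))\<^sup>2)"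
  shows "\<bar>LINT x|M. f x \<bullet> g x\<bar> \<le> sqrt (LINT x|M. (norm (f x))\<^sup>2) * sqrt (LINT x|M. (norm (g x))\<^sup>2)"
proof -
  define A where "A = (LINT x|M. (norm (f x))\<^sup>2)"
  define B where "B = (LINT x|M. f x \<bullet> g x)"
  define D where "D = (LINT x|M. (norm (g x))\<^sup>2)"
  have fg: "integrable M (\<lambda>x. f x \<bullet> g x)" by (rule integrable_inner_L2[OF assms])
  have A0: "A \<ge> 0" and D0: "D \<ge> 0" by (auto simp: A_def D_def)
  have sq: "(norm (a - r *\<^sub>R b))\<^sup>2 = (norm a)\<^sup>2 - 2 * r * (a \<bullet> b) + r\<^sup>2 * (norm b)\<^sup>2" for a b :: 'a and r
    unfolding power2_norm_eq_inner
    by (simp add: inner_diff_left inner_diff_right inner_commute[of b a] power2_eq_square algebra_simps)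
  have q: "0 \<le> A - 2 * r * B + r\<^sup>2 * D" for r
  proof -
    have "0 \<le> (LINT x|M. (norm (f x - r *\<^sub>R g x))\<^sup>2)" by simp
    also have "\<dots> = (LINT x|M. (norm (f x))\<^sup>2 - 2 * r * (f x \<bullet> g x) + r\<^sup>2 * (norm (g x))\<^sup>2)"
      by (rule Bochner_Integration.integral_cong)
        (rule refl, rule sq)
    also have "\<dots> = A - 2 * r * B + r\<^sup>2 * D" using fg f2 g2 by (simp add: A_def B_def D_def)
    finally show ?thesis .
  qed
  have "B\<^sup>2 \<le> A * D"
  proof (cases "D = 0")
    case True
    have "B = 0"
    proof (rule ccontr)
      assume "B \<noteq> 0"
      with q[of "(A + 1) / (2 * B)"] True show False by (simp add: field_simps)
    qed
    with A0 D0 show ?thesis by simp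
  next
    case False
    with D0 have "D > 0" by simp
    have "0 \<le> (A - 2 * (B / D) * B + (B / D)\<^sup>2 * D) * D" using q[of "B/D"] D0 by simp
    also have "\<dots> = A * D - B\<^sup>2" using \<open>D > 0\<close> by (simp add: field_simps power2_eq_square)
    finally show ?thesis by simp
  qed
  then have "sqrt (B\<^sup>2) \<le> sqrt (A * D)" by (rule real_sqrt_le_mono)
  then show ?thesis by (simp add: real_sqrt_mult A_def B_def D_def)
qed

section \<open>Integrals of periodic functions over the period cell\<close>

abbreviation cell :: "(real^3) set" where "cell \<equiv> cbox 0 (vec (2 * pi))"

lemma torus_integral_eq:
  fixes F :: "real^3 \<Rightarrow> real"
  assumes "continuous_on UNIV F"
  shows "integrable torus F" and "(LINT x|torus. F x) = integral cell F"
proof -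
  show *: "integrable torus F"
    by (rule continuous_imp_integrable) (rule continuous_on_subset[OF assms], simp)
  show "(LINT x|torus. F x) = integral cell F"
    by (rule lebesgue_integral_eq_integral[OF *]) simp
qed

text \<open>The cell, enlarged by \<open>s\<close> in direction \<open>i\<close>, is cut at \<open>s\<close> and at
  \<open>2\<pi>\<close>. The first cut leaves the shifted cell, the second one the cell itself, and the two
  remaining slabs differ by a period.\<close>

lemma integral_cell_axis_shift_nonneg:
  fixes F :: "real^3 \<Rightarrow> real"
  assumes c: "continuous_on UNIV F" and p: "periodic F" and s: "s \<ge> 0"
  shows "integral cell (\<lambda>x. F (x + axis i s)) = integral cell F"
proof -
  let ?b = "vec (2 * pi) :: real^3"
  let ?A = "cbox 0 (\<chi> j. if j = i then s else 2 * pi)"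
  let ?D = "cbox 0 (?b + axis i s)"
  have int: "F integrable_on cbox a b" for a b
    by (rule integrable_continuous) (rule continuous_on_subset[OF c], simp)
  have bas: "axis i 1 \<in> (Basis :: (real^3) set)" by (simp add: axis_in_Basis_iff)
  have pi0: "(pi \<le> 0) = False" by (metis pi_gt_zero not_le)
  have le: "cbox p q \<inter> {x. x \<bullet> axis i 1 \<le> c} = cbox p (\<chi> j. if j = i then min (q$i) c else q$j)"
    and ge: "cbox p q \<inter> {x. x \<bullet> axis i 1 \<ge> c} = cbox (\<chi> j. if j = i then max (p$i) c else p$j) q" for p q :: "real^3" and c
    using interval_split_cart[where a=p and b=q and k=i and c=c] by (simp_all add: inner_axis interval_cbox_cart)
  have 1: "?D \<inter> {x. x \<bullet> axis i 1 \<le> s} = ?A"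
    unfolding le using s
    by (intro arg_cong2[where f=cbox]) (auto simp: vec_eq_iff axis_def min_def pi0)
  have 2: "?D \<inter> {x. x \<bullet> axis i 1 \<ge> s} = cbox (0 + axis i s) (?b + axis i s)"
    unfolding ge using s by (intro arg_cong2[where f=cbox]) (auto simp: vec_eq_iff axis_def)
  have 3: "?D \<inter> {x. x \<bullet> axis i 1 \<le> 2 * pi} = cell"
    unfolding le using s by (intro arg_cong2[where f=cbox]) (auto simp: vec_eq_iff axis_def)
  have 4: "?D \<inter> {x. x \<bullet> axis i 1 \<ge> 2 * pi} = cbox (0 + axis i (2*pi)) ((\<chi> j. if j = i then s else 2 * pi) + axis i (2*pi))"
    unfolding ge using s
    by (intro arg_cong2[where f=cbox]) (auto simp: vec_eq_iff axis_def max_def pi0)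
  have per: "integral ?A F = integral (cbox (0 + axis i (2*pi)) ((\<chi> j. if j = i then s else 2 * pi) + axis i (2*pi))) F"
  proof -
    have "F \<circ> (+) (axis i (2*pi)) = F"
      using p by (auto simp: periodic_def o_def add.commute)
    then show ?thesis using integral_shift_cbox_plus[of 0 "\<chi> j. if j = i then s else 2 * pi" F "axis i (2*pi)"] by simp
  qed
  have "integral ?D F = integral ?A F + integral (cbox (0 + axis i s) (?b + axis i s)) F"
    using integral_split[OF int bas, of 0 "?b + axis i s" s] unfolding 1 2 .
  moreover have "integral ?D F = integral cell F + integral ?A F"
    using integral_split[OF int bas, of 0 "?b + axis i s" "2*pi"] unfolding 3 4 per .
  moreover have "integral cell (\<lambda>x. F (x + axis i s)) = integral (cbox (0 + axis i s) (?b + axis i s)) F"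
    using integral_shift_cbox_plus[of 0 ?b F "axis i s"] by (simp add: o_def add.commute)
  ultimately show ?thesis by simp
qed

lemma periodic_shift: "periodic F \<Longrightarrow> periodic (\<lambda>x. F (x + z))"
  unfolding periodic_def by (metis add.assoc add.commute)

text \<open>A translation is composed of three axis shifts, and a negative shift is the inverse of a positive one.\<close>

lemma integral_torus_translate:
  fixes F :: "real^3 \<Rightarrow> real"
  assumes c: "continuous_on UNIV F" and p: "periodic F"
  shows "(LINT x|torus. F (x + z)) = (LINT x|torus. F x)"
proof -
  have cs: "continuous_on UNIV (\<lambda>x. F (x + w))" for w
    by (intro continuous_on_compose2[OF c]) (auto intro!: continuous_intros)
  have ax: "integral cell (\<lambda>x. F (x + w + axis i s)) = integral cell (\<lambda>x. F (x + w))" for i s w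
  proof (cases "s \<ge> 0")
    case True
    show ?thesis
      using integral_cell_axis_shift_nonneg[OF cs[of w] periodic_shift[OF p] True, of i]
      by (simp add: add_ac)
  next
    case False
    then have "integral cell (\<lambda>x. F (x + (w + axis i s))) = integral cell (\<lambda>x. F (x + axis i (-s) + (w + axis i s)))"
      by (intro integral_cell_axis_shift_nonneg[OF cs[of "w + axis i s"] periodic_shift[OF p], symmetric]) auto
    also have "(\<lambda>x. F (x + axis i (-s) + (w + axis i s))) = (\<lambda>x. F (x + w))"
    proof
      fix x
      have "x + axis i (-s) + (w + axis i s) = x + w" by (simp add: vec_eq_iff axis_def)
      then show "F (x + axis i (-s) + (w + axis i s)) = F (x + w)" by (rule arg_cong)
    qed
    finally show ?thesis by (simp add: add_ac)
  qed
  have z: "z = axis 1 (z$1) + axis 2 (z$2) + axis 3 (z$3)"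
    by (simp add: vec_eq_iff axis_def forall_3)
  have "integral cell (\<lambda>x. F (x + z)) = integral cell (\<lambda>x. F (x + (axis 1 (z$1) + axis 2 (z$2)) + axis 3 (z$3)))"
    by (subst z) (simp add: add.assoc)
  also have "\<dots> = integral cell (\<lambda>x. F (x + (axis 1 (z$1) + axis 2 (z$2))))" by (rule ax)
  also have "\<dots> = integral cell (\<lambda>x. F (x + axis 1 (z$1) + axis 2 (z$2)))" by (simp add: add.assoc)
  also have "\<dots> = integral cell (\<lambda>x. F (x + axis 1 (z$1)))" by (rule ax)
  also have "\<dots> = integral cell (\<lambda>x. F (x + 0 + axis 1 (z$1)))" by simp
  also have "\<dots> = integral cell (\<lambda>x. F (x + 0))" by (rule ax)
  finally show ?thesis using torus_integral_eq(2)[OF cs[of z]] torus_integral_eq(2)[OF c] by simp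
qed

definition partial :: "3 \<Rightarrow> (real^3 \<Rightarrow> real) \<Rightarrow> real^3 \<Rightarrow> real"
  where "partial j p z = frechet_derivative p (at z) (axis j 1)"

text \<open>By translation invariance, the integral of \<open>F (x + s e\<^sub>j)\<close> does not depend on \<open>s\<close>;
  its derivative at \<open>s = 0\<close> is the integral of the partial derivative. This replaces the divergence
  theorem.\<close>

lemma integral_torus_partial_eq_0:
  fixes F :: "real^3 \<Rightarrow> real"
  assumes d: "\<And>x. F differentiable (at x)" and c: "continuous_on UNIV (partial j F)" and p: "periodic F"
  shows "(LINT x|torus. partial j F x) = 0"
proof -
  have cF: "continuous_on UNIV F"
    using d by (simp add: continuous_on_eq_continuous_at differentiable_imp_continuous_within)
  have cs: "continuous_on UNIV (\<lambda>x. F (x + w))" for w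
    by (intro continuous_on_compose2[OF cF]) (auto intro!: continuous_intros)
  define h where "h s = integral cell (\<lambda>x. F (x + axis j s))" for s
  have h: "h s = h 0" for s
    using integral_torus_translate[OF cF p, of "axis j s"] integral_torus_translate[OF cF p, of "axis j 0"]
    by (simp add: h_def torus_integral_eq(2)[OF cs])
  have "((\<lambda>s. integral cell (\<lambda>x. F (x + axis j s))) has_field_derivative integral cell (\<lambda>x. partial j F (x + axis j 0))) (at 0 within UNIV)"
  proof (rule leibniz_rule_field_derivative)
    fix s x
    have ax: "((\<lambda>s. x + axis j s) has_derivative (\<lambda>h. h *\<^sub>R axis j 1)) (at s within UNIV)"
    proof -
      have "(\<lambda>s::real. x + axis j s) = (\<lambda>s. x + s *\<^sub>R axis j 1)" 
        by (auto simp: vec_eq_iff axis_def)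
      then show ?thesis by (auto intro!: derivative_eq_intros)
    qed
    have "(F has_derivative frechet_derivative F (at (x + axis j s))) (at (x + axis j s))"
      using d frechet_derivative_works by blast
    from has_derivative_compose[OF ax, OF this]
    have *: "((\<lambda>s. F (x + axis j s)) has_derivative (\<lambda>h. frechet_derivative F (at (x + axis j s)) (h *\<^sub>R axis j 1))) (at s within UNIV)" .
    have "(\<lambda>h. frechet_derivative F (at (x + axis j s)) (h *\<^sub>R axis j 1)) = (*) (partial j F (x + axis j s))"
      using linear_frechet_derivative[OF d] by (auto simp: partial_def linear_cmul)
    with * show "((\<lambda>s. F (x + axis j s)) has_field_derivative partial j F (x + axis j s)) (at s within UNIV)"
      by (simp add: has_field_derivative_def)
  next
    fix s :: real
    show "(\<lambda>x. F (x + axis j s)) integrable_on cell"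
      by (rule integrable_continuous) (rule continuous_on_subset[OF cs], simp)
  next
    have "continuous_on (UNIV \<times> cell) (\<lambda>z. partial j F (snd z + fst z *\<^sub>R axis j 1))"
      by (intro continuous_on_compose2[OF c]) (auto intro!: continuous_intros)
    moreover have "(\<lambda>(s, x). partial j F (x + axis j s)) = (\<lambda>z. partial j F (snd z + fst z *\<^sub>R axis j 1))"
    proof -
      have "axis j (s::real) = s *\<^sub>R axis j 1" for s by (auto simp: vec_eq_iff axis_def)
      then show ?thesis by (metis (no_types, lifting) case_prod_beta')
    qed
    ultimately show "continuous_on (UNIV \<times> cell) (\<lambda>(s, x). partial j F (x + axis j s))"
      by simp
  qed auto
  note hd = this
  have "(h has_field_derivative integral cell (partial j F)) (at 0)"
  proof -
    have "axis j 0 = (0::real^3)" by (simp add: vec_eq_iff axis_def)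
    with hd show ?thesis by (simp add: h_def[abs_def])
  qed
  moreover have "(h has_field_derivative 0) (at 0)"
  proof -
    have "h = (\<lambda>s. h 0)" using h by auto
    then show ?thesis by (metis DERIV_const)
  qed
  ultimately have "integral cell (partial j F) = 0" by (rule DERIV_unique)
  then show ?thesis using torus_integral_eq(2)[OF c] by simp
qed

section \<open>Smoothness of a family closed under differentiation\<close>

lemma Ck_on_cong:
  assumes "\<And>x. x \<in> S \<Longrightarrow> f x = g x"
  shows "Ck_on k S f \<longleftrightarrow> Ck_on k S g"
  using assms
proof (induction k arbitrary: f g)
  case 0
  then show ?case by (simp cong: continuous_on_cong)
next
  case (Suc k)
  have hd: "(f has_derivative D) (at x within S) \<longleftrightarrow> (g has_derivative D) (at x within S)" if "x \<in> S" for x D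
    using Suc.prems that by (metis has_derivative_transform)
  then have d: "f differentiable (at x within S) \<longleftrightarrow> g differentiable (at x within S)" if "x \<in> S" for x
    using that by (simp add: differentiable_def)
  have "frechet_derivative f (at x within S) = frechet_derivative g (at x within S)" if "x \<in> S" for x
    using hd[OF that] by (simp add: frechet_derivative_def)
  then have "Ck_on k S (\<lambda>x. frechet_derivative f (at x within S) h) \<longleftrightarrow> Ck_on k S (\<lambda>x. frechet_derivative g (at x within S) h)" for h
    by (intro Suc.IH) simp
  with d show ?case by simp
qed

text \<open>Smoothness by coinduction: if the directional derivatives of every member of a family belong to the family again,
  then all members are smooth. Derivatives within \<open>S\<close> have to be unique, since the classes
  \<open>C\<^sup>k\<close> are built from one chosen derivative.\<close>

lemma smooth_on_closed_family:
  assumes P: "P f"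
    and unique: "\<And>(g :: 'a::euclidean_space \<Rightarrow> 'b::real_normed_vector) x A B. \<lbrakk>x \<in> S; (g has_derivative A) (at x within S); (g has_derivative B) (at x within S)\<rbrakk> \<Longrightarrow> A = B"
    and closed: "\<And>g. P g \<Longrightarrow> \<exists>D. (\<forall>x\<in>S. (g has_derivative D x) (at x within S)) \<and> (\<forall>h. P (\<lambda>x. D x h))"
  shows "smooth_on S (f :: 'a \<Rightarrow> 'b)"
  unfolding smooth_on_def
proof
  fix k
  show "Ck_on k S f" using P
  proof (induction k arbitrary: f)
    case 0
    then obtain D where "\<forall>x\<in>S. (f has_derivative D x) (at x within S)" using closed by blast
    then show ?case by (auto intro!: has_derivative_continuous_on)
  next
    case (Suc k)
    then obtain D where D: "\<And>x. x \<in> S \<Longrightarrow> (f has_derivative D x) (at x within S)" "\<And>h. P (\<lambda>x. D x h)" using closed by blast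
    have "frechet_derivative f (at x within S) = D x" if "x \<in> S" for x
      using D(1)[OF that] unique[OF that] that
      by (metis differentiable_def frechet_derivative_works)
    then have "Ck_on k S (\<lambda>x. frechet_derivative f (at x within S) h)" for h
      using Suc.IH[OF D(2)[of h]] by (subst Ck_on_cong[where g="\<lambda>x. D x h"]) auto
    with D(1) show ?case by (auto simp: differentiable_def)
  qed
qed

section \<open>Real trigonometric polynomials\<close>

text \<open>Integer frequencies make the functions \<open>2\<pi>\<close>-periodic; the phase \<open>c\<close> covers the sines.\<close>

inductive trigpoly :: "(real^3 \<Rightarrow> real) \<Rightarrow> bool" where
  wave: "(\<And>i. k $ i \<in> \<int>) \<Longrightarrow> trigpoly (\<lambda>z. cos (k \<bullet> z + c))"
| add: "trigpoly p \<Longrightarrow> trigpoly q \<Longrightarrow> trigpoly (\<lambda>z. p z + q z)"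
| scale: "trigpoly p \<Longrightarrow> trigpoly (\<lambda>z. r * p z)"

lemma trigpoly_sin: "(\<And>i. k $ i \<in> \<int>) \<Longrightarrow> trigpoly (\<lambda>z. sin (k \<bullet> z + c))"
  using trigpoly.wave[of k "c - pi/2"] by (simp add: cos_diff add_diff_eq)

lemma trigpoly_const: "trigpoly (\<lambda>z. r)"
  using trigpoly.scale[OF trigpoly.wave[of 0 0], of r] by simp

lemma trigpoly_sum: "(\<And>i. i \<in> I \<Longrightarrow> trigpoly (f i)) \<Longrightarrow> trigpoly (\<lambda>z. \<Sum>i\<in>I. f i z)"
  by (induction I rule: infinite_finite_induct) (auto intro: trigpoly_const trigpoly.add)

lemma trigpoly_wave_mult:
  assumes "\<And>i. k $ i \<in> \<int>" "trigpoly q"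
  shows "trigpoly (\<lambda>z. cos (k \<bullet> z + c) * q z)"
  using assms(2)
proof induction
  case (wave l d)
  have "trigpoly (\<lambda>z. (1/2) * (cos ((k - l) \<bullet> z + (c - d)) + cos ((k + l) \<bullet> z + (c + d))))"
    using assms(1) wave by (intro trigpoly.intros) auto
  also have "(\<lambda>z. (1/2) * (cos ((k - l) \<bullet> z + (c - d)) + cos ((k + l) \<bullet> z + (c + d)))) = (\<lambda>z. cos (k \<bullet> z + c) * cos (l \<bullet> z + d))"
    by (auto simp: cos_times_cos inner_diff_left inner_add_left algebra_simps)
  finally show ?case .
next
  case (add p q)
  from trigpoly.add[OF add.IH] show ?case by (simp add: distrib_left)
next
  case (scale p r)
  from trigpoly.scale[OF scale.IH, of r] show ?case by (simp add: mult_ac)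
qed

lemma trigpoly_mult: "trigpoly p \<Longrightarrow> trigpoly q \<Longrightarrow> trigpoly (\<lambda>z. p z * q z)"
proof (induction rule: trigpoly.induct)
  case (wave k c)
  then show ?case by (rule trigpoly_wave_mult)
next
  case (add p r)
  then show ?case using trigpoly.add[of "\<lambda>z. p z * q z" "\<lambda>z. r z * q z"] by (simp add: distrib_right)
next
  case (scale p r)
  then show ?case using trigpoly.scale[of "\<lambda>z. p z * q z" r] by (simp add: mult.assoc)
qed

lemma trigpoly_power: "trigpoly p \<Longrightarrow> trigpoly (\<lambda>z. p z ^ n)"
  by (induction n) (auto intro: trigpoly_const trigpoly_mult)

lemma trigpoly_shift: "trigpoly p \<Longrightarrow> trigpoly (\<lambda>z. p (z + w))"
proof (induction rule: trigpoly.induct)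
  case (wave k c)
  from trigpoly.wave[OF this, of "k \<bullet> w + c"] show ?case by (simp add: inner_add_right add_ac)
qed (auto intro: trigpoly.intros)

lemma trigpoly_uminus_arg: "trigpoly p \<Longrightarrow> trigpoly (\<lambda>z. p (- z))"
proof (induction rule: trigpoly.induct)
  case (wave k c)
  then show ?case using trigpoly.wave[of "-k" c] by simp
qed (auto intro: trigpoly.intros)

lemma trigpoly_periodic: "trigpoly p \<Longrightarrow> periodic p"
proof (induction rule: trigpoly.induct)
  case (wave k c)
  show ?case unfolding periodic_def
  proof (intro allI)
    fix x i
    obtain n where n: "k $ i = of_int n" using wave[of i] by (auto elim: Ints_cases)
    have "k \<bullet> (x + axis i (2 * pi)) + c = (k \<bullet> x + c) + 2 * pi * of_int n"
      by (simp add: inner_add_right inner_axis n)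
    moreover have "cos ((k \<bullet> x + c) + 2 * pi * of_int n) = cos (k \<bullet> x + c)"
      by (subst cos_add) (simp add: cos_int_2pin sin_int_2pin)
    ultimately show "cos (k \<bullet> (x + axis i (2 * pi)) + c) = cos (k \<bullet> x + c)"
      by (rule ssubst)
  qed
qed (auto simp: periodic_def)

lemma trigpoly_deriv:
  "trigpoly p \<Longrightarrow> \<exists>D. (\<forall>x. (p has_derivative D x) (at x)) \<and> (\<forall>h. trigpoly (\<lambda>x. D x h))"
proof (induction rule: trigpoly.induct)
  case (wave k c)
  have "((\<lambda>z. cos (k \<bullet> z + c)) has_derivative (\<lambda>h. (- (k \<bullet> h)) * sin (k \<bullet> x + c))) (at x)" for x
    by (auto intro!: derivative_eq_intros)
  moreover have "trigpoly (\<lambda>x. (- (k \<bullet> h)) * sin (k \<bullet> x + c))" for h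
    using wave by (intro trigpoly.scale trigpoly_sin)
  ultimately show ?case by (intro exI[where x="\<lambda>x h. (- (k \<bullet> h)) * sin (k \<bullet> x + c)"]) blast
next
  case (add p q)
  then obtain D E where "\<And>x. (p has_derivative D x) (at x)" "\<And>h. trigpoly (\<lambda>x. D x h)"
    "\<And>x. (q has_derivative E x) (at x)" "\<And>h. trigpoly (\<lambda>x. E x h)" by blast
  then show ?case by (intro exI[where x="\<lambda>x h. D x h + E x h"]) (auto intro!: derivative_intros trigpoly.add)
next
  case (scale p r)
  then obtain D where "\<And>x. (p has_derivative D x) (at x)" "\<And>h. trigpoly (\<lambda>x. D x h)" by blast
  then show ?case by (intro exI[where x="\<lambda>x h. r * D x h"]) (auto intro!: derivative_intros trigpoly.scale)
qed

lemma trigpoly_smooth: "trigpoly p \<Longrightarrow> smooth_on UNIV p"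
proof (rule smooth_on_closed_family[of trigpoly])
  show "\<exists>D. (\<forall>x\<in>UNIV. (g has_derivative D x) (at x)) \<and> (\<forall>h. trigpoly (\<lambda>x. D x h))" if "trigpoly g" for g
    using trigpoly_deriv[OF that] by simp
qed (auto intro: has_derivative_unique)

lemma trigpoly_differentiable: "trigpoly p \<Longrightarrow> p differentiable (at x)"
  using trigpoly_deriv[of p] by (auto simp: differentiable_def)

lemma trigpoly_partial: "trigpoly p \<Longrightarrow> trigpoly (partial j p)"
proof -
  assume "trigpoly p"
  then obtain D where D: "\<And>x. (p has_derivative D x) (at x)" "\<And>h. trigpoly (\<lambda>x. D x h)"
    using trigpoly_deriv by blast
  have "partial j p = (\<lambda>x. D x (axis j 1))"
    using frechet_derivative_at[OF D(1)] by (auto simp: partial_def)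
  with D(2) show ?thesis by simp
qed

lemma has_derivative_partial:
  assumes "p differentiable (at x)"
  shows "(p has_derivative (\<lambda>h. \<Sum>j\<in>UNIV. h $ j * partial j p x)) (at x)"
proof -
  have lin: "linear (frechet_derivative p (at x))" by (rule linear_frechet_derivative[OF assms])
  have "frechet_derivative p (at x) h = (\<Sum>j\<in>UNIV. h $ j * partial j p x)" for h
  proof -
    have "frechet_derivative p (at x) h = frechet_derivative p (at x) (\<Sum>j\<in>UNIV. h $ j *\<^sub>R axis j 1)"
      using basis_expansion[of h] by (simp add: scalar_mult_eq_scaleR)
    also have "\<dots> = (\<Sum>j\<in>UNIV. h $ j * partial j p x)"
      by (simp add: linear_sum[OF lin] linear_scale[OF lin] partial_def)
    finally show ?thesis .
  qed
  then have "frechet_derivative p (at x) = (\<lambda>h. \<Sum>j\<in>UNIV. h $ j * partial j p x)" by auto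
  with assms show ?thesis using frechet_derivative_works by metis
qed

lemma partial_eqI: "(p has_derivative D) (at x) \<Longrightarrow> partial j p x = D (axis j 1)"
  by (simp add: partial_def frechet_derivative_at[symmetric])

lemma partial_scale: "p differentiable (at x) \<Longrightarrow> partial j (\<lambda>z. r * p z) x = r * partial j p x"
  unfolding partial_def[of j p]
  by (rule partial_eqI) (auto intro!: derivative_intros simp: frechet_derivative_works[symmetric])

lemma partial_mult: "p differentiable (at x) \<Longrightarrow> q differentiable (at x) \<Longrightarrow> partial j (\<lambda>z. p z * q z) x = p x * partial j q x + partial j p x * q x"
  unfolding partial_def[of j p] partial_def[of j q]
  by (rule partial_eqI) (auto intro!: derivative_intros simp: frechet_derivative_works[symmetric])

lemma partial_sum: "finite I \<Longrightarrow> (\<And>i. i \<in> I \<Longrightarrow> f i differentiable (at x)) \<Longrightarrow> partial j (\<lambda>z. \<Sum>i\<in>I. f i z) x = (\<Sum>i\<in>I. partial j (f i) x)"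
  unfolding partial_def[of j "f _"]
  by (rule partial_eqI) (auto intro!: derivative_intros simp: frechet_derivative_works[symmetric])

lemma partial_shift: "p differentiable (at (x + w)) \<Longrightarrow> partial j (\<lambda>z. p (z + w)) x = partial j p (x + w)"
  unfolding partial_def[of j p]
  by (rule partial_eqI, rule has_derivative_compose[where f="\<lambda>z. z + w" and g=p, THEN has_derivative_eq_rhs])
    (auto intro!: derivative_eq_intros simp: frechet_derivative_works[symmetric])

lemma partial_uminus: "p differentiable (at (- x)) \<Longrightarrow> partial j (\<lambda>z. p (- z)) x = - partial j p (- x)"
proof -
  assume a: "p differentiable (at (- x))"
  have "((\<lambda>z. p (- z)) has_derivative (\<lambda>h. frechet_derivative p (at (- x)) (- h))) (at x)"
    by (rule has_derivative_compose[where f="\<lambda>z. - z" and g=p, THEN has_derivative_eq_rhs])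
      (use a in \<open>auto intro!: derivative_eq_intros simp: frechet_derivative_works[symmetric]\<close>)
  from partial_eqI[OF this] show ?thesis using linear_frechet_derivative[OF a] by (simp add: partial_def linear_neg)
qed

lemma partial_wave: "partial j (\<lambda>z. cos (k \<bullet> z + c)) x = - (k $ j) * sin (k \<bullet> x + c)"
  by (rule trans[OF partial_eqI[where D="\<lambda>h. (- (k \<bullet> h)) * sin (k \<bullet> x + c)"]])
    (auto intro!: derivative_eq_intros simp: inner_axis)

lemma trigpoly_continuous: "trigpoly p \<Longrightarrow> continuous_on S p"
  by (meson continuous_at_imp_continuous_on differentiable_imp_continuous_within trigpoly_differentiable)

lemma trigpoly_borel: "trigpoly p \<Longrightarrow> p \<in> borel_measurable borel"
  by (intro borel_measurable_continuous_onI trigpoly_continuous)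

lemma trigpoly_bounded: "trigpoly p \<Longrightarrow> \<exists>B\<ge>0. \<forall>z. \<bar>p z\<bar> \<le> B"
proof (induction rule: trigpoly.induct)
  case (wave k c)
  show ?case by (intro exI[of _ 1]) auto
next
  case (add p q)
  then obtain A B where "A \<ge> 0" "\<forall>z. \<bar>p z\<bar> \<le> A" "B \<ge> 0" "\<forall>z. \<bar>q z\<bar> \<le> B" by blast
  then show ?case by (intro exI[of _ "A + B"]) (auto intro: order_trans[OF abs_triangle_ineq] add_mono)
next
  case (scale p r)
  then obtain A where "A \<ge> 0" "\<forall>z. \<bar>p z\<bar> \<le> A" by blast
  then show ?case by (intro exI[of _ "\<bar>r\<bar> * A"]) (auto simp: abs_mult intro: mult_left_mono)
qed

text \<open>The addition theorem. A convolution with a trigonometric kernel thus has finite rank, and every exchange of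
  integrals involving it is a rearrangement of finite sums, even if the other factors are merely integrable.\<close>

lemma trigpoly_separate:
  "trigpoly p \<Longrightarrow> \<exists>(n::nat) \<alpha> \<beta>. (\<forall>m<n. trigpoly (\<alpha> m) \<and> trigpoly (\<beta> m)) \<and> (\<forall>x y. p (x - y) = (\<Sum>m<n. \<alpha> m x * \<beta> m y))"
proof (induction rule: trigpoly.induct)
  case (wave k c)
  define \<alpha> where "\<alpha> = (\<lambda>m::nat. if m = 0 then (\<lambda>x. cos (k \<bullet> x + c)) else (\<lambda>x. sin (k \<bullet> x + c)))"
  define \<beta> where "\<beta> = (\<lambda>m::nat. if m = 0 then (\<lambda>x. cos (k \<bullet> x + 0)) else (\<lambda>x. sin (k \<bullet> x + 0)))"
  have "\<forall>m<2. trigpoly (\<alpha> m) \<and> trigpoly (\<beta> m)"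
    using wave by (auto simp only: \<alpha>_def \<beta>_def split: if_splits intro!: trigpoly.wave trigpoly_sin)
  moreover have "\<forall>x y. cos (k \<bullet> (x - y) + c) = (\<Sum>m<2. \<alpha> m x * \<beta> m y)"
  proof (intro allI)
    fix x y
    have "k \<bullet> (x - y) + c = (k \<bullet> x + c) - k \<bullet> y" by (simp add: inner_diff_right)
    then have "cos (k \<bullet> (x - y) + c) = cos (k \<bullet> x + c) * cos (k \<bullet> y) + sin (k \<bullet> x + c) * sin (k \<bullet> y)"
      by (simp only: cos_diff)
    then show "cos (k \<bullet> (x - y) + c) = (\<Sum>m<2. \<alpha> m x * \<beta> m y)"
      by (simp add: \<alpha>_def \<beta>_def numeral_2_eq_2)
  qed
  ultimately show ?case by blast
next
  case (add p q)
  obtain n :: nat and \<alpha> \<beta> where 1: "\<forall>m<n. trigpoly (\<alpha> m) \<and> trigpoly (\<beta> m)" "\<forall>x y. p (x - y) = (\<Sum>m<n. \<alpha> m x * \<beta> m y)"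
    using add.IH(1) by blast
  obtain n' :: nat and \<alpha>' \<beta>' where 2: "\<forall>m<n'. trigpoly (\<alpha>' m) \<and> trigpoly (\<beta>' m)" "\<forall>x y. q (x - y) = (\<Sum>m<n'. \<alpha>' m x * \<beta>' m y)"
    using add.IH(2) by blast
  define A where "A m = (if m < n then \<alpha> m else \<alpha>' (m - n))" for m :: nat
  define B where "B m = (if m < n then \<beta> m else \<beta>' (m - n))" for m :: nat
  have "\<forall>m<n+n'. trigpoly (A m) \<and> trigpoly (B m)" using 1(1) 2(1) by (auto simp: A_def B_def)
  moreover have "(\<Sum>m<n+n'. A m x * B m y) = p (x - y) + q (x - y)" for x y
  proof -
    have split: "(\<Sum>m<n+k. F m) = (\<Sum>m<n. F m) + (\<Sum>m<k. F (n + m))" for F :: "nat \<Rightarrow> real" and k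
      by (induction k) auto
    have "(\<Sum>m<n+n'. A m x * B m y) = (\<Sum>m<n. A m x * B m y) + (\<Sum>m<n'. A (n + m) x * B (n + m) y)"
      by (rule split)
    then show ?thesis by (simp add: 1(2) 2(2) A_def B_def)
  qed
  ultimately show ?case by (intro exI[of _ "n+n'"] exI[of _ A] exI[of _ B]) auto
next
  case (scale p r)
  then obtain n :: nat and \<alpha> \<beta> where 1: "\<forall>m<n. trigpoly (\<alpha> m) \<and> trigpoly (\<beta> m)" "\<forall>x y. p (x - y) = (\<Sum>m<n. \<alpha> m x * \<beta> m y)"
    by blast
  then show ?case
    by (intro exI[of _ n] exI[of _ "\<lambda>m z. r * \<alpha> m z"] exI[of _ \<beta>])
      (auto simp: sum_distrib_left mult.assoc intro: trigpoly.scale)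
qed

section \<open>Convolution with a trigonometric kernel\<close>

lemma borel_measurable_torus: "u \<in> borel_measurable lebesgue \<Longrightarrow> u \<in> borel_measurable torus"
  by (rule measurable_restrict_space1)

lemma trigpoly_measurable_torus: "trigpoly p \<Longrightarrow> p \<in> borel_measurable torus"
  by (intro borel_measurable_torus measurable_completion) (simp add: trigpoly_borel)

lemma integrable_mult_trigpoly:
  assumes "integrable torus a" "trigpoly p"
  shows "integrable torus (\<lambda>x. a x * p x)"
proof -
  obtain B where B: "B \<ge> 0" "\<And>z. \<bar>p z\<bar> \<le> B" using trigpoly_bounded[OF assms(2)] by blast
  show ?thesis
  proof (rule Bochner_Integration.integrable_bound)
    show "integrable torus (\<lambda>x. B * \<bar>a x\<bar>)" using assms(1) by simp
    show "(\<lambda>x. a x * p x) \<in> borel_measurable torus"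
      using assms trigpoly_measurable_torus by simp
    show "AE x in torus. norm (a x * p x) \<le> norm (B * \<bar>a x\<bar>)"
    proof (rule AE_I2)
      fix x show "norm (a x * p x) \<le> norm (B * \<bar>a x\<bar>)"
        using mult_right_mono[OF B(2)[of x], of "\<bar>a x\<bar>"] B(1) by (simp add: abs_mult mult_ac)
    qed
  qed
qed

lemma integrable_trigpoly: "trigpoly p \<Longrightarrow> integrable torus p"
  by (rule torus_integral_eq(1)) (rule trigpoly_continuous)

definition convolve :: "(real^3 \<Rightarrow> real) \<Rightarrow> (real^3 \<Rightarrow> real) \<Rightarrow> real^3 \<Rightarrow> real"
  where "convolve p b x = (LINT y|torus. p (x - y) * b y)"

definition conv_form :: "(real^3 \<Rightarrow> real) \<Rightarrow> (real^3 \<Rightarrow> real) \<Rightarrow> (real^3 \<Rightarrow> real) \<Rightarrow> real"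
  where "conv_form p a b = (LINT x|torus. a x * convolve p b x)"

lemma convolve_separated:
  assumes "\<forall>m<n. trigpoly (\<alpha> m) \<and> trigpoly (\<beta> m)" "\<forall>x y. p (x - y) = (\<Sum>m<(n::nat). \<alpha> m x * \<beta> m y)"
    and b: "integrable torus b"
  shows "convolve p b x = (\<Sum>m<n. \<alpha> m x * (LINT y|torus. b y * \<beta> m y))"
proof -
  have "convolve p b x = (LINT y|torus. (\<Sum>m<n. \<alpha> m x * (b y * \<beta> m y)))"
    unfolding convolve_def assms(2)[rule_format] sum_distrib_right by (simp add: mult_ac)
  also have "\<dots> = (\<Sum>m<n. \<alpha> m x * (LINT y|torus. b y * \<beta> m y))"
    using assms(1) by (subst Bochner_Integration.integral_sum) (auto intro!: integrable_mult_trigpoly b)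
  finally show ?thesis .
qed

lemma trigpoly_convolve:
  assumes "trigpoly p" "integrable torus b"
  shows "trigpoly (convolve p b)"
proof -
  obtain n :: nat and \<alpha> \<beta> where 1: "\<forall>m<n. trigpoly (\<alpha> m) \<and> trigpoly (\<beta> m)" "\<forall>x y. p (x - y) = (\<Sum>m<n. \<alpha> m x * \<beta> m y)"
    using trigpoly_separate[OF assms(1)] by blast
  have "convolve p b = (\<lambda>x. \<Sum>m<n. (LINT y|torus. b y * \<beta> m y) * \<alpha> m x)"
    using convolve_separated[OF 1 assms(2)] by (auto simp: mult.commute)
  with 1(1) show ?thesis by (auto intro!: trigpoly_sum trigpoly.scale)
qed

lemma partial_convolve:
  assumes p: "trigpoly p" and b: "integrable torus b"
  shows "partial j (convolve p b) = convolve (partial j p) b"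
proof
  fix x
  obtain n :: nat and \<alpha> \<beta> where 1: "\<forall>m<n. trigpoly (\<alpha> m) \<and> trigpoly (\<beta> m)" "\<forall>x y. p (x - y) = (\<Sum>m<n. \<alpha> m x * \<beta> m y)"
    using trigpoly_separate[OF p] by blast
  have df: "\<alpha> m differentiable (at x)" if "m < n" for m x
    using 1(1) that trigpoly_differentiable by blast
  have 2: "\<forall>x y. partial j p (x - y) = (\<Sum>m<n. partial j (\<alpha> m) x * \<beta> m y)"
  proof (intro allI)
    fix x y
    have "partial j p (x - y) = partial j (\<lambda>z. p (z + (- y))) x"
      using partial_shift[of p x "- y" j] trigpoly_differentiable[OF p] by simp
    also have "(\<lambda>z. p (z + (- y))) = (\<lambda>z. \<Sum>m<n. \<beta> m y * \<alpha> m z)" using 1(2) by (auto simp: mult.commute)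
    also have "partial j \<dots> x = (\<Sum>m<n. \<beta> m y * partial j (\<alpha> m) x)"
      using df by (subst partial_sum) (auto simp: partial_scale intro!: derivative_intros)
    also have "\<dots> = (\<Sum>m<n. partial j (\<alpha> m) x * \<beta> m y)" by (simp add: mult.commute)
    finally show "partial j p (x - y) = (\<Sum>m<n. partial j (\<alpha> m) x * \<beta> m y)" .
  qed
  have "convolve p b = (\<lambda>x. \<Sum>m<n. (LINT y|torus. b y * \<beta> m y) * \<alpha> m x)"
    using convolve_separated[OF 1 b] by (auto simp: mult.commute)
  then have "partial j (convolve p b) x = partial j (\<lambda>x. \<Sum>m<n. (LINT y|torus. b y * \<beta> m y) * \<alpha> m x) x" by simp
  also have "\<dots> = (\<Sum>m<n. (LINT y|torus. b y * \<beta> m y) * partial j (\<alpha> m) x)"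
    using df by (subst partial_sum) (auto simp: partial_scale intro!: derivative_intros)
  also have "\<dots> = (\<Sum>m<n. partial j (\<alpha> m) x * (LINT y|torus. b y * \<beta> m y))"
    by (simp add: mult.commute)
  also have "\<dots> = convolve (partial j p) b x"
    using 1(1) 2 by (intro convolve_separated[symmetric] b) (auto intro: trigpoly_partial)
  finally show "partial j (convolve p b) x = convolve (partial j p) b x" .
qed

lemma trigpoly_reflect: "trigpoly p \<Longrightarrow> trigpoly (\<lambda>y. p (x - y))"
  using trigpoly_uminus_arg[OF trigpoly_shift[of p x]] by simp

lemma convolve_integrand: "trigpoly p \<Longrightarrow> integrable torus b \<Longrightarrow> integrable torus (\<lambda>y. p (x - y) * b y)"
  using integrable_mult_trigpoly[OF _ trigpoly_reflect[of p x], of b] by (simp add: mult.commute)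

lemma convolve_add_kernel:
  assumes "trigpoly p" "trigpoly q" "integrable torus b"
  shows "convolve (\<lambda>z. p z + q z) b x = convolve p b x + convolve q b x"
  unfolding convolve_def using assms by (simp add: distrib_right convolve_integrand)

lemma convolve_scale_kernel: "convolve (\<lambda>z. r * p z) b x = r * convolve p b x"
  unfolding convolve_def by (simp add: mult.assoc)

lemma convolve_diff:
  assumes "trigpoly p" "integrable torus a" "integrable torus b"
  shows "convolve p (\<lambda>y. a y - b y) x = convolve p a x - convolve p b x"
  unfolding convolve_def using assms by (simp add: right_diff_distrib convolve_integrand)

lemma conv_form_integrable: "trigpoly p \<Longrightarrow> integrable torus a \<Longrightarrow> integrable torus b \<Longrightarrow> integrable torus (\<lambda>x. a x * convolve p b x)"
  by (intro integrable_mult_trigpoly trigpoly_convolve)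

text \<open>In terms of the factors of the kernel, the form is a finite sum of products of moments. Its dependence on time is
  read off from this, because the moments of a weakly continuous field are continuous.\<close>

lemma conv_form_separated:
  assumes 1: "\<forall>m<n. trigpoly (\<alpha> m) \<and> trigpoly (\<beta> m)" "\<forall>x y. p (x - y) = (\<Sum>m<(n::nat). \<alpha> m x * \<beta> m y)"
    and a: "integrable torus a" and b: "integrable torus b"
  shows "conv_form p a b = (\<Sum>m<n. (LINT x|torus. a x * \<alpha> m x) * (LINT y|torus. b y * \<beta> m y))"
proof -
  have "conv_form p a b = (LINT x|torus. (\<Sum>m<n. (a x * \<alpha> m x) * (LINT y|torus. b y * \<beta> m y)))"
    unfolding conv_form_def convolve_separated[OF 1 b] sum_distrib_left by (simp add: mult_ac)
  also have "\<dots> = (\<Sum>m<n. (LINT x|torus. a x * \<alpha> m x) * (LINT y|torus. b y * \<beta> m y))"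
    using 1(1) by (subst Bochner_Integration.integral_sum) (auto intro!: integrable_mult_trigpoly a)
  finally show ?thesis .
qed

lemma conv_form_flip:
  assumes p: "trigpoly p" and a: "integrable torus a" and b: "integrable torus b"
  shows "conv_form p a b = conv_form (\<lambda>z. p (- z)) b a"
proof -
  obtain n :: nat and \<alpha> \<beta> where 1: "\<forall>m<n. trigpoly (\<alpha> m) \<and> trigpoly (\<beta> m)" "\<forall>x y. p (x - y) = (\<Sum>m<n. \<alpha> m x * \<beta> m y)"
    using trigpoly_separate[OF p] by blast
  have 2: "\<forall>x y. p (- (x - y)) = (\<Sum>m<n. \<beta> m x * \<alpha> m y)"
    using 1(2) by (simp add: mult.commute)
  have "conv_form (\<lambda>z. p (- z)) b a = (\<Sum>m<n. (LINT x|torus. b x * \<beta> m x) * (LINT y|torus. a y * \<alpha> m y))"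
    by (rule conv_form_separated) (use 1(1) 2 a b in auto)
  with conv_form_separated[OF 1 a b] show ?thesis by (simp add: mult.commute)
qed

lemma conv_form_add_kernel:
  assumes "trigpoly p" "trigpoly q" "integrable torus a" "integrable torus b"
  shows "conv_form (\<lambda>z. p z + q z) a b = conv_form p a b + conv_form q a b"
  unfolding conv_form_def using assms by (simp add: convolve_add_kernel distrib_left conv_form_integrable)

lemma conv_form_scale_kernel: "conv_form (\<lambda>z. r * p z) a b = r * conv_form p a b"
  unfolding conv_form_def by (simp add: convolve_scale_kernel mult.left_commute)

lemma convolve_one:
  assumes "trigpoly p"
  shows "convolve p (\<lambda>_. 1) x = (LINT y|torus. p (- y))"
proof -
  have "trigpoly (\<lambda>y. p (- y))" using assms by (rule trigpoly_uminus_arg)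
  from integral_torus_translate[OF trigpoly_continuous[OF this] trigpoly_periodic[OF this], of "- x"]
  show ?thesis by (simp add: convolve_def)
qed

lemma conv_form_one:
  assumes "trigpoly p" "integrable torus a"
  shows "conv_form p a (\<lambda>_. 1) = (LINT y|torus. p (- y)) * (LINT x|torus. a x)"
  by (simp add: conv_form_def convolve_one[OF assms(1)] mult.commute)

lemma integral_partial_trigpoly: "trigpoly p \<Longrightarrow> (LINT x|torus. partial j p x) = 0"
  by (intro integral_torus_partial_eq_0 trigpoly_differentiable trigpoly_continuous trigpoly_partial trigpoly_periodic)

text \<open>Since \<open>2 a(x) a(y) \<le> a(x)\<^sup>2 + a(y)\<^sup>2\<close> and the kernel has mass one in either variable,
  mollification does not increase the energy. This holds for every square integrable function, hence for the
  velocity at every time and for its gradient.\<close>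

lemma conv_form_le_square:
  assumes p: "trigpoly p" and nonneg: "\<And>z. p z \<ge> 0" and even: "\<And>z. p (- z) = p z" and one: "(LINT z|torus. p z) = 1"
    and a: "integrable torus a" and a2: "integrable torus (\<lambda>x. (a x)\<^sup>2)"
  shows "conv_form p a a \<le> (LINT x|torus. (a x)\<^sup>2)"
proof -
  have c1: "integrable torus (\<lambda>_. 1::real)" using integrable_trigpoly[OF trigpoly_const] .
  have one': "convolve p (\<lambda>_. 1) x = 1" for x using convolve_one[OF p] one by (simp add: even)
  have pt: "a x * convolve p a x \<le> (a x)\<^sup>2 / 2 + convolve p (\<lambda>y. (a y)\<^sup>2) x / 2" for x
  proof -
    have "a x * convolve p a x = (LINT y|torus. p (x - y) * (a x * a y))"
    proof -
      have "(\<lambda>y. p (x - y) * (a x * a y)) = (\<lambda>y. a x * (p (x - y) * a y))" by auto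
      then show ?thesis by (simp add: convolve_def)
    qed
    also have "\<dots> \<le> (LINT y|torus. (a x)\<^sup>2 / 2 * (p (x - y) * 1) + (p (x - y) * (a y)\<^sup>2) / 2)"
    proof (rule integral_mono)
      show "integrable torus (\<lambda>y. p (x - y) * (a x * a y))" using convolve_integrand[OF p, of "\<lambda>y. a x * a y"] a by simp
      show "integrable torus (\<lambda>y. (a x)\<^sup>2 / 2 * (p (x - y) * 1) + (p (x - y) * (a y)\<^sup>2) / 2)"
        using convolve_integrand[OF p c1] convolve_integrand[OF p a2] by simp
      fix y
      have "a x * a y \<le> (a x)\<^sup>2 / 2 + (a y)\<^sup>2 / 2" using sum_squares_bound[of "a x" "a y"] by simp
      from mult_left_mono[OF this nonneg[of "x - y"]]
      show "p (x - y) * (a x * a y) \<le> (a x)\<^sup>2 / 2 * (p (x - y) * 1) + (p (x - y) * (a y)\<^sup>2) / 2"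
        by (simp add: algebra_simps)
    qed
    also have "\<dots> = (a x)\<^sup>2 / 2 * convolve p (\<lambda>_. 1) x + convolve p (\<lambda>y. (a y)\<^sup>2) x / 2"
      using convolve_integrand[OF p c1] convolve_integrand[OF p a2] by (simp add: convolve_def)
    finally show ?thesis by (simp add: one')
  qed
  have ic: "integrable torus (convolve p (\<lambda>y. (a y)\<^sup>2))" by (intro integrable_trigpoly trigpoly_convolve p a2)
  have "conv_form p a a \<le> (LINT x|torus. (a x)\<^sup>2 / 2 + convolve p (\<lambda>y. (a y)\<^sup>2) x / 2)"
    unfolding conv_form_def by (rule integral_mono) (use pt a2 ic conv_form_integrable[OF p a a] in auto)
  also have "\<dots> = (LINT x|torus. (a x)\<^sup>2) / 2 + conv_form p (\<lambda>_. 1) (\<lambda>y. (a y)\<^sup>2) / 2"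
    using a2 ic by (simp add: conv_form_def)
  also have "conv_form p (\<lambda>_. 1) (\<lambda>y. (a y)\<^sup>2) = (LINT x|torus. (a x)\<^sup>2)"
    using conv_form_flip[OF p c1 a2] conv_form_one[OF p a2] one by (simp add: even)
  finally show ?thesis by simp
qed

section \<open>Square integrable periodic fields\<close>

lemma integrable_of_square:
  fixes a :: "real^3 \<Rightarrow> real"
  assumes "a \<in> borel_measurable torus" "integrable torus (\<lambda>x. (a x)\<^sup>2)"
  shows "integrable torus a"
proof (rule Bochner_Integration.integrable_bound)
  show "integrable torus (\<lambda>x. 1 + (a x)\<^sup>2)"
    using assms integrable_trigpoly[OF trigpoly_const] by simp
  show "AE x in torus. norm (a x) \<le> norm (1 + (a x)\<^sup>2)"
  proof (rule AE_I2)
    fix x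
    have "2 * \<bar>a x\<bar> \<le> 1 + (a x)\<^sup>2" using sum_squares_bound[of "\<bar>a x\<bar>" 1] by simp
    then show "norm (a x) \<le> norm (1 + (a x)\<^sup>2)" by simp
  qed
qed (use assms in auto)

lemma L2_measurable: "u \<in> L2 \<Longrightarrow> u \<in> borel_measurable torus"
  by (auto simp: L2_def intro: borel_measurable_torus)

lemma L2_component:
  fixes u :: "real^3 \<Rightarrow> real^3"
  assumes "u \<in> L2"
  shows "(\<lambda>x. u x $ i) \<in> borel_measurable torus" "integrable torus (\<lambda>x. (u x $ i)\<^sup>2)" "integrable torus (\<lambda>x. u x $ i)"
proof -
  have m: "u \<in> borel_measurable torus" using assms by (rule L2_measurable)
  show 1: "(\<lambda>x. u x $ i) \<in> borel_measurable torus"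
    using borel_measurable_inner[OF m borel_measurable_const[of "axis i 1"]] by (simp add: inner_axis)
  show 2: "integrable torus (\<lambda>x. (u x $ i)\<^sup>2)"
  proof (rule Bochner_Integration.integrable_bound)
    show "integrable torus (\<lambda>x. (norm (u x))\<^sup>2)" using assms by (simp add: L2_def)
    show "AE x in torus. norm ((u x $ i)\<^sup>2) \<le> norm ((norm (u x))\<^sup>2)"
      by (rule AE_I2) (simp add: abs_le_square_iff[symmetric] component_le_norm_cart)
  qed (use 1 in auto)
  show "integrable torus (\<lambda>x. u x $ i)" by (rule integrable_of_square[OF 1 2])
qed

lemma L2_matrix_row:
  fixes G :: "real^3 \<Rightarrow> real^3^3"
  assumes "G \<in> L2"
  shows "(\<lambda>x. G x $ i) \<in> L2"
proof -
  have m: "G \<in> borel_measurable lebesgue" and p: "periodic G" and n: "integrable torus (\<lambda>x. (norm (G x))\<^sup>2)"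
    using assms by (auto simp: L2_def)
  have 1: "(\<lambda>x. G x $ i) \<in> borel_measurable lebesgue"
    by (rule borel_measurable_continuous_on[OF _ m, of "\<lambda>A. A $ i"]) (intro continuous_intros)
  have "integrable torus (\<lambda>x. (norm (G x $ i))\<^sup>2)"
  proof (rule Bochner_Integration.integrable_bound[OF n])
    show "(\<lambda>x. (norm (G x $ i))\<^sup>2) \<in> borel_measurable torus" using borel_measurable_torus[OF 1] by simp
    show "AE x in torus. norm ((norm (G x $ i))\<^sup>2) \<le> norm ((norm (G x))\<^sup>2)"
      by (rule AE_I2) (simp add: Finite_Cartesian_Product.norm_nth_le power_mono)
  qed
  with 1 p show ?thesis by (simp add: L2_def periodic_def)
qed

lemma weak_gradient_trigpoly:
  assumes "has_weak_gradient u G" "trigpoly p"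
  shows "(LINT x|torus. u x $ i * partial j p x) = - (LINT x|torus. G x $ i $ j * p x)"
  using assms trigpoly_smooth trigpoly_periodic unfolding has_weak_gradient_def partial_def by blast

lemma square_norm_vec: "(norm (x :: real^3))\<^sup>2 = (\<Sum>i\<in>UNIV. (x $ i)\<^sup>2)"
  unfolding power2_norm_eq_inner inner_vec_def by (simp add: power2_eq_square)

lemma L2_norm_sq: "u \<in> L2 \<Longrightarrow> (L2_norm u)\<^sup>2 = (LINT x|torus. (norm (u x))\<^sup>2)"
  unfolding L2_norm_def L2_inner_def by (simp add: power2_norm_eq_inner[symmetric])

lemma L2_norm_nonneg: "L2_norm u \<ge> 0"
  unfolding L2_norm_def L2_inner_def by simp

lemma L2_norm_eq: "L2_norm u = sqrt (LINT x|torus. (norm (u x))\<^sup>2)"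
  unfolding L2_norm_def L2_inner_def by (simp add: power2_norm_eq_inner[symmetric])

lemma L2_inner_CS: "u \<in> L2 \<Longrightarrow> w \<in> L2 \<Longrightarrow> \<bar>L2_inner u w\<bar> \<le> L2_norm u * L2_norm w"
  unfolding L2_inner_def L2_norm_eq by (intro Cauchy_Schwarz_L2 L2_measurable) (auto simp: L2_def)

lemma L2_diff:
  assumes "u \<in> L2" "w \<in> L2"
  shows "(\<lambda>x. u x - w x) \<in> L2"
proof -
  have "integrable torus (\<lambda>x. (norm (u x - w x))\<^sup>2)"
  proof (rule Bochner_Integration.integrable_bound)
    show "integrable torus (\<lambda>x. 2 * (norm (u x))\<^sup>2 + 2 * (norm (w x))\<^sup>2)" using assms by (simp add: L2_def)
    show "(\<lambda>x. (norm (u x - w x))\<^sup>2) \<in> borel_measurable torus" using assms[THEN L2_measurable] by simp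
    show "AE x in torus. norm ((norm (u x - w x))\<^sup>2) \<le> norm (2 * (norm (u x))\<^sup>2 + 2 * (norm (w x))\<^sup>2)"
    proof (rule AE_I2)
      fix x
      have "(norm (u x - w x))\<^sup>2 \<le> (norm (u x) + norm (w x))\<^sup>2" by (intro power_mono norm_triangle_ineq4) simp
      also have "\<dots> \<le> 2 * (norm (u x))\<^sup>2 + 2 * (norm (w x))\<^sup>2"
        using sum_squares_bound[of "norm (u x)" "norm (w x)"] by (simp add: power2_sum)
      finally show "norm ((norm (u x - w x))\<^sup>2) \<le> norm (2 * (norm (u x))\<^sup>2 + 2 * (norm (w x))\<^sup>2)" by simp
    qed
  qed
  with assms show ?thesis by (auto simp: L2_def periodic_def)
qed

lemma continuous_periodic_L2:
  fixes u :: "real^3 \<Rightarrow> 'a::euclidean_space"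
  assumes "continuous_on UNIV u" "periodic u"
  shows "u \<in> L2"
proof -
  have "continuous_on UNIV (\<lambda>x. (norm (u x))\<^sup>2)" using assms(1) by (intro continuous_intros)
  from torus_integral_eq(1)[OF this] have "integrable torus (\<lambda>x. (norm (u x))\<^sup>2)" .
  moreover have "u \<in> borel_measurable lebesgue"
    using borel_measurable_continuous_onI[OF assms(1)] by (intro measurable_completion) simp
  ultimately show ?thesis using assms(2) by (simp add: L2_def)
qed

section \<open>A nonnegative trigonometric approximate identity\<close>

text \<open>A wave without phase is even, and \<open>cos (k \<bullet> (x - y))\<close> is the sum of a product of cosines and a
  product of sines. The associated quadratic form is therefore a combination of squares of Fourier moments.\<close>

inductive cospoly :: "(real^3 \<Rightarrow> real) \<Rightarrow> bool" where
  wave: "(\<And>i. k $ i \<in> \<int>) \<Longrightarrow> cospoly (\<lambda>z. cos (k \<bullet> z))"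
| add: "cospoly p \<Longrightarrow> cospoly q \<Longrightarrow> cospoly (\<lambda>z. p z + q z)"
| scale: "cospoly p \<Longrightarrow> cospoly (\<lambda>z. r * p z)"

lemma cospoly_trigpoly: "cospoly p \<Longrightarrow> trigpoly p"
proof (induction rule: cospoly.induct)
  case (wave k)
  from trigpoly.wave[OF this, of 0] show ?case by simp
qed (auto intro: trigpoly.intros)

lemma cospoly_even: "cospoly p \<Longrightarrow> p (- z) = p z"
  by (induction rule: cospoly.induct) auto

lemma cospoly_const: "cospoly (\<lambda>z. r)"
  using cospoly.scale[OF cospoly.wave[of 0], of r] by simp

lemma cospoly_wave_mult:
  assumes "\<And>i. k $ i \<in> \<int>" "cospoly q"
  shows "cospoly (\<lambda>z. cos (k \<bullet> z) * q z)"
  using assms(2)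
proof induction
  case (wave l)
  have "cospoly (\<lambda>z. (1/2) * (cos ((k - l) \<bullet> z) + cos ((k + l) \<bullet> z)))"
    using assms(1) wave by (intro cospoly.intros) auto
  also have "(\<lambda>z. (1/2) * (cos ((k - l) \<bullet> z) + cos ((k + l) \<bullet> z))) = (\<lambda>z. cos (k \<bullet> z) * cos (l \<bullet> z))"
    by (auto simp: cos_times_cos inner_diff_left inner_add_left)
  finally show ?case .
next
  case (add p q)
  from cospoly.add[OF add.IH] show ?case by (simp add: distrib_left)
next
  case (scale p r)
  from cospoly.scale[OF scale.IH, of r] show ?case by (simp add: mult_ac)
qed

lemma cospoly_mult: "cospoly p \<Longrightarrow> cospoly q \<Longrightarrow> cospoly (\<lambda>z. p z * q z)"
proof (induction rule: cospoly.induct)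
  case (wave k)
  then show ?case by (rule cospoly_wave_mult)
next
  case (add p r)
  then show ?case using cospoly.add[of "\<lambda>z. p z * q z" "\<lambda>z. r z * q z"] by (simp add: distrib_right)
next
  case (scale p r)
  then show ?case using cospoly.scale[of "\<lambda>z. p z * q z" r] by (simp add: mult.assoc)
qed

lemma cospoly_power: "cospoly p \<Longrightarrow> cospoly (\<lambda>z. p z ^ n)"
  by (induction n) (auto intro: cospoly_const cospoly_mult)

definition cos2 :: "3 \<Rightarrow> real^3 \<Rightarrow> real" where "cos2 i z = (1 + cos (z $ i)) / 2"
definition sin2 :: "3 \<Rightarrow> real^3 \<Rightarrow> real" where "sin2 i z = (1 - cos (z $ i)) / 2"
text \<open>Up to normalisation, with equal exponents \<open>n\<close>, the product of three de la Vallee-Poussin kernels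
  \<open>cos\<^sup>2\<^sup>n (z\<^sub>i / 2)\<close>.\<close>

definition cweight :: "(3 \<Rightarrow> nat) \<Rightarrow> real^3 \<Rightarrow> real" where "cweight n z = cos2 1 z ^ n 1 * cos2 2 z ^ n 2 * cos2 3 z ^ n 3"

lemma cospoly_cos: "cospoly (\<lambda>z. cos (z $ i))"
proof -
  have "cospoly (\<lambda>z. cos (axis i 1 \<bullet> z))" by (rule cospoly.wave) (simp add: axis_def)
  then show ?thesis by (simp add: inner_axis')
qed

lemma cospoly_cos2: "cospoly (cos2 i)"
proof -
  have "cospoly (\<lambda>z. (1/2) * (1 + cos (z $ i)))" by (intro cospoly.scale cospoly.add cospoly_const cospoly_cos)
  then show ?thesis by (simp add: cos2_def[abs_def])
qed

lemma cospoly_sin2: "cospoly (sin2 i)"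
proof -
  have "cospoly (\<lambda>z. (1/2) * (1 + (-1) * cos (z $ i)))" by (intro cospoly.scale cospoly.add cospoly_const cospoly_cos)
  then show ?thesis by (simp add: sin2_def[abs_def])
qed

lemma cospoly_cweight: "cospoly (cweight n)"
  unfolding cweight_def[abs_def] by (intro cospoly_mult cospoly_power cospoly_cos2)

lemmas trigpoly_cos2 = cospoly_trigpoly[OF cospoly_cos2]
lemmas trigpoly_sin2 = cospoly_trigpoly[OF cospoly_sin2]
lemmas trigpoly_cweight = cospoly_trigpoly[OF cospoly_cweight]

lemma cos2_nonneg: "cos2 i z \<ge> 0" and sin2_nonneg: "sin2 i z \<ge> 0" and cos2_sin2: "cos2 i z = 1 - sin2 i z"
  and cos2_le_1: "cos2 i z \<le> 1" and sin2_le_1: "sin2 i z \<le> 1"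
proof -
  have "0 \<le> 1 + cos (z $ i)" using cos_ge_minus_one[of "z $ i"] by linarith
  then show "cos2 i z \<ge> 0" "sin2 i z \<ge> 0" "cos2 i z = 1 - sin2 i z" "cos2 i z \<le> 1" "sin2 i z \<le> 1"
    by (auto simp: cos2_def sin2_def field_simps)
qed

lemma cweight_nonneg: "cweight n z \<ge> 0"
  by (simp add: cweight_def cos2_nonneg)

lemma sin2_eq_sin: "sin2 i z = (sin (z $ i / 2))\<^sup>2"
  using cos_double_sin[of "z $ i / 2"] by (simp add: sin2_def)

lemma cweight_Suc: "cweight (n(i := Suc (n i))) z = cweight n z * cos2 i z"
  using exhaust_3[of i] by (auto simp: cweight_def)

lemma partial_power: "p differentiable (at x) \<Longrightarrow> partial j (\<lambda>z. p z ^ n) x = real n * p x ^ (n - 1) * partial j p x"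
  unfolding partial_def[of j p]
  by (rule partial_eqI[THEN trans], rule has_derivative_power)
    (auto simp: frechet_derivative_works[symmetric] mult_ac)

lemma partial_cos2: "partial j (cos2 i) z = (if i = j then - sin (z $ i) / 2 else 0)"
  unfolding cos2_def[abs_def]
  by (rule trans[OF partial_eqI[where D="\<lambda>h. - (h $ i) * sin (z $ i) / 2"]])
    (auto intro!: derivative_eq_intros bounded_linear.has_derivative[OF bounded_linear_vec_nth] simp: axis_def)

lemma partial_cweight:
  "partial i (cweight n) z = - real (n i) * (sin (z $ i) / 2) * cweight (n(i := n i - 1)) z"
proof -
  have d: "cos2 j differentiable (at z)" for j by (rule trigpoly_differentiable[OF trigpoly_cos2])
  have dp: "(\<lambda>z. cos2 j z ^ m) differentiable (at z)" for j m
    by (rule trigpoly_differentiable) (intro trigpoly_power trigpoly_cos2)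
  have dm: "(\<lambda>z. cos2 j z ^ m * cos2 l z ^ k) differentiable (at z)" for j m l k
    by (rule trigpoly_differentiable) (intro trigpoly_mult trigpoly_power trigpoly_cos2)
  show ?thesis
    unfolding cweight_def[abs_def] 
    using exhaust_3[of i]
    by (subst partial_mult[OF dm dp], subst partial_mult[OF dp dp]) (auto simp: partial_power[OF d] partial_cos2)
qed

lemma int_cweight_pos: "(LINT z|torus. cweight n z) > 0"
proof -
  have c: "continuous_on S (cweight n)" for S by (rule trigpoly_continuous[OF trigpoly_cweight])
  have eq: "(LINT z|torus. cweight n z) = integral cell (cweight n)" by (rule torus_integral_eq(2)[OF c])
  have ge: "(LINT z|torus. cweight n z) \<ge> 0" by (simp add: cweight_nonneg)
  have "(LINT z|torus. cweight n z) \<noteq> 0"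
  proof
    assume "(LINT z|torus. cweight n z) = 0"
    then have hi: "(cweight n has_integral 0) cell"
      using eq integrable_integral[OF integrable_continuous[OF c]] by metis
    have "cweight n 0 = 0"
    proof (rule has_integral_0_cbox_imp_0[OF c _ hi])
      show "box 0 (vec (2 * pi)) \<noteq> ({} :: (real^3) set)"
        by (simp add: box_ne_empty inner_Basis vec_eq_iff) (auto simp: Basis_vec_def inner_axis)
    qed (auto simp: cweight_nonneg mem_box_cart)
    then show False by (simp add: cweight_def cos2_def)
  qed
  with ge show ?thesis by linarith
qed

text \<open>The integral of the derivative of \<open>cweight n z sin z\<^sub>i\<close> in direction \<open>i\<close> vanishes.
  This is the recursion behind Wallis' product; all moments of the kernel are derived from it.\<close>

lemma int_cweight_sin2: "(LINT z|torus. cweight n z * sin2 i z) = (LINT z|torus. cweight n z) / (2 * (real (n i) + 1))"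
proof -
  have tps: "trigpoly (\<lambda>z. sin (z $ i))"
  proof -
    have "trigpoly (\<lambda>z. sin (axis i 1 \<bullet> z + 0))" by (rule trigpoly_sin) (simp add: axis_def)
    then show ?thesis by (simp add: inner_axis')
  qed
  have ps: "partial i (\<lambda>z. sin (z $ i)) z = cos (z $ i)" for z
    by (rule trans[OF partial_eqI[where D="\<lambda>h. (h $ i) * cos (z $ i)"]])
      (auto intro!: derivative_eq_intros bounded_linear.has_derivative[OF bounded_linear_vec_nth] simp: axis_def)
  have eq: "partial i (\<lambda>z. cweight n z * sin (z $ i)) z = cweight n z - 2 * (real (n i) + 1) * (cweight n z * sin2 i z)" for z
  proof -
    have sc: "sin (z $ i) * sin (z $ i) = 4 * (sin2 i z * cos2 i z)"
      by (simp add: sin2_def cos2_def field_simps) (use sin_cos_squared_add3[of "z $ i"] in linarith)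
    have w: "real (n i) * (cweight (n(i := n i - 1)) z * cos2 i z) = real (n i) * cweight n z"
    proof (cases "n i")
      case (Suc m)
      have "cweight ((n(i := m))(i := Suc ((n(i := m)) i))) z = cweight (n(i := m)) z * cos2 i z" by (rule cweight_Suc)
      moreover have "(n(i := m))(i := Suc ((n(i := m)) i)) = n" using Suc by auto
      ultimately show ?thesis using Suc by simp
    qed simp
    have "partial i (\<lambda>z. cweight n z * sin (z $ i)) z = cweight n z * cos (z $ i) + partial i (cweight n) z * sin (z $ i)"
      by (subst partial_mult) (auto simp: ps intro: trigpoly_differentiable trigpoly_cweight tps)
    also have "partial i (cweight n) z * sin (z $ i) = - (1/2) * (real (n i) * cweight (n(i := n i - 1)) z * (sin (z $ i) * sin (z $ i)))"
      by (simp add: partial_cweight)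
    also have "\<dots> = - 2 * sin2 i z * (real (n i) * (cweight (n(i := n i - 1)) z * cos2 i z))"
      by (simp add: sc)
    also have "\<dots> = - 2 * sin2 i z * (real (n i) * cweight n z)" by (simp only: w)
    finally show ?thesis by (simp add: sin2_def field_simps)
  qed
  have i1: "integrable torus (cweight n)" "integrable torus (\<lambda>z. cweight n z * sin2 i z)"
    by (intro integrable_trigpoly trigpoly_mult trigpoly_cweight trigpoly_sin2)+
  have "0 = (LINT z|torus. partial i (\<lambda>z. cweight n z * sin (z $ i)) z)"
    by (rule integral_partial_trigpoly[symmetric]) (intro trigpoly_mult trigpoly_cweight tps)
  also have "\<dots> = (LINT z|torus. cweight n z) - 2 * (real (n i) + 1) * (LINT z|torus. cweight n z * sin2 i z)"
    using i1 by (simp add: eq)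
  finally show ?thesis by (simp add: field_simps)
qed

lemma int_cweight_Suc: "(LINT z|torus. cweight (n(i := Suc (n i))) z) = (LINT z|torus. cweight n z) * (1 - 1 / (2 * (real (n i) + 1)))"
proof -
  have "(LINT z|torus. cweight (n(i := Suc (n i))) z) = (LINT z|torus. cweight n z - cweight n z * sin2 i z)"
    by (simp only: cweight_Suc cos2_sin2 right_diff_distrib mult_1_right)
  also have "\<dots> = (LINT z|torus. cweight n z) - (LINT z|torus. cweight n z * sin2 i z)"
    by (rule Bochner_Integration.integral_diff) (intro integrable_trigpoly trigpoly_mult trigpoly_cweight trigpoly_sin2)+
  finally show ?thesis unfolding int_cweight_sin2 by (simp add: right_diff_distrib)
qed

text \<open>One factor \<open>sin\<^sup>2 (z\<^sub>i / 2) = 1 - cos\<^sup>2 (z\<^sub>i / 2)\<close> is absorbed into the weight,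
  so that the recursion applies twice.\<close>

lemma int_cweight_sin4_le: "(LINT z|torus. cweight n z * (sin2 i z)\<^sup>2) \<le> (LINT z|torus. cweight n z) * (3 / (4 * (real (n i) + 1)\<^sup>2))"
proof -
  define m where "m = real (n i) + 1"
  have m: "m \<ge> 1" by (simp add: m_def)
  have "(LINT z|torus. cweight n z * (sin2 i z)\<^sup>2) = (LINT z|torus. cweight n z * sin2 i z - cweight (n(i := Suc (n i))) z * sin2 i z)"
  proof (rule Bochner_Integration.integral_cong)
    fix z show "cweight n z * (sin2 i z)\<^sup>2 = cweight n z * sin2 i z - cweight (n(i := Suc (n i))) z * sin2 i z"
      by (simp add: cweight_Suc cos2_sin2 power2_eq_square algebra_simps)
  qed simp
  also have "\<dots> = (LINT z|torus. cweight n z * sin2 i z) - (LINT z|torus. cweight (n(i := Suc (n i))) z * sin2 i z)"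
    by (rule Bochner_Integration.integral_diff) (intro integrable_trigpoly trigpoly_mult trigpoly_cweight trigpoly_sin2)+
  also have "\<dots> = (LINT z|torus. cweight n z) * (1 / (2 * m) - (1 - 1 / (2 * m)) / (2 * (m + 1)))"
    unfolding int_cweight_sin2 int_cweight_Suc by (simp add: m_def field_simps)
  also have "1 / (2 * m) - (1 - 1 / (2 * m)) / (2 * (m + 1)) = 3 / (4 * m * (m + 1))"
    using m by (simp add: divide_simps)
  also have "(LINT z|torus. cweight n z) * (3 / (4 * m * (m + 1))) \<le> (LINT z|torus. cweight n z) * (3 / (4 * m\<^sup>2))"
    using m int_cweight_pos[of n] by (intro mult_left_mono) (auto simp: power2_eq_square divide_simps)
  finally show ?thesis by (simp add: m_def)
qed

definition kern :: "nat \<Rightarrow> real^3 \<Rightarrow> real"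
  where "kern N z = (1 / (LINT y|torus. cweight (\<lambda>_. Suc N) y)) * cweight (\<lambda>_. Suc N) z"

text \<open>A periodic substitute for \<open>|z|\<close>, comparable to the distance of \<open>z\<close> from the lattice
  \<open>(2\<pi>\<int>)\<^sup>3\<close>. The kernel concentrates at all corners of the cell, most of which are far
  from the origin.\<close>

definition tdist :: "real^3 \<Rightarrow> real" where "tdist z = (\<Sum>i\<in>UNIV. \<bar>sin (z $ i / 2)\<bar>)"

definition sin2_sum :: "real^3 \<Rightarrow> real" where "sin2_sum z = (\<Sum>i\<in>UNIV. sin2 i z)"

lemma cospoly_kern: "cospoly (kern N)"
  unfolding kern_def[abs_def] by (intro cospoly.scale cospoly_cweight)

lemmas trigpoly_kern = cospoly_trigpoly[OF cospoly_kern]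
lemmas kern_even = cospoly_even[OF cospoly_kern]

lemma kern_nonneg: "kern N z \<ge> 0"
  using int_cweight_pos[of "\<lambda>_. Suc N"] by (simp add: kern_def cweight_nonneg)

lemma int_kern: "(LINT z|torus. kern N z) = 1"
  using int_cweight_pos[of "\<lambda>_. Suc N"] by (simp add: kern_def)

lemma tdist_nonneg: "tdist z \<ge> 0" by (simp add: tdist_def sum_nonneg)

lemma tdist_sq_le: "(tdist z)\<^sup>2 \<le> 3 * sin2_sum z"
  using Cauchy_Schwarz_ineq_sum[of "\<lambda>_. 1" "\<lambda>i. \<bar>sin (z $ i / 2)\<bar>" "UNIV :: 3 set"]
  by (simp add: tdist_def sin2_sum_def sin2_eq_sin)

lemma sin2_sum_nonneg: "sin2_sum z \<ge> 0" by (simp add: sin2_sum_def sum_nonneg sin2_nonneg)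
lemma trigpoly_sin2_sum: "trigpoly sin2_sum" unfolding sin2_sum_def[abs_def] by (intro trigpoly_sum trigpoly_sin2)
lemma sin2_sum_even: "sin2_sum (- z) = sin2_sum z" by (simp add: sin2_sum_def sin2_def)

lemma int_kern_sin2_sum: "(LINT z|torus. kern N z * sin2_sum z) \<le> 3 / (real N + 1)"
proof -
  let ?n = "\<lambda>_. Suc N"
  have "(LINT z|torus. kern N z * sin2_sum z) = (LINT z|torus. (\<Sum>i\<in>UNIV. (1 / (LINT y|torus. cweight ?n y)) * (cweight ?n z * sin2 i z)))"
    by (simp add: kern_def sin2_sum_def sum_distrib_left mult.assoc)
  also have "\<dots> = (\<Sum>i\<in>UNIV. (1 / (LINT y|torus. cweight ?n y)) * (LINT z|torus. cweight ?n z * sin2 i z))"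
    by (subst Bochner_Integration.integral_sum, intro integrable_trigpoly trigpoly.scale trigpoly_mult trigpoly_cweight trigpoly_sin2, simp)
  also have "\<dots> = 3 / (2 * (real N + 2))"
    using int_cweight_pos[of ?n] by (simp add: int_cweight_sin2)
  also have "\<dots> \<le> 3 / (real N + 1)" by (simp add: divide_simps)
  finally show ?thesis .
qed

text \<open>Differentiation in direction \<open>i\<close> lowers one exponent of the kernel; this is the resulting weight with
  the normalisation of the original kernel.\<close>

definition kern_slope :: "nat \<Rightarrow> 3 \<Rightarrow> real^3 \<Rightarrow> real"
  where "kern_slope N i z = (1 / (LINT y|torus. cweight (\<lambda>_. Suc N) y)) * cweight ((\<lambda>_. Suc N)(i := N)) z"

lemma trigpoly_kern_slope: "trigpoly (kern_slope N i)"
  unfolding kern_slope_def[abs_def] by (intro trigpoly.scale trigpoly_cweight)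

lemma kern_slope_nonneg: "kern_slope N i z \<ge> 0"
  using int_cweight_pos[of "\<lambda>_. Suc N"] by (simp add: kern_slope_def cweight_nonneg)

lemma int_kern_slope: "(LINT z|torus. cweight ((\<lambda>_. Suc N)(i := N)) z) \<le> 2 * (LINT z|torus. cweight (\<lambda>_. Suc N) z)"
proof -
  let ?m = "(\<lambda>_. Suc N)(i := N)"
  have e: "?m(i := Suc (?m i)) = (\<lambda>_. Suc N)" by auto
  have "(LINT z|torus. cweight (\<lambda>_. Suc N) z) = (LINT z|torus. cweight ?m z) * (1 - 1 / (2 * (real N + 1)))"
    using int_cweight_Suc[of ?m i] unfolding e by simp
  moreover have "1 - 1 / (2 * (real N + 1)) \<ge> 1/2" by (simp add: divide_simps)
  ultimately show ?thesis
    using mult_left_mono[of "1/2" "1 - 1 / (2 * (real N + 1))" "LINT z|torus. cweight ?m z"] int_cweight_pos[of ?m] by simp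
qed

text \<open>The derivative of \<open>cos\<^sup>2\<^sup>n (z\<^sub>i / 2)\<close> has \<open>2n - 1\<close> factors
  \<open>cos (z\<^sub>i / 2)\<close>. One of them is estimated by one, to keep an even power, that is, a
  trigonometric polynomial.\<close>

lemma abs_partial_kern_le: "\<bar>partial i (kern N) z\<bar> \<le> (real N + 1) * kern_slope N i z * \<bar>sin (z $ i / 2)\<bar>"
proof -
  let ?A = "LINT y|torus. cweight (\<lambda>_. Suc N) y"
  have A: "?A > 0" by (rule int_cweight_pos)
  have "partial i (kern N) z = (1 / ?A) * partial i (cweight (\<lambda>_. Suc N)) z"
    unfolding kern_def[abs_def] by (rule partial_scale) (rule trigpoly_differentiable[OF trigpoly_cweight])
  also have "\<dots> = - ((real N + 1) * kern_slope N i z * (sin (z $ i) / 2))"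
    using A by (simp add: partial_cweight kern_slope_def field_simps)
  finally have "\<bar>partial i (kern N) z\<bar> = (real N + 1) * kern_slope N i z * (\<bar>sin (z $ i)\<bar> / 2)"
    by (simp add: abs_mult kern_slope_nonneg)
  also have "\<bar>sin (z $ i)\<bar> / 2 \<le> \<bar>sin (z $ i / 2)\<bar>"
  proof -
    have "sin (z $ i) = 2 * sin (z $ i / 2) * cos (z $ i / 2)" using sin_double[of "z $ i / 2"] by simp
    then have "\<bar>sin (z $ i)\<bar> / 2 = \<bar>sin (z $ i / 2)\<bar> * \<bar>cos (z $ i / 2)\<bar>" by (simp add: abs_mult)
    also have "\<dots> \<le> \<bar>sin (z $ i / 2)\<bar> * 1" by (intro mult_left_mono) auto
    finally show ?thesis by simp
  qed
  then have "(real N + 1) * kern_slope N i z * (\<bar>sin (z $ i)\<bar> / 2) \<le> (real N + 1) * kern_slope N i z * \<bar>sin (z $ i / 2)\<bar>"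
    by (intro mult_left_mono) (auto simp: kern_slope_nonneg)
  finally show ?thesis .
qed

text \<open>A trigonometric majorant of the slope of the kernel times the distance. Its integral stays bounded, as the scaling
  of an approximate identity predicts.\<close>

definition slope_majorant1 :: "nat \<Rightarrow> 3 \<Rightarrow> real^3 \<Rightarrow> real"
  where "slope_majorant1 N i z = 2 * (real N + 1) * (kern_slope N i z * sin2_sum z)"

lemma trigpoly_slope_majorant1: "trigpoly (slope_majorant1 N i)"
  unfolding slope_majorant1_def[abs_def] by (intro trigpoly.scale trigpoly_mult trigpoly_kern_slope trigpoly_sin2_sum)

text \<open>Products of two sines are estimated by their squares, whose moments are known.\<close>

lemma partial_kern_tdist: "\<bar>partial i (kern N) z\<bar> * tdist z \<le> slope_majorant1 N i z"
proof -
  let ?s = "\<lambda>l. \<bar>sin (z $ l / 2)\<bar>"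
  have "?s i * tdist z = (\<Sum>l\<in>UNIV. ?s i * ?s l)" by (simp add: tdist_def sum_distrib_left)
  also have "\<dots> \<le> (\<Sum>l\<in>UNIV. (sin2 i z + sin2 l z) / 2)"
  proof (rule sum_mono)
    fix l
    show "?s i * ?s l \<le> (sin2 i z + sin2 l z) / 2"
      using sum_squares_bound[of "?s i" "?s l"] by (simp add: sin2_eq_sin)
  qed
  also have "\<dots> = (3 * sin2 i z + sin2_sum z) / 2" by (simp add: sin2_sum_def sum.distrib add_divide_distrib sum_divide_distrib)
  also have "\<dots> \<le> 2 * sin2_sum z"
    using member_le_sum[of i UNIV "\<lambda>i. sin2 i z"] by (simp add: sin2_sum_def sin2_nonneg)
  finally have *: "?s i * tdist z \<le> 2 * sin2_sum z" .
  have "\<bar>partial i (kern N) z\<bar> * tdist z \<le> (real N + 1) * kern_slope N i z * ?s i * tdist z"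
    by (intro mult_right_mono abs_partial_kern_le tdist_nonneg)
  also have "\<dots> = (real N + 1) * kern_slope N i z * (?s i * tdist z)" by simp
  also have "\<dots> \<le> (real N + 1) * kern_slope N i z * (2 * sin2_sum z)"
    by (intro mult_left_mono *) (simp add: kern_slope_nonneg)
  also have "\<dots> = slope_majorant1 N i z" by (simp add: slope_majorant1_def)
  finally show ?thesis .
qed

lemma int_kern_slope_sin2: "(LINT z|torus. kern_slope N i z * sin2 l z) \<le> 1 / (real N + 1)"
proof -
  let ?m = "(\<lambda>_. Suc N)(i := N)" and ?A = "LINT y|torus. cweight (\<lambda>_. Suc N) y"
  have A: "?A > 0" by (rule int_cweight_pos)
  have "(LINT z|torus. kern_slope N i z * sin2 l z) = (1 / ?A) * (LINT z|torus. cweight ?m z * sin2 l z)"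
    by (simp add: kern_slope_def mult.assoc)
  also have "\<dots> = (1 / ?A) * ((LINT z|torus. cweight ?m z) / (2 * (real (?m l) + 1)))" by (simp only: int_cweight_sin2)
  also have "\<dots> \<le> (1 / ?A) * ((2 * ?A) / (2 * (real N + 1)))"
    using A int_cweight_pos[of ?m] by (intro mult_left_mono frac_le int_kern_slope) auto
  also have "\<dots> = 1 / (real N + 1)" using A by (simp add: field_simps)
  finally show ?thesis .
qed

lemma int_kern_slope_sin4: "(LINT z|torus. kern_slope N i z * (sin2 l z)\<^sup>2) \<le> 2 / (real N + 1)\<^sup>2"
proof -
  let ?m = "(\<lambda>_. Suc N)(i := N)" and ?A = "LINT y|torus. cweight (\<lambda>_. Suc N) y"
  have A: "?A > 0" by (rule int_cweight_pos)
  have "(LINT z|torus. kern_slope N i z * (sin2 l z)\<^sup>2) = (1 / ?A) * (LINT z|torus. cweight ?m z * (sin2 l z)\<^sup>2)"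
    by (simp add: kern_slope_def mult.assoc)
  also have "\<dots> \<le> (1 / ?A) * ((LINT z|torus. cweight ?m z) * (3 / (4 * (real (?m l) + 1)\<^sup>2)))"
    using A by (intro mult_left_mono int_cweight_sin4_le) auto
  also have "\<dots> \<le> (1 / ?A) * ((2 * ?A) * (1 / (real N + 1)\<^sup>2))"
    using A int_cweight_pos[of ?m]
    by (intro mult_left_mono mult_mono int_kern_slope) (auto simp: divide_simps intro!: mult_mono power_mono)
  also have "\<dots> = 2 / (real N + 1)\<^sup>2" using A by simp
  finally show ?thesis .
qed

lemma int_kern_slope_sin2_sum: "(LINT z|torus. kern_slope N i z * sin2_sum z) \<le> 3 / (real N + 1)"
proof -
  have "(LINT z|torus. kern_slope N i z * sin2_sum z) = (\<Sum>l\<in>UNIV. LINT z|torus. kern_slope N i z * sin2 l z)"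
    unfolding sin2_sum_def sum_distrib_left
    by (rule Bochner_Integration.integral_sum) (intro integrable_trigpoly trigpoly_mult trigpoly_kern_slope trigpoly_sin2)
  also have "\<dots> \<le> (\<Sum>l\<in>(UNIV::3 set). 1 / (real N + 1))" by (intro sum_mono int_kern_slope_sin2)
  finally show ?thesis by simp
qed

lemma int_slope_majorant1: "(LINT z|torus. slope_majorant1 N i z) \<le> 6"
proof -
  have "(LINT z|torus. slope_majorant1 N i z) = 2 * (real N + 1) * (LINT z|torus. kern_slope N i z * sin2_sum z)"
    by (simp add: slope_majorant1_def)
  also have "\<dots> \<le> 2 * (real N + 1) * (3 / (real N + 1))" by (intro mult_left_mono int_kern_slope_sin2_sum) auto
  also have "\<dots> = 6" by (simp add: field_simps)
  finally show ?thesis .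
qed

text \<open>A majorant of the slope times the squared distance, of integral \<open>O(1 / sqrt N)\<close>. The expression to be
  bounded is cubic in the sines; \<open>|s| \<le> (sqrt (N + 1) s\<^sup>2 + 1 / sqrt (N + 1)) / 2\<close> turns it
  into even powers at the correct scale.\<close>

definition slope_majorant2 :: "nat \<Rightarrow> 3 \<Rightarrow> real^3 \<Rightarrow> real"
  where "slope_majorant2 N i z = 3/2 * (real N + 1) * (3 * sqrt (real N + 1) * (\<Sum>l\<in>UNIV. kern_slope N i z * (sin2 l z)\<^sup>2) + (1 / sqrt (real N + 1)) * (kern_slope N i z * sin2_sum z))"

lemma trigpoly_slope_majorant2: "trigpoly (slope_majorant2 N i)"
  unfolding slope_majorant2_def[abs_def]
  by (intro trigpoly.scale trigpoly.add trigpoly_sum trigpoly_mult trigpoly_kern_slope trigpoly_sin2_sum trigpoly_power trigpoly_sin2)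

lemma partial_kern_tdist2: "\<bar>partial i (kern N) z\<bar> * (tdist z)\<^sup>2 \<le> slope_majorant2 N i z"
proof -
  let ?s = "\<bar>sin (z $ i / 2)\<bar>" and ?r = "sqrt (real N + 1)"
  have r: "?r > 0" by simp
  have a: "?s \<le> (?r * sin2_sum z + 1 / ?r) / 2"
  proof -
    have "2 * ?r * ?s * 1 \<le> (?r * ?s)\<^sup>2 + 1" using sum_squares_bound[of "?r * ?s" 1] by simp
    also have "(?r * ?s)\<^sup>2 = ?r\<^sup>2 * sin2 i z" by (simp add: power_mult_distrib sin2_eq_sin)
    also have "?r\<^sup>2 * sin2 i z \<le> ?r\<^sup>2 * sin2_sum z"
      using member_le_sum[of i UNIV "\<lambda>i. sin2 i z"] by (intro mult_left_mono) (auto simp: sin2_sum_def sin2_nonneg)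
    also have "?r\<^sup>2 * sin2_sum z + 1 = ?r * (?r * sin2_sum z + 1 / ?r)"
      using r by (simp only: distrib_left power2_eq_square) simp
    finally have "?r * (2 * ?s) \<le> ?r * (?r * sin2_sum z + 1 / ?r)" by (simp add: mult_ac)
    then have "2 * ?s \<le> ?r * sin2_sum z + 1 / ?r" using r by (simp only: mult_le_cancel_left_pos)
    then show ?thesis by simp
  qed
  have b: "(sin2_sum z)\<^sup>2 \<le> 3 * (\<Sum>l\<in>UNIV. (sin2 l z)\<^sup>2)"
    using Cauchy_Schwarz_ineq_sum[of "\<lambda>_. 1" "\<lambda>i. sin2 i z" "UNIV :: 3 set"] by (simp add: sin2_sum_def)
  have "?s * (tdist z)\<^sup>2 \<le> ((?r * sin2_sum z + 1 / ?r) / 2) * (3 * sin2_sum z)"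
    using sin2_sum_nonneg[of z] r by (intro mult_mono a tdist_sq_le) auto
  also have "\<dots> = 3/2 * (?r * (sin2_sum z)\<^sup>2 + (1 / ?r) * sin2_sum z)" by (simp add: power2_eq_square algebra_simps)
  also have "\<dots> \<le> 3/2 * (?r * (3 * (\<Sum>l\<in>UNIV. (sin2 l z)\<^sup>2)) + (1 / ?r) * sin2_sum z)"
    using b r by (intro mult_left_mono add_right_mono) auto
  finally have *: "?s * (tdist z)\<^sup>2 \<le> 3/2 * (?r * (3 * (\<Sum>l\<in>UNIV. (sin2 l z)\<^sup>2)) + (1 / ?r) * sin2_sum z)" .
  have "\<bar>partial i (kern N) z\<bar> * (tdist z)\<^sup>2 \<le> (real N + 1) * kern_slope N i z * ?s * (tdist z)\<^sup>2"
    by (intro mult_right_mono abs_partial_kern_le) simp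
  also have "\<dots> = (real N + 1) * kern_slope N i z * (?s * (tdist z)\<^sup>2)" by simp
  also have "\<dots> \<le> (real N + 1) * kern_slope N i z * (3/2 * (?r * (3 * (\<Sum>l\<in>UNIV. (sin2 l z)\<^sup>2)) + (1 / ?r) * sin2_sum z))"
    by (intro mult_left_mono *) (simp add: kern_slope_nonneg)
  also have "\<dots> = slope_majorant2 N i z"
    by (simp add: slope_majorant2_def sum_distrib_left[symmetric] algebra_simps)
  finally show ?thesis .
qed

lemma int_slope_majorant2: "(LINT z|torus. slope_majorant2 N i z) \<le> 32 / sqrt (real N + 1)"
proof -
  let ?r = "sqrt (real N + 1)"
  have r: "?r > 0" "?r\<^sup>2 = real N + 1" by simp_all
  have i: "integrable torus (\<lambda>z. kern_slope N i z * (sin2 l z)\<^sup>2)" "integrable torus (\<lambda>z. kern_slope N i z * sin2_sum z)" for l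
    by (intro integrable_trigpoly trigpoly_mult trigpoly_kern_slope trigpoly_sin2_sum trigpoly_power trigpoly_sin2)+
  have "(LINT z|torus. slope_majorant2 N i z) = 3/2 * (real N + 1) * (3 * ?r * (\<Sum>l\<in>UNIV. LINT z|torus. kern_slope N i z * (sin2 l z)\<^sup>2) + (1 / ?r) * (LINT z|torus. kern_slope N i z * sin2_sum z))"
    unfolding slope_majorant2_def using i by simp
  also have "\<dots> \<le> 3/2 * (real N + 1) * (3 * ?r * (\<Sum>l\<in>(UNIV::3 set). 2 / (real N + 1)\<^sup>2) + (1 / ?r) * (3 / (real N + 1)))"
    using r by (intro mult_left_mono add_mono sum_mono int_kern_slope_sin4 int_kern_slope_sin2_sum) auto
  also have "\<dots> = 3/2 * ?r\<^sup>2 * (18 * ?r / (?r\<^sup>2)\<^sup>2 + (1 / ?r) * (3 / ?r\<^sup>2))"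
    unfolding r(2) by simp
  also have "\<dots> = (63/2) / ?r"
  proof -
    have "3/2 * x\<^sup>2 * (18 * x / (x\<^sup>2)\<^sup>2 + (1 / x) * (3 / x\<^sup>2)) = (63/2) / x" if "x > 0" for x :: real
      using that by (simp add: field_simps power2_eq_square)
    then show ?thesis using r(1) .
  qed
  also have "\<dots> \<le> 32 / ?r" using r(1) by (intro divide_right_mono) auto
  finally show ?thesis .
qed

section \<open>Uniform approximation of continuous periodic functions\<close>

definition cper :: "(real^3 \<Rightarrow> real) \<Rightarrow> bool"
  where "cper a \<longleftrightarrow> continuous_on UNIV a \<and> periodic a"

lemma periodic_lattice:
  assumes "periodic u" and w: "\<And>i. \<exists>n::int. w $ i = z $ i + 2 * pi * of_int n"
  shows "u w = u z"
proof -
  have one: "u (x + axis i (2 * pi * of_int n)) = u x" for x i and n :: int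
  proof (induction n rule: int_induct[where k=0])
    case base
    have "x + axis i (2 * pi * of_int 0) = x" by (simp add: vec_eq_iff axis_def)
    then show ?case by (rule arg_cong)
  next
    case (step1 n)
    have "x + axis i (2 * pi * of_int (n + 1)) = (x + axis i (2 * pi * of_int n)) + axis i (2 * pi)"
      by (simp add: vec_eq_iff axis_def algebra_simps)
    then show ?case using step1 assms(1) unfolding periodic_def by metis
  next
    case (step2 n)
    have "x + axis i (2 * pi * of_int n) = (x + axis i (2 * pi * of_int (n - 1))) + axis i (2 * pi)"
      by (simp add: vec_eq_iff axis_def algebra_simps)
    then show ?case using step2 assms(1) unfolding periodic_def by metis
  qed
  from w obtain n :: "3 \<Rightarrow> int" where n: "\<And>i. w $ i = z $ i + 2 * pi * of_int (n i)" by metis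
  have "w = z + axis 1 (2 * pi * of_int (n 1)) + axis 2 (2 * pi * of_int (n 2)) + axis 3 (2 * pi * of_int (n 3))"
    using n by (simp add: vec_eq_iff axis_def forall_3)
  then show ?thesis by (simp only: one)
qed

text \<open>From \<open>|sin t - t| \<le> |t|\<^sup>3 / 6\<close> and \<open>t\<^sup>2 \<le> 3\<close>.\<close>

lemma abs_le_sin:
  fixes t :: real
  assumes "\<bar>t\<bar> \<le> pi / 2"
  shows "\<bar>t\<bar> \<le> 2 * \<bar>sin t\<bar>"
proof -
  have "\<bar>sin t - (\<Sum>m<3. sin_coeff m * t ^ m)\<bar> \<le> inverse (fact 3) * \<bar>t\<bar> ^ 3" by (rule Maclaurin_sin_bound)
  moreover have "(\<Sum>m<3. sin_coeff m * t ^ m) = t" by (simp add: sin_coeff_def eval_nat_numeral)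
  ultimately have 1: "\<bar>sin t - t\<bar> \<le> \<bar>t\<bar> ^ 3 / 6" by (simp add: fact_numeral)
  have "\<bar>t\<bar> \<le> 17/10" using assms pi_approx by simp
  then have "\<bar>t\<bar>\<^sup>2 \<le> (17/10)\<^sup>2" by (intro power_mono) auto
  then have "\<bar>t\<bar>\<^sup>2 \<le> 3" by (simp add: power2_eq_square)
  then have "\<bar>t\<bar> * \<bar>t\<bar>\<^sup>2 \<le> \<bar>t\<bar> * 3" by (intro mult_left_mono) auto
  then have "\<bar>t\<bar> ^ 3 / 6 \<le> \<bar>t\<bar> / 2" by (simp add: power2_eq_square power3_eq_cube)
  with 1 show ?thesis by linarith
qed

text \<open>Rounding \<open>z\<^sub>i / (2\<pi>)\<close> selects the representative of \<open>z\<close> modulo the lattice with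
  \<open>|w\<^sub>i| \<le> \<pi>\<close>.\<close>

lemma tdist_lift:
  obtains w where "\<And>i. \<exists>n::int. w $ i = z $ i + 2 * pi * of_int n" "norm w \<le> 4 * tdist z"
proof -
  define w :: "real^3" where "w = (\<chi> i. z $ i - 2 * pi * of_int (round (z $ i / (2 * pi))))"
  have 1: "\<exists>n::int. w $ i = z $ i + 2 * pi * of_int n" for i
    by (rule exI[of _ "- round (z $ i / (2 * pi))"]) (simp add: w_def)
  have 2: "\<bar>w $ i\<bar> \<le> 4 * \<bar>sin (z $ i / 2)\<bar>" for i
  proof -
    let ?n = "round (z $ i / (2 * pi))"
    have w: "w $ i = 2 * pi * (z $ i / (2 * pi) - of_int ?n)" by (simp add: w_def field_simps)
    have "\<bar>of_int ?n - z $ i / (2 * pi)\<bar> \<le> 1/2" by (rule of_int_round_abs_le)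
    then have "\<bar>z $ i / (2 * pi) - of_int ?n\<bar> \<le> 1/2" by linarith
    then have "2 * pi * \<bar>z $ i / (2 * pi) - of_int ?n\<bar> \<le> 2 * pi * (1/2)" by (intro mult_left_mono) auto
    then have "\<bar>w $ i\<bar> \<le> pi" unfolding w abs_mult by simp
    then have "\<bar>w $ i / 2\<bar> \<le> 2 * \<bar>sin (w $ i / 2)\<bar>" by (intro abs_le_sin) simp
    moreover have "\<bar>sin (w $ i / 2)\<bar> = \<bar>sin (z $ i / 2)\<bar>"
    proof -
      have "w $ i / 2 = z $ i / 2 - pi * of_int ?n" by (simp add: w_def field_simps)
      then have "sin (w $ i / 2) = sin (z $ i / 2) * cos (pi * of_int ?n) - cos (z $ i / 2) * sin (pi * of_int ?n)"
        by (simp only: sin_diff)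
      then show ?thesis by (simp add: abs_mult cos_npi_int sin_npi_int)
    qed
    ultimately show ?thesis by simp
  qed
  have "norm w \<le> (\<Sum>i\<in>UNIV. \<bar>w $ i\<bar>)" by (rule norm_le_l1_cart)
  also have "\<dots> \<le> (\<Sum>i\<in>UNIV. 4 * \<bar>sin (z $ i / 2)\<bar>)" by (intro sum_mono 2)
  also have "\<dots> = 4 * tdist z" by (simp add: tdist_def sum_distrib_left)
  finally show ?thesis using 1 that by blast
qed

lemma tdist_le_3: "tdist z \<le> 3"
  using sum_bounded_above[of UNIV "\<lambda>i. \<bar>sin (z $ i / 2)\<bar>" 1] by (simp add: tdist_def)

lemma cper_integrable: "cper a \<Longrightarrow> integrable torus a"
  by (simp add: cper_def torus_integral_eq(1))

lemma cper_trigpoly: "trigpoly p \<Longrightarrow> cper p"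
  by (simp add: cper_def trigpoly_continuous trigpoly_periodic)

lemma cper_const: "cper (\<lambda>_. c)" by (simp add: cper_def periodic_def)
lemma cper_mult: "cper a \<Longrightarrow> cper b \<Longrightarrow> cper (\<lambda>x. a x * b x)"
  by (auto simp: cper_def periodic_def intro!: continuous_intros)
lemma cper_diff: "cper a \<Longrightarrow> cper b \<Longrightarrow> cper (\<lambda>x. a x - b x)"
  by (auto simp: cper_def periodic_def intro!: continuous_intros)
lemma cper_power: "cper a \<Longrightarrow> cper (\<lambda>x. a x ^ n)"
  by (auto simp: cper_def periodic_def intro!: continuous_intros)
lemma cper_sum: "(\<And>i. i \<in> I \<Longrightarrow> cper (f i)) \<Longrightarrow> cper (\<lambda>x. \<Sum>i\<in>I. f i x)"
  by (auto simp: cper_def periodic_def intro!: continuous_intros sum.cong)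
lemma cper_shift: "cper a \<Longrightarrow> cper (\<lambda>x. a (x + w))"
  unfolding cper_def by (auto intro!: periodic_shift continuous_on_compose2[of UNIV a] continuous_intros)
lemma cper_translate: "cper a \<Longrightarrow> (LINT x|torus. a (x + w)) = (LINT x|torus. a x)"
  by (simp add: cper_def integral_torus_translate)

lemma cper_bounded:
  assumes "cper a"
  obtains B where "B \<ge> 0" "\<And>x. \<bar>a x\<bar> \<le> B"
proof -
  have "continuous_on (cball 0 12) a" using assms by (auto simp: cper_def intro: continuous_on_subset)
  then have "bounded (a ` cball 0 12)" by (intro compact_imp_bounded compact_continuous_image) auto
  then obtain B where B: "\<forall>x\<in>cball 0 12. \<bar>a x\<bar> \<le> B" by (auto simp: bounded_iff)
  have "\<bar>a x\<bar> \<le> B" for x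
  proof -
    obtain w where w: "\<And>i. \<exists>n::int. w $ i = x $ i + 2 * pi * of_int n" "norm w \<le> 4 * tdist x" by (rule tdist_lift) (rule that)
    have "a w = a x" using assms w(1) by (intro periodic_lattice) (auto simp: cper_def)
    moreover have "w \<in> cball 0 12" using w(2) tdist_le_3[of x] by simp
    ultimately show ?thesis using B by metis
  qed
  moreover have "B \<ge> 0" using B by (auto dest: bspec[of _ _ 0])
  ultimately show ?thesis using that by blast
qed

text \<open>Uniform continuity in a form that can be integrated against a kernel: near the lattice the increment is at most
  \<open>\<delta>\<close>, and away from it the sum of squared sines is bounded below, so that a large
  \<open>C\<close> exceeds twice the supremum of \<open>|a|\<close>.\<close>

lemma cper_modulus:
  assumes a: "cper a" and d: "\<delta> > 0"
  obtains C where "C \<ge> 0" "\<And>x z. \<bar>a (x + z) - a x\<bar> \<le> \<delta> + C * sin2_sum z"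
proof -
  have per: "periodic a" using a by (simp add: cper_def)
  obtain B where B: "B \<ge> 0" "\<And>x. \<bar>a x\<bar> \<le> B" by (rule cper_bounded[OF a]) (rule that)
  have "continuous_on (cball 0 24) a" using a by (auto simp: cper_def intro: continuous_on_subset)
  then have "uniformly_continuous_on (cball 0 24) a" by (rule compact_uniformly_continuous) simp
  then obtain r where r: "r > 0" "\<And>x y. x \<in> cball 0 24 \<Longrightarrow> y \<in> cball 0 24 \<Longrightarrow> dist y x < r \<Longrightarrow> dist (a y) (a x) < \<delta>"
    using d unfolding uniformly_continuous_on_def by metis
  (* If z has distance at least r from the lattice, then r^2 is at most (4 tdist z)^2, hence at most 48 times the
     sum of the squared sines. *)
  define C where "C = 2 * B * 48 / r\<^sup>2"
  have "\<bar>a (x + z) - a x\<bar> \<le> \<delta> + C * sin2_sum z" for x z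
  proof -
    obtain w where w: "\<And>i. \<exists>n::int. w $ i = z $ i + 2 * pi * of_int n" "norm w \<le> 4 * tdist z" by (rule tdist_lift) (rule that)
    obtain y where y: "\<And>i. \<exists>n::int. y $ i = x $ i + 2 * pi * of_int n" "norm y \<le> 4 * tdist x" by (rule tdist_lift) (rule that)
    have "a y = a x" using per y(1) by (rule periodic_lattice)
    moreover have "a (y + w) = a (x + z)"
    proof (rule periodic_lattice[OF per])
      fix i
      obtain n m :: int where "w $ i = z $ i + 2 * pi * of_int n" "y $ i = x $ i + 2 * pi * of_int m" using w(1) y(1) by blast
      then show "\<exists>n::int. (y + w) $ i = (x + z) $ i + 2 * pi * of_int n"
        by (intro exI[of _ "n + m"]) (simp add: algebra_simps)
    qed
    ultimately have eq: "\<bar>a (x + z) - a x\<bar> = dist (a (y + w)) (a y)" by (simp add: dist_real_def)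
    show ?thesis
    proof (cases "norm w < r")
      case True
      have ny: "norm y \<le> 12" "norm w \<le> 12" using y(2) w(2) tdist_le_3[of x] tdist_le_3[of z] by auto
      then have "norm (y + w) \<le> 24" using norm_triangle_ineq[of y w] by linarith
      then have "norm (- y - w) \<le> 24" using norm_minus_cancel[of "y + w"] by simp
      with ny have "dist (a (y + w)) (a y) < \<delta>" using True by (intro r(2)) (auto simp: dist_norm)
      moreover have "C * sin2_sum z \<ge> 0" using B(1) sin2_sum_nonneg[of z] by (simp add: C_def)
      ultimately show ?thesis using eq by linarith
    next
      case False
      have "r\<^sup>2 \<le> (4 * tdist z)\<^sup>2" using False w(2) r(1) by (intro power_mono) auto
      also have "\<dots> \<le> 48 * sin2_sum z" using tdist_sq_le[of z] by (simp add: power_mult_distrib)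
      finally have "2 * B * r\<^sup>2 \<le> 2 * B * (48 * sin2_sum z)" using B(1) by (intro mult_left_mono) auto
      then have "2 * B \<le> C * sin2_sum z" using r(1) by (simp add: C_def field_simps)
      moreover have "\<bar>a (x + z) - a x\<bar> \<le> 2 * B" using B(2)[of x] B(2)[of "x + z"] by linarith
      ultimately show ?thesis using d by linarith
    qed
  qed
  moreover have "C \<ge> 0" using B(1) by (simp add: C_def)
  ultimately show ?thesis using that by blast
qed

text \<open>The modulus of continuity is integrated against the kernel, whose second moment is \<open>O(1 / N)\<close>.\<close>

lemma convolve_kern_uniform:
  assumes a: "cper a"
  shows "uniform_limit UNIV (\<lambda>N. convolve (kern N) a) a sequentially"
proof (rule uniform_limitI)
  fix e :: real assume e: "e > 0"
  obtain C where C: "C \<ge> 0" "\<And>x z. \<bar>a (x + z) - a x\<bar> \<le> e / 2 + C * sin2_sum z" using cper_modulus[OF a, of "e/2"] e by (metis half_gt_zero)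
  have ai: "integrable torus a" by (rule cper_integrable[OF a])
  have ci: "integrable torus (\<lambda>_. c)" for c :: real by (rule cper_integrable[OF cper_const])
  have main: "\<bar>convolve (kern N) a x - a x\<bar> \<le> e / 2 + C * (3 / (real N + 1))" for N x
  proof -
    have tp: "trigpoly (kern N)" by (rule trigpoly_kern)
    have tS: "trigpoly (\<lambda>z. kern N z * sin2_sum z)" by (intro trigpoly_mult tp trigpoly_sin2_sum)
    have one: "convolve (kern N) (\<lambda>_. 1) x = 1" using convolve_one[OF tp] by (simp add: kern_even int_kern)
    have "convolve (kern N) a x - a x = convolve (kern N) a x - a x * convolve (kern N) (\<lambda>_. 1) x" by (simp add: one)
    also have "a x * convolve (kern N) (\<lambda>_. 1) x = convolve (kern N) (\<lambda>_. a x) x" 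
      unfolding convolve_def by (simp add: mult.commute)
    also have "convolve (kern N) a x - \<dots> = convolve (kern N) (\<lambda>y. a y - a x) x"
      by (rule convolve_diff[symmetric, OF tp ai ci])
    finally have e: "convolve (kern N) a x - a x = convolve (kern N) (\<lambda>y. a y - a x) x" .
    have "\<bar>convolve (kern N) a x - a x\<bar> \<le> (LINT y|torus. \<bar>kern N (x - y) * (a y - a x)\<bar>)"
      unfolding e by (unfold convolve_def) (rule integral_abs_bound)
    also have "\<dots> \<le> (LINT y|torus. e / 2 * (kern N (x - y) * 1) + C * ((kern N (x - y) * sin2_sum (x - y)) * 1))"
    proof (rule integral_mono)
      show "integrable torus (\<lambda>y. \<bar>kern N (x - y) * (a y - a x)\<bar>)"
        using convolve_integrand[OF tp, of "\<lambda>y. a y - a x"] ai ci by simp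
      show "integrable torus (\<lambda>y. e / 2 * (kern N (x - y) * 1) + C * ((kern N (x - y) * sin2_sum (x - y)) * 1))"
        using convolve_integrand[OF tp, of "\<lambda>_. 1"] convolve_integrand[OF tS, of "\<lambda>_. 1"] ci by simp
      fix y
      have "\<bar>a y - a x\<bar> \<le> e / 2 + C * sin2_sum (x - y)" using C(2)[of x "y - x"] sin2_sum_even[of "x - y"] by simp
      from mult_left_mono[OF this kern_nonneg[of N "x - y"]]
      show "\<bar>kern N (x - y) * (a y - a x)\<bar> \<le> e / 2 * (kern N (x - y) * 1) + C * ((kern N (x - y) * sin2_sum (x - y)) * 1)"
        by (simp add: abs_mult kern_nonneg distrib_left mult_ac)
    qed
    also have "\<dots> = e / 2 * convolve (kern N) (\<lambda>_. 1) x + C * convolve (\<lambda>z. kern N z * sin2_sum z) (\<lambda>_. 1) x"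
      using convolve_integrand[OF tp, of "\<lambda>_. 1" x] convolve_integrand[OF tS, of "\<lambda>_. 1" x] ci unfolding convolve_def by simp
    also have "convolve (\<lambda>z. kern N z * sin2_sum z) (\<lambda>_. 1) x = (LINT z|torus. kern N z * sin2_sum z)"
      using convolve_one[OF tS] by (simp add: kern_even sin2_sum_even)
    also have "e / 2 * convolve (kern N) (\<lambda>_. 1) x + C * (LINT z|torus. kern N z * sin2_sum z) \<le> e / 2 + C * (3 / (real N + 1))"
      using C(1) by (simp only: one mult_1_right) (intro add_left_mono mult_left_mono int_kern_sin2_sum)
    finally show ?thesis .
  qed
  have "(\<lambda>N. C * (3 * inverse (real (Suc N)))) \<longlonglongrightarrow> C * (3 * 0)"
    by (intro tendsto_mult tendsto_const LIMSEQ_inverse_real_of_nat)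
  then have "(\<lambda>N. C * (3 / (real N + 1))) \<longlonglongrightarrow> 0"
    by (simp add: divide_inverse add.commute)
  then have "\<forall>\<^sub>F N in sequentially. C * (3 / (real N + 1)) < e / 2"
    using e by (intro order_tendstoD) auto
  then show "\<forall>\<^sub>F N in sequentially. \<forall>x\<in>UNIV. dist (convolve (kern N) a x) (a x) < e"
  proof eventually_elim
    case (elim N)
    have "dist (convolve (kern N) a x) (a x) < e" for x
      using elim main[of N x] unfolding dist_real_def by linarith
    then show ?case by blast
  qed
qed

lemma integral_uniform_limit:
  assumes g: "integrable torus g" and u: "uniform_limit UNIV h l sequentially"
    and h: "\<And>N. integrable torus (\<lambda>x. g x * h N x)" and l: "integrable torus (\<lambda>x. g x * l x)"
  shows "(\<lambda>N::nat. LINT x|torus. g x * h N x) \<longlonglongrightarrow> (LINT x|torus. g x * (l x :: real))"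
proof (rule tendstoI)
  fix e :: real assume e: "e > 0"
  define A where "A = (LINT x|torus. \<bar>g x\<bar>)"
  have A: "A \<ge> 0" by (simp add: A_def)
  have "e / (A + 1) > 0" using e A by simp
  from uniform_limitD[OF u this]
  show "\<forall>\<^sub>F N in sequentially. dist (LINT x|torus. g x * h N x) (LINT x|torus. g x * l x) < e"
  proof eventually_elim
    case (elim N)
    have "\<bar>(LINT x|torus. g x * h N x) - (LINT x|torus. g x * l x)\<bar> = \<bar>LINT x|torus. g x * h N x - g x * l x\<bar>"
      by (subst Bochner_Integration.integral_diff[OF h l]) simp
    also have "\<dots> \<le> (LINT x|torus. \<bar>g x * h N x - g x * l x\<bar>)" by (rule integral_abs_bound)
    also have "\<dots> \<le> (LINT x|torus. \<bar>g x\<bar> * (e / (A + 1)))"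
    proof (rule integral_mono)
      show "integrable torus (\<lambda>x. \<bar>g x * h N x - g x * l x\<bar>)" using h l by simp
      show "integrable torus (\<lambda>x. \<bar>g x\<bar> * (e / (A + 1)))" using g by simp
      fix x
      have "\<bar>h N x - l x\<bar> \<le> e / (A + 1)" using elim by (auto simp: dist_real_def less_imp_le)
      from mult_left_mono[OF this, of "\<bar>g x\<bar>"]
      show "\<bar>g x * h N x - g x * l x\<bar> \<le> \<bar>g x\<bar> * (e / (A + 1))"
        by (simp add: abs_mult[symmetric] right_diff_distrib)
    qed
    also have "\<dots> = A * (e / (A + 1))" using g by (simp add: A_def)
    also have "\<dots> < e" using e A by (simp add: field_simps)
    finally show ?case by (simp add: dist_real_def)
  qed
qed

lemma integrable_mult_cper:
  assumes "integrable torus g" "cper a"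
  shows "integrable torus (\<lambda>x. g x * a x)"
proof -
  obtain B where B: "B \<ge> 0" "\<And>x. \<bar>a x\<bar> \<le> B" by (rule cper_bounded[OF assms(2)]) (rule that)
  show ?thesis
  proof (rule Bochner_Integration.integrable_bound)
    show "integrable torus (\<lambda>x. B * \<bar>g x\<bar>)" using assms(1) by simp
    show "(\<lambda>x. g x * a x) \<in> borel_measurable torus"
      using assms(1) cper_integrable[OF assms(2)] by simp
    show "AE x in torus. norm (g x * a x) \<le> norm (B * \<bar>g x\<bar>)"
    proof (rule AE_I2)
      fix x show "norm (g x * a x) \<le> norm (B * \<bar>g x\<bar>)"
        using mult_right_mono[OF B(2)[of x], of "\<bar>g x\<bar>"] B(1) by (simp add: abs_mult mult_ac)
    qed
  qed
qed

lemma torus_swap: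
  fixes F :: "real^3 \<Rightarrow> real^3 \<Rightarrow> real"
  assumes c: "continuous_on UNIV (\<lambda>p. F (fst p) (snd p))"
  shows "(LINT x|torus. LINT z|torus. F x z) = (LINT z|torus. LINT x|torus. F x z)"
    and "continuous_on UNIV (\<lambda>z. LINT x|torus. F x z)"
proof -
  have c1: "continuous_on S (\<lambda>p. F (fst p) (snd p))" for S by (rule continuous_on_subset[OF c]) simp
  have cos2: "continuous_on S (\<lambda>p. F (snd p) (fst p))" for S
    by (rule continuous_on_compose2[OF c, of S "\<lambda>p. (snd p, fst p)", simplified]) (auto intro!: continuous_intros)
  have cz: "continuous_on UNIV (F x)" for x
    by (rule continuous_on_compose2[OF c, of UNIV "\<lambda>z. (x, z)", simplified]) (auto intro!: continuous_intros)
  have cx: "continuous_on UNIV (\<lambda>x. F x z)" for z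
    by (rule continuous_on_compose2[OF c, of UNIV "\<lambda>x. (x, z)", simplified]) (auto intro!: continuous_intros)
  have iz: "(LINT z|torus. F x z) = integral cell (F x)" for x by (rule torus_integral_eq(2)[OF cz])
  have ix: "(LINT x|torus. F x z) = integral cell (\<lambda>x. F x z)" for z by (rule torus_integral_eq(2)[OF cx])
  have A: "continuous_on UNIV (\<lambda>x. integral cell (F x))"
    by (rule integral_continuous_on_param) (use c1 in \<open>simp add: split_def\<close>)
  have B: "continuous_on UNIV (\<lambda>z. integral cell (\<lambda>x. F x z))"
    by (rule integral_continuous_on_param) (use cos2 in \<open>simp add: split_def\<close>)
  show "continuous_on UNIV (\<lambda>z. LINT x|torus. F x z)" unfolding ix by (rule B)
  show "(LINT x|torus. LINT z|torus. F x z) = (LINT z|torus. LINT x|torus. F x z)"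
    unfolding ix iz torus_integral_eq(2)[OF A] torus_integral_eq(2)[OF B]
    by (rule integral_swap_continuous) (use c1 in \<open>simp add: split_def\<close>)
qed

section \<open>Solenoidal fields are orthogonal to gradients\<close>

lemma partial_component:
  assumes "\<phi> differentiable (at x)"
  shows "partial j (\<lambda>x. (\<phi> x :: real^3) $ i) x = frechet_derivative \<phi> (at x) (axis j 1) $ i"
    and "(\<lambda>x. \<phi> x $ i) differentiable (at x)"
proof -
  have "((\<lambda>x. \<phi> x $ i) has_derivative (\<lambda>h. frechet_derivative \<phi> (at x) h $ i)) (at x)"
    using assms by (intro bounded_linear.has_derivative[OF bounded_linear_vec_nth]) (simp add: frechet_derivative_works)
  then show "partial j (\<lambda>x. \<phi> x $ i) x = frechet_derivative \<phi> (at x) (axis j 1) $ i" "(\<lambda>x. \<phi> x $ i) differentiable (at x)"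
    by (auto intro: partial_eqI differentiableI)
qed

lemma solenoidal_orth_gradient:
  assumes \<phi>: "\<phi> \<in> solenoidal" and p: "trigpoly p"
  shows "(\<Sum>j\<in>UNIV. LINT x|torus. \<phi> x $ j * partial j p x) = 0"
proof -
  have sm: "smooth_on UNIV \<phi>" and per: "periodic \<phi>" and div: "\<And>x. divergence \<phi> x = 0"
    using \<phi> by (auto simp: solenoidal_def)
  have C1: "Ck_on (Suc 0) UNIV \<phi>" using sm by (simp only: smooth_on_def)
  have d: "\<phi> differentiable (at x)" for x using C1 by simp
  have c: "continuous_on UNIV (\<lambda>x. frechet_derivative \<phi> (at x) h)" for h using C1 by simp
  have dp: "p differentiable (at x)" for x by (rule trigpoly_differentiable[OF p])
  have cphi: "cper (\<lambda>x. \<phi> x $ j)" for j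
    using differentiable_imp_continuous_within[OF partial_component(2)[OF d]] per
    by (simp add: cper_def periodic_def continuous_on_eq_continuous_at)
  have cdphi: "continuous_on UNIV (partial j (\<lambda>x. \<phi> x $ j))" for j
    using c by (simp add: partial_component(1)[OF d, abs_def] continuous_on_component)
  have ibp: "(LINT x|torus. \<phi> x $ j * partial j p x) = - (LINT x|torus. partial j (\<lambda>x. \<phi> x $ j) x * p x)" for j
  proof -
    have eq: "partial j (\<lambda>x. \<phi> x $ j * p x) = (\<lambda>x. \<phi> x $ j * partial j p x + partial j (\<lambda>x. \<phi> x $ j) x * p x)"
      by (rule ext, rule partial_mult) (auto intro: partial_component(2) d dp)
    have cp: "continuous_on UNIV p" "continuous_on UNIV (partial j p)" using p by (auto intro: trigpoly_continuous trigpoly_partial)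
    have cc: "continuous_on UNIV (\<lambda>x. \<phi> x $ j * partial j p x)" "continuous_on UNIV (\<lambda>x. partial j (\<lambda>x. \<phi> x $ j) x * p x)"
      using cphi[of j] cdphi[of j] cp by (auto simp: cper_def intro!: continuous_intros)
    have "(LINT x|torus. partial j (\<lambda>x. \<phi> x $ j * p x) x) = 0"
    proof (rule integral_torus_partial_eq_0)
      show "(\<lambda>x. \<phi> x $ j * p x) differentiable (at x)" for x by (intro differentiable_mult partial_component(2) d dp)
      show "continuous_on UNIV (partial j (\<lambda>x. \<phi> x $ j * p x))" unfolding eq by (rule continuous_on_add[OF cc])
      show "periodic (\<lambda>x. \<phi> x $ j * p x)" using per trigpoly_periodic[OF p] by (simp add: periodic_def)
    qed
    then show ?thesis unfolding eq using cc[THEN torus_integral_eq(1)] by simp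
  qed
  have "(\<Sum>j\<in>UNIV. LINT x|torus. \<phi> x $ j * partial j p x) = - (\<Sum>j\<in>UNIV. LINT x|torus. partial j (\<lambda>x. \<phi> x $ j) x * p x)"
    by (simp add: ibp sum_negf)
  also have "(\<Sum>j\<in>UNIV. LINT x|torus. partial j (\<lambda>x. \<phi> x $ j) x * p x) = (LINT x|torus. (\<Sum>j\<in>UNIV. partial j (\<lambda>x. \<phi> x $ j) x * p x))"
    by (rule Bochner_Integration.integral_sum[symmetric], rule torus_integral_eq(1))
      (intro continuous_on_mult cdphi trigpoly_continuous p)
  also have "(\<lambda>x. \<Sum>j\<in>UNIV. partial j (\<lambda>x. \<phi> x $ j) x * p x) = (\<lambda>x. divergence \<phi> x * p x)"
    by (simp add: divergence_def trace_def cgrad_def jacobian_def matrix_def partial_component(1)[OF d] sum_distrib_right)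
  finally show ?thesis by (simp add: div)
qed

lemma L2_gradient_trigpoly: "trigpoly p \<Longrightarrow> (\<lambda>x. \<chi> j. partial j p x) \<in> L2"
  by (rule continuous_periodic_L2)
    (auto simp: periodic_def vec_eq_iff trigpoly_periodic[OF trigpoly_partial, unfolded periodic_def] intro!: continuous_on_vec_lambda trigpoly_continuous trigpoly_partial)

lemma L2_inner_sum:
  fixes u w :: "real^3 \<Rightarrow> real^3"
  assumes "u \<in> L2" "w \<in> L2"
  shows "L2_inner u w = (\<Sum>i\<in>UNIV. LINT x|torus. u x $ i * w x $ i)"
  unfolding L2_inner_def inner_vec_def inner_real_def
  by (rule Bochner_Integration.integral_sum)
    (use integrable_inner_L2[of "\<lambda>x. u x $ _" torus "\<lambda>x. w x $ _"] L2_component[OF assms(1)] L2_component[OF assms(2)] in simp)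

text \<open>Being orthogonal to a fixed gradient is preserved under limits in \<open>L\<^sup>2\<close>.\<close>

lemma H_space_orth_gradient:
  assumes u: "u \<in> H_space" and p: "trigpoly p"
  shows "(\<Sum>j\<in>UNIV. LINT x|torus. u x $ j * partial j p x) = 0"
proof -
  let ?g = "\<lambda>x. \<chi> j. partial j p x"
  have g: "?g \<in> L2" by (rule L2_gradient_trigpoly[OF p])
  have uL: "u \<in> L2" using u by (simp add: H_space_def)
  have small: "\<bar>L2_inner u ?g\<bar> \<le> e" if e: "e > 0" for e
  proof -
    let ?n = "L2_norm ?g + 1"
    have n: "?n > 0" using L2_norm_nonneg[of ?g] by simp
    obtain \<phi> where \<phi>: "\<phi> \<in> solenoidal" "L2_norm (\<lambda>x. u x - \<phi> x) < e / ?n"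
    proof -
      have "\<forall>\<epsilon>>0. \<exists>\<phi>\<in>solenoidal. L2_norm (\<lambda>x. u x - \<phi> x) < \<epsilon>" using u by (simp add: H_space_def)
      moreover have "e / ?n > 0" using e n by simp
      ultimately show ?thesis using that by blast
    qed
    have "Ck_on 0 UNIV \<phi>" using \<phi>(1) by (simp only: solenoidal_def smooth_on_def mem_Collect_eq)
    then have pL: "\<phi> \<in> L2" using \<phi>(1) by (intro continuous_periodic_L2) (auto simp: solenoidal_def)
    have "L2_inner \<phi> ?g = 0"
      using solenoidal_orth_gradient[OF \<phi>(1) p] by (simp add: L2_inner_sum[OF pL g])
    moreover have "L2_inner (\<lambda>x. u x - \<phi> x) ?g = L2_inner u ?g - L2_inner \<phi> ?g"
    proof -
      have "integrable torus (\<lambda>x. w x \<bullet> ?g x)" if "w \<in> L2" for w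
        using that g by (intro integrable_inner_L2 L2_measurable) (auto simp: L2_def)
      then show ?thesis unfolding L2_inner_def inner_diff_left using uL pL by (intro Bochner_Integration.integral_diff)
    qed
    ultimately have "\<bar>L2_inner u ?g\<bar> \<le> L2_norm (\<lambda>x. u x - \<phi> x) * L2_norm ?g"
      using L2_inner_CS[OF L2_diff[OF uL pL] g] by simp
    also have "\<dots> \<le> e / ?n * ?n" using \<phi>(2) L2_norm_nonneg[of ?g] e n by (intro mult_mono) auto
    finally show ?thesis using n by simp
  qed
  have "\<bar>L2_inner u ?g\<bar> \<le> 0 + e" if "e > 0" for e using small[OF that] by simp
  then have "\<bar>L2_inner u ?g\<bar> \<le> 0" by (rule field_le_epsilon)
  then have "L2_inner u ?g = 0" by simp
  then show ?thesis by (simp add: L2_inner_sum[OF uL g])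
qed

section \<open>A Hoelder continuous solenoidal field with a weak gradient\<close>

lemma norm_matrix_vector_le:
  fixes A :: "real^3^3"
  shows "(norm (A *v x))\<^sup>2 \<le> (norm A)\<^sup>2 * (norm x)\<^sup>2"
proof -
  have "(norm (A *v x))\<^sup>2 = (\<Sum>i\<in>UNIV. ((A $ i) \<bullet> x)\<^sup>2)"
    by (simp add: square_norm_vec matrix_vector_mul_component)
  also have "\<dots> \<le> (\<Sum>i\<in>UNIV. (norm (A $ i))\<^sup>2 * (norm x)\<^sup>2)"
    by (rule sum_mono) (metis Cauchy_Schwarz_ineq power2_norm_eq_inner)
  also have "\<dots> = (norm A)\<^sup>2 * (norm x)\<^sup>2"
    unfolding power2_norm_eq_inner[of A] inner_vec_def[of A]
    by (simp add: sum_distrib_right power2_norm_eq_inner)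
  finally show ?thesis .
qed

text \<open>The velocity at almost every time: \<open>f\<close> is its Hoelder constant, \<open>G\<close> its weak gradient, and
  the last assumption says that it is divergence-free.\<close>

locale regular_field =
  fixes u :: "real^3 \<Rightarrow> real^3" and G :: "real^3 \<Rightarrow> real^3^3" and \<alpha> f :: real
  assumes alpha: "0 < \<alpha>" "\<alpha> < 1"
    and per: "periodic u"
    and f_nonneg: "0 \<le> f"
    and holder: "\<And>x y. norm (u x - u y) \<le> f * norm (x - y) powr \<alpha>"
    and wg: "has_weak_gradient u G"
    and orth: "\<And>p. trigpoly p \<Longrightarrow> (\<Sum>j\<in>UNIV. LINT x|torus. u x $ j * partial j p x) = 0"
begin

lemma G_L2: "G \<in> L2" using wg by (simp add: has_weak_gradient_def)

lemma G_integrable: "integrable torus (\<lambda>x. G x $ i $ j)"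
  by (rule L2_component(3)[OF L2_matrix_row[OF G_L2]])

lemma continuous_u: "continuous_on UNIV u"
proof -
  have "isCont u x" for x
  proof -
    have "((\<lambda>y. f * norm (y - x) powr \<alpha>) \<longlongrightarrow> f * norm (x - x) powr \<alpha>) (at x)"
      using alpha(1) by (intro tendsto_intros) auto
    then have "((\<lambda>y. f * norm (y - x) powr \<alpha>) \<longlongrightarrow> 0) (at x)" by simp
    then have "((\<lambda>y. u y - u x) \<longlongrightarrow> 0) (at x)"
      by (rule Lim_null_comparison[rotated]) (simp add: holder)
    then show ?thesis by (simp add: isCont_def LIM_zero_iff)
  qed
  then show ?thesis by (simp add: continuous_on_eq_continuous_at)
qed

lemma cper_u: "cper (\<lambda>x. u x $ i)"
  using continuous_u per by (auto simp: cper_def periodic_def intro!: continuous_intros)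

lemma u_L2: "u \<in> L2" by (rule continuous_periodic_L2[OF continuous_u per])

lemma norm_sq_u: "(L2_norm u)\<^sup>2 = (\<Sum>i\<in>UNIV. LINT x|torus. (u x $ i)\<^sup>2)"
  unfolding L2_norm_sq[OF u_L2] square_norm_vec
  by (rule Bochner_Integration.integral_sum) (intro cper_integrable cper_power cper_u)

text \<open>As a function of \<open>y\<close>, the kernel \<open>p (x - y)\<close> is a trigonometric polynomial, to whose
  gradient \<open>u\<close> is orthogonal.\<close>

lemma mollified_div_free:
  assumes p: "trigpoly p"
  shows "(\<Sum>j\<in>UNIV. partial j (convolve p (\<lambda>y. u y $ j)) x) = 0"
proof -
  have r: "trigpoly (\<lambda>y. p (x - y))" by (rule trigpoly_reflect[OF p])
  have e: "partial j p (x - y) = - partial j (\<lambda>y. p (x - y)) y" for j y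
  proof -
    have "partial j (\<lambda>y. (\<lambda>z. p (z + x)) (- y)) y = - partial j (\<lambda>z. p (z + x)) (- y)"
      by (rule partial_uminus) (intro trigpoly_differentiable trigpoly_shift p)
    also have "partial j (\<lambda>z. p (z + x)) (- y) = partial j p (- y + x)"
      by (rule partial_shift) (rule trigpoly_differentiable[OF p])
    finally show ?thesis by simp
  qed
  have "(\<Sum>j\<in>UNIV. partial j (convolve p (\<lambda>y. u y $ j)) x) = (\<Sum>j\<in>UNIV. LINT y|torus. partial j p (x - y) * u y $ j)"
    by (simp add: partial_convolve[OF p cper_integrable[OF cper_u]] convolve_def)
  also have "\<dots> = - (\<Sum>j\<in>UNIV. LINT y|torus. u y $ j * partial j (\<lambda>y. p (x - y)) y)"
    by (simp add: e mult.commute sum_negf)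
  finally show ?thesis using orth[OF r] by simp
qed

lemma uniform_u: "uniform_limit UNIV (\<lambda>N. convolve (kern N) (\<lambda>y. u y $ i)) (\<lambda>x. u x $ i) sequentially"
  by (rule convolve_kern_uniform[OF cper_u])

lemma trigpoly_mollified: "trigpoly (convolve (kern N) (\<lambda>y. u y $ i))"
  by (intro trigpoly_convolve trigpoly_kern cper_integrable cper_u)

lemma conv_form_kern_limit:
  assumes "integrable torus g"
  shows "(\<lambda>N. conv_form (kern N) g (\<lambda>x. u x $ j)) \<longlonglongrightarrow> (LINT x|torus. g x * u x $ j)"
  unfolding conv_form_def
  by (rule integral_uniform_limit[OF assms uniform_u])
    (intro integrable_mult_trigpoly assms trigpoly_mollified integrable_mult_cper cper_u)+

text \<open>The product \<open>u\<^sub>j \<psi>\<close> is not a test function. It is replaced by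
  \<open>w\<^sub>j \<psi>\<close>, where \<open>w\<close> is the mollified field: this is a trigonometric
  polynomial, \<open>w\<close> is divergence-free, and \<open>w\<close> converges to \<open>u\<close> uniformly.\<close>

lemma convection_by_parts:
  assumes \<psi>: "trigpoly \<psi>"
  shows "(\<Sum>j\<in>UNIV. LINT x|torus. G x $ i $ j * u x $ j * \<psi> x) = - (\<Sum>j\<in>UNIV. LINT x|torus. u x $ i * u x $ j * partial j \<psi> x)"
proof -
  define w where "w N j = convolve (kern N) (\<lambda>y. u y $ j)" for N j
  have tw: "trigpoly (w N j)" for N j unfolding w_def by (rule trigpoly_mollified)
  have ui: "integrable torus (\<lambda>x. u x $ i)" for i by (intro cper_integrable cper_u)
  have step: "(\<Sum>j\<in>UNIV. LINT x|torus. (G x $ i $ j * \<psi> x) * w N j x) = - (\<Sum>j\<in>UNIV. LINT x|torus. (u x $ i * partial j \<psi> x) * w N j x)" for N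
  proof -
    have 1: "(LINT x|torus. (G x $ i $ j * \<psi> x) * w N j x) = - (LINT x|torus. (u x $ i * partial j \<psi> x) * w N j x) - (LINT x|torus. u x $ i * \<psi> x * partial j (w N j) x)" for j
    proof -
      have tp: "trigpoly (\<lambda>x. w N j x * \<psi> x)" by (intro trigpoly_mult tw \<psi>)
      have "(LINT x|torus. (G x $ i $ j * \<psi> x) * w N j x) = (LINT x|torus. G x $ i $ j * (w N j x * \<psi> x))"
        by (simp add: mult_ac)
      also have "\<dots> = - (LINT x|torus. u x $ i * partial j (\<lambda>x. w N j x * \<psi> x) x)"
        using weak_gradient_trigpoly[OF wg tp, of i j] by simp
      also have "(\<lambda>x. u x $ i * partial j (\<lambda>x. w N j x * \<psi> x) x) = (\<lambda>x. (u x $ i * partial j \<psi> x) * w N j x + u x $ i * \<psi> x * partial j (w N j) x)"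
        by (rule ext, subst partial_mult) (auto intro: trigpoly_differentiable tw \<psi> simp: algebra_simps)
      also have "(LINT x|torus. (u x $ i * partial j \<psi> x) * w N j x + u x $ i * \<psi> x * partial j (w N j) x) = (LINT x|torus. (u x $ i * partial j \<psi> x) * w N j x) + (LINT x|torus. u x $ i * \<psi> x * partial j (w N j) x)"
        by (rule Bochner_Integration.integral_add) (intro integrable_mult_trigpoly ui tw \<psi> trigpoly_partial)+
      finally show ?thesis by simp
    qed
    have "(\<Sum>j\<in>UNIV. LINT x|torus. u x $ i * \<psi> x * partial j (w N j) x) = (LINT x|torus. (\<Sum>j\<in>UNIV. u x $ i * \<psi> x * partial j (w N j) x))"
      by (rule Bochner_Integration.integral_sum[symmetric]) (intro integrable_mult_trigpoly ui tw \<psi> trigpoly_partial)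
    also have "\<dots> = 0"
      using mollified_div_free[OF trigpoly_kern] by (simp add: sum_distrib_left[symmetric] w_def)
    finally show ?thesis unfolding 1 by (simp add: sum_subtractf sum_negf)
  qed
  have lim1: "(\<lambda>N. \<Sum>j\<in>UNIV. LINT x|torus. (G x $ i $ j * \<psi> x) * w N j x) \<longlonglongrightarrow> (\<Sum>j\<in>UNIV. LINT x|torus. (G x $ i $ j * \<psi> x) * u x $ j)"
    by (intro tendsto_sum conv_form_kern_limit[unfolded conv_form_def, folded w_def] integrable_mult_trigpoly G_integrable \<psi>)
  have lim2: "(\<lambda>N. - (\<Sum>j\<in>UNIV. LINT x|torus. (u x $ i * partial j \<psi> x) * w N j x)) \<longlonglongrightarrow> - (\<Sum>j\<in>UNIV. LINT x|torus. (u x $ i * partial j \<psi> x) * u x $ j)"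
    by (intro tendsto_minus tendsto_sum conv_form_kern_limit[unfolded conv_form_def, folded w_def] integrable_mult_trigpoly ui \<psi> trigpoly_partial)
  from LIMSEQ_unique[OF lim1[unfolded step] lim2] show ?thesis by (simp add: mult_ac)
qed

lemma translation_derivative:
  assumes p: "trigpoly p" and a: "integrable torus a"
  shows "((\<lambda>\<theta>. LINT x|torus. a x * p (x - \<theta> *\<^sub>R w)) has_real_derivative
      - (\<Sum>j\<in>UNIV. w $ j * (LINT x|torus. a x * partial j p (x - \<theta> *\<^sub>R w)))) (at \<theta>)"
proof -
  obtain n :: nat and \<beta> \<gamma> where 1: "\<forall>m<n. trigpoly (\<beta> m) \<and> trigpoly (\<gamma> m)" "\<forall>x y. p (x - y) = (\<Sum>m<n. \<beta> m x * \<gamma> m y)"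
    using trigpoly_separate[OF p] by blast
  have dg: "\<gamma> m differentiable (at x)" if "m < n" for m x using 1(1) that trigpoly_differentiable by blast
  have ib: "integrable torus (\<lambda>x. a x * \<beta> m x)" if "m < n" for m using 1(1) that by (intro integrable_mult_trigpoly a) auto
  have e1: "(LINT x|torus. a x * p (x - y)) = (\<Sum>m<n. (LINT x|torus. a x * \<beta> m x) * \<gamma> m y)" for y
  proof -
    have "(LINT x|torus. a x * p (x - y)) = (LINT x|torus. (\<Sum>m<n. (a x * \<beta> m x) * \<gamma> m y))"
      unfolding 1(2)[rule_format] sum_distrib_left by (simp add: mult_ac)
    also have "\<dots> = (\<Sum>m<n. (LINT x|torus. a x * \<beta> m x) * \<gamma> m y)"
      using ib by (subst Bochner_Integration.integral_sum) auto
    finally show ?thesis .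
  qed
  have pdp: "partial j p (x - y) = - (\<Sum>m<n. \<beta> m x * partial j (\<gamma> m) y)" for j x y
  proof -
    have "partial j (\<lambda>y. (\<lambda>z. p (z + x)) (- y)) y = - partial j (\<lambda>z. p (z + x)) (- y)"
      by (rule partial_uminus) (intro trigpoly_differentiable trigpoly_shift p)
    also have "partial j (\<lambda>z. p (z + x)) (- y) = partial j p (- y + x)"
      by (rule partial_shift) (rule trigpoly_differentiable[OF p])
    finally have "partial j p (x - y) = - partial j (\<lambda>y. p (x - y)) y" by simp
    also have "(\<lambda>y. p (x - y)) = (\<lambda>y. \<Sum>m<n. \<beta> m x * \<gamma> m y)" using 1(2) by simp
    also have "partial j (\<lambda>y. \<Sum>m<n. \<beta> m x * \<gamma> m y) y = (\<Sum>m<n. \<beta> m x * partial j (\<gamma> m) y)"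
      using dg by (subst partial_sum) (auto simp: partial_scale intro!: derivative_intros)
    finally show ?thesis .
  qed
  have e2: "(LINT x|torus. a x * partial j p (x - y)) = - (\<Sum>m<n. (LINT x|torus. a x * \<beta> m x) * partial j (\<gamma> m) y)" for j y
  proof -
    have "(LINT x|torus. a x * partial j p (x - y)) = (LINT x|torus. - (\<Sum>m<n. (a x * \<beta> m x) * partial j (\<gamma> m) y))"
      unfolding pdp by (simp add: sum_distrib_left mult_ac)
    also have "\<dots> = - (LINT x|torus. (\<Sum>m<n. (a x * \<beta> m x) * partial j (\<gamma> m) y))" by simp
    also have "(LINT x|torus. (\<Sum>m<n. (a x * \<beta> m x) * partial j (\<gamma> m) y)) = (\<Sum>m<n. (LINT x|torus. a x * \<beta> m x) * partial j (\<gamma> m) y)"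
      using ib by (subst Bochner_Integration.integral_sum) auto
    finally show ?thesis .
  qed
  have "((\<lambda>\<theta>. \<gamma> m (\<theta> *\<^sub>R w)) has_real_derivative (\<Sum>j\<in>UNIV. w $ j * partial j (\<gamma> m) (\<theta> *\<^sub>R w))) (at \<theta>)" if "m < n" for m
  proof -
    have "((\<lambda>\<theta>. \<gamma> m (\<theta> *\<^sub>R w)) has_derivative (\<lambda>h. \<Sum>j\<in>UNIV. (h *\<^sub>R w) $ j * partial j (\<gamma> m) (\<theta> *\<^sub>R w))) (at \<theta>)"
      by (rule has_derivative_compose[OF _ has_derivative_partial[OF dg[OF that]]]) (auto intro!: derivative_eq_intros)
    moreover have "(\<lambda>h. \<Sum>j\<in>UNIV. (h *\<^sub>R w) $ j * partial j (\<gamma> m) (\<theta> *\<^sub>R w)) = (*) (\<Sum>j\<in>UNIV. w $ j * partial j (\<gamma> m) (\<theta> *\<^sub>R w))"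
      by (rule ext) (simp add: sum_distrib_left sum_distrib_right mult_ac)
    ultimately show ?thesis by (simp add: has_field_derivative_def)
  qed
  then have "((\<lambda>\<theta>. \<Sum>m<n. (LINT x|torus. a x * \<beta> m x) * \<gamma> m (\<theta> *\<^sub>R w)) has_real_derivative
    (\<Sum>m<n. (LINT x|torus. a x * \<beta> m x) * (\<Sum>j\<in>UNIV. w $ j * partial j (\<gamma> m) (\<theta> *\<^sub>R w)))) (at \<theta>)"
    by (intro DERIV_sum DERIV_cmult) auto
  also have "(\<Sum>m<n. (LINT x|torus. a x * \<beta> m x) * (\<Sum>j\<in>UNIV. w $ j * partial j (\<gamma> m) (\<theta> *\<^sub>R w)))
     = (\<Sum>j\<in>UNIV. w $ j * (\<Sum>m<n. (LINT x|torus. a x * \<beta> m x) * partial j (\<gamma> m) (\<theta> *\<^sub>R w)))"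
    unfolding sum_distrib_left by (subst sum.swap) (simp add: mult_ac)
  also have "\<dots> = - (\<Sum>j\<in>UNIV. w $ j * (LINT x|torus. a x * partial j p (x - \<theta> *\<^sub>R w)))"
    by (simp add: e2 sum_negf)
  finally show ?thesis by (simp add: e1)
qed

section \<open>Increments and the nonlinear energy transfer\<close>

text \<open>Put \<open>h \<theta> = (u, \<psi> (\<cdot> - \<theta> w))\<close> for a trigonometric field \<open>\<psi>\<close>.
  Then \<open>h 1 - h 0\<close> is the pairing of \<open>\<psi>\<close> with the increment of \<open>u\<close>,
  while \<open>h' \<theta> = (G w, \<psi> (\<cdot> - \<theta> w))\<close> by the definition of the weak gradient. By
  the mean value theorem and Cauchy--Schwarz, the pairing is at most \<open>|w| |G| |\<psi>|\<close> with
  \<open>L\<^sup>2\<close> norms of \<open>G\<close> and \<open>\<psi>\<close>. Finally \<open>\<psi>\<close> runs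
  through the mollifications of the increment.\<close>

lemma L2_translate_le:
  "(LINT x|torus. (norm (u (x + w) - u x))\<^sup>2) \<le> (norm w)\<^sup>2 * (L2_norm G)\<^sup>2"
proof -
  define d where "d i x = u (x + w) $ i - u x $ i" for i x
  have cd: "cper (d i)" for i unfolding d_def by (intro cper_diff cper_shift cper_u)
  define \<psi> where "\<psi> N i = convolve (kern N) (d i)" for N i
  have t\<psi>: "trigpoly (\<psi> N i)" for N i unfolding \<psi>_def by (intro trigpoly_convolve trigpoly_kern cper_integrable cd)
  have ul: "uniform_limit UNIV (\<lambda>N. \<psi> N i) (d i) sequentially" for i unfolding \<psi>_def by (rule convolve_kern_uniform[OF cd])
  define D where "D = (\<Sum>i\<in>UNIV. LINT x|torus. d i x * d i x)"
  define A where "A N = (\<Sum>i\<in>UNIV. LINT x|torus. d i x * \<psi> N i x)" for N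
  define B where "B N = (\<Sum>i\<in>UNIV. LINT x|torus. 1 * (\<psi> N i x * \<psi> N i x))" for N
  have AD: "A \<longlonglongrightarrow> D"
    unfolding A_def D_def
    by (intro tendsto_sum integral_uniform_limit[OF _ ul] cper_integrable cper_mult cd cper_trigpoly[OF t\<psi>])
  have BD: "B \<longlonglongrightarrow> D"
  proof -
    have "uniform_limit UNIV (\<lambda>N x. \<psi> N i x * \<psi> N i x) (\<lambda>x. d i x * d i x) sequentially" for i
    proof (rule uniform_lim_mult[OF ul ul])
      obtain K where "K \<ge> 0" "\<And>x. \<bar>d i x\<bar> \<le> K" by (rule cper_bounded[OF cd]) (rule that)
      then show "bounded (range (d i))" "bounded (range (d i))" by (auto simp: bounded_iff)
    qed
    then have "B \<longlonglongrightarrow> (\<Sum>i\<in>UNIV. LINT x|torus. 1 * (d i x * d i x))" unfolding B_def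
      by (intro tendsto_sum integral_uniform_limit cper_integrable cper_mult cd cper_const cper_trigpoly[OF t\<psi>])
    then show ?thesis by (simp add: D_def)
  qed
  have main: "(A N)\<^sup>2 \<le> (norm w)\<^sup>2 * (L2_norm G)\<^sup>2 * B N" for N
  proof -
    define h where "h \<theta> = (\<Sum>i\<in>UNIV. LINT x|torus. u x $ i * \<psi> N i (x - \<theta> *\<^sub>R w))" for \<theta>
    define h' where "h' \<theta> = (\<Sum>i\<in>UNIV. - (\<Sum>j\<in>UNIV. w $ j * (LINT x|torus. u x $ i * partial j (\<psi> N i) (x - \<theta> *\<^sub>R w))))" for \<theta>
    have "(h has_real_derivative h' \<theta>) (at \<theta>)" for \<theta>
      unfolding h_def h'_def by (intro DERIV_sum translation_derivative t\<psi> cper_integrable cper_u)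
    then have "\<exists>z>0. z < 1 \<and> h 1 - h 0 = (1 - 0) * h' z" by (intro MVT2) auto
    then obtain z where z: "h 1 - h 0 = h' z" by auto
    have sh: "trigpoly (\<lambda>x. \<psi> N i (x - y))" for i y
      using trigpoly_shift[OF t\<psi>, of N i "- y"] by simp
    have "h 1 - h 0 = A N"
    proof -
      have "(LINT x|torus. u x $ i * \<psi> N i (x - 1 *\<^sub>R w)) - (LINT x|torus. u x $ i * \<psi> N i (x - 0 *\<^sub>R w)) = (LINT x|torus. d i x * \<psi> N i x)" for i
      proof -
        have "(LINT x|torus. u x $ i * \<psi> N i (x - w)) = (LINT x|torus. u (x + w) $ i * \<psi> N i (x + w - w))"
          by (rule cper_translate[symmetric]) (intro cper_mult cper_u cper_trigpoly sh)
        moreover have "(LINT x|torus. d i x * \<psi> N i x) = (LINT x|torus. u (x + w) $ i * \<psi> N i x) - (LINT x|torus. u x $ i * \<psi> N i x)"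
          unfolding d_def left_diff_distrib
          by (intro Bochner_Integration.integral_diff cper_integrable cper_mult cper_shift[of "\<lambda>x. u x $ i"] cper_u cper_trigpoly t\<psi>)
        ultimately show ?thesis by simp
      qed
      then show ?thesis by (simp add: h_def A_def sum_subtractf[symmetric])
    qed
    with z have Ah: "A N = h' z" by simp
    let ?\<psi> = "\<lambda>x. \<chi> i. \<psi> N i (x - z *\<^sub>R w)"
    let ?G = "\<lambda>x. G x *v w"
    have mG: "G \<in> borel_measurable torus" by (rule L2_measurable[OF G_L2])
    have mGw: "?G \<in> borel_measurable torus"
      by (rule borel_measurable_continuous_on[OF _ mG, of "\<lambda>A. A *v w"])
        (intro linear_continuous_on linear_conv_bounded_linear[THEN iffD1] linearI; simp add: matrix_vector_mult_add_rdistrib scaleR_matrix_vector_assoc)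
    have iGw: "integrable torus (\<lambda>x. (norm (?G x))\<^sup>2)" and bGw: "(LINT x|torus. (norm (?G x))\<^sup>2) \<le> (norm w)\<^sup>2 * (L2_norm G)\<^sup>2"
    proof -
      have i: "integrable torus (\<lambda>x. (norm (G x))\<^sup>2)" using G_L2 by (simp add: L2_def)
      show *: "integrable torus (\<lambda>x. (norm (?G x))\<^sup>2)"
      proof (rule Bochner_Integration.integrable_bound)
        show "integrable torus (\<lambda>x. (norm (G x))\<^sup>2 * (norm w)\<^sup>2)" using i by simp
      qed (use mGw norm_matrix_vector_le in auto)
      have "(LINT x|torus. (norm (?G x))\<^sup>2) \<le> (LINT x|torus. (norm (G x))\<^sup>2 * (norm w)\<^sup>2)"
        by (rule integral_mono) (use * i norm_matrix_vector_le in auto)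
      then show "(LINT x|torus. (norm (?G x))\<^sup>2) \<le> (norm w)\<^sup>2 * (L2_norm G)\<^sup>2"
        by (simp add: L2_norm_sq[OF G_L2] mult.commute)
    qed
    have pL: "?\<psi> \<in> L2"
      using sh by (intro continuous_periodic_L2 continuous_on_vec_lambda trigpoly_continuous)
        (use trigpoly_periodic[OF sh] in \<open>auto simp: periodic_def vec_eq_iff\<close>)
    have "h' z = (\<Sum>i\<in>UNIV. \<Sum>j\<in>UNIV. LINT x|torus. (G x $ i $ j * w $ j) * \<psi> N i (x - z *\<^sub>R w))"
    proof -
      have "- (w $ j * (LINT x|torus. u x $ i * partial j (\<psi> N i) (x - z *\<^sub>R w))) = (LINT x|torus. (G x $ i $ j * w $ j) * \<psi> N i (x - z *\<^sub>R w))" for i j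
      proof -
        have "partial j (\<psi> N i) (x - z *\<^sub>R w) = partial j (\<lambda>x. \<psi> N i (x - z *\<^sub>R w)) x" for x
          using partial_shift[of "\<psi> N i" x "- z *\<^sub>R w" j] trigpoly_differentiable[OF t\<psi>] by simp
        then show ?thesis using weak_gradient_trigpoly[OF wg sh[of i "z *\<^sub>R w"], of i j] by (simp add: mult_ac)
      qed
      then show ?thesis by (simp add: h'_def sum_negf[symmetric])
    qed
    also have "\<dots> = (LINT x|torus. (\<Sum>i\<in>UNIV. \<Sum>j\<in>UNIV. (G x $ i $ j * w $ j) * \<psi> N i (x - z *\<^sub>R w)))"
      by (subst Bochner_Integration.integral_sum, intro Bochner_Integration.integrable_sum integrable_mult_trigpoly sh integrable_mult_left G_integrable,
          rule sum.cong[OF refl], subst Bochner_Integration.integral_sum, intro integrable_mult_trigpoly sh integrable_mult_left G_integrable, simp)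
    also have "\<dots> = (LINT x|torus. ?G x \<bullet> ?\<psi> x)"
      by (simp add: inner_vec_def matrix_vector_mult_def sum_distrib_right)
    finally have hz: "h' z = (LINT x|torus. ?G x \<bullet> ?\<psi> x)" .
    have "\<bar>h' z\<bar> \<le> sqrt (LINT x|torus. (norm (?G x))\<^sup>2) * sqrt (LINT x|torus. (norm (?\<psi> x))\<^sup>2)"
      unfolding hz by (rule Cauchy_Schwarz_L2[OF mGw L2_measurable[OF pL] iGw]) (use pL in \<open>simp add: L2_def\<close>)
    then have "\<bar>h' z\<bar>\<^sup>2 \<le> (sqrt (LINT x|torus. (norm (?G x))\<^sup>2) * sqrt (LINT x|torus. (norm (?\<psi> x))\<^sup>2))\<^sup>2"
      by (intro power_mono) auto
    then have "(h' z)\<^sup>2 \<le> (LINT x|torus. (norm (?G x))\<^sup>2) * (LINT x|torus. (norm (?\<psi> x))\<^sup>2)"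
      by (simp add: power_mult_distrib)
    also have "(LINT x|torus. (norm (?\<psi> x))\<^sup>2) = B N"
    proof -
      have "(LINT x|torus. (norm (?\<psi> x))\<^sup>2) = (\<Sum>i\<in>UNIV. LINT x|torus. (\<psi> N i (x - z *\<^sub>R w))\<^sup>2)"
        unfolding square_norm_vec vec_lambda_beta
        by (rule Bochner_Integration.integral_sum) (intro integrable_trigpoly trigpoly_power sh)
      also have "\<dots> = B N"
        unfolding B_def
      proof (rule sum.cong[OF refl])
        fix i :: 3
        have "cper (\<lambda>x. (\<psi> N i x)\<^sup>2)" by (intro cper_trigpoly trigpoly_power t\<psi>)
        from cper_translate[OF this, of "- (z *\<^sub>R w)"]
        show "(LINT x|torus. (\<psi> N i (x - z *\<^sub>R w))\<^sup>2) = (LINT x|torus. 1 * (\<psi> N i x * \<psi> N i x))"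
          by (simp add: power2_eq_square)
      qed
      finally show ?thesis .
    qed
    finally have "(h' z)\<^sup>2 \<le> (LINT x|torus. (norm (?G x))\<^sup>2) * B N" .
    also have "\<dots> \<le> (norm w)\<^sup>2 * (L2_norm G)\<^sup>2 * B N"
      by (intro mult_right_mono bGw) (simp add: B_def sum_nonneg)
    finally show ?thesis by (simp add: Ah)
  qed
  have "D\<^sup>2 \<le> (norm w)\<^sup>2 * (L2_norm G)\<^sup>2 * D"
    by (rule LIMSEQ_le[OF tendsto_power[OF AD] tendsto_mult_left[OF BD]]) (use main in auto)
  moreover have "D \<ge> 0" unfolding D_def by (intro sum_nonneg) simp
  ultimately have "D \<le> (norm w)\<^sup>2 * (L2_norm G)\<^sup>2"
    by (cases "D = 0") (auto simp: power2_eq_square)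
  also have "D = (LINT x|torus. (norm (u (x + w) - u x))\<^sup>2)"
  proof -
    have "(LINT x|torus. (norm (u (x + w) - u x))\<^sup>2) = (LINT x|torus. (\<Sum>i\<in>UNIV. d i x * d i x))"
      unfolding square_norm_vec by (simp add: d_def power2_eq_square)
    also have "\<dots> = D" unfolding D_def
      by (rule Bochner_Integration.integral_sum) (intro cper_integrable cper_mult cd)
    finally show ?thesis by simp
  qed
  finally show ?thesis .
qed

definition increment :: "real^3 \<Rightarrow> real^3 \<Rightarrow> real^3" where "increment z x = u (x + z) - u x"

text \<open>The nonlinear term \<open>((u \<cdot> \<nabla>)u, J * u)\<close>: the rate at which the mollified field loses energy
  to small scales.\<close>

definition transfer :: "(real^3 \<Rightarrow> real) \<Rightarrow> real"
  where "transfer J = (\<Sum>i\<in>UNIV. \<Sum>j\<in>UNIV. LINT x|torus. G x $ i $ j * u x $ j * convolve J (\<lambda>y. u y $ i) x)"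

lemma partial_odd:
  assumes "trigpoly J" "\<And>z. J (- z) = J z"
  shows "partial j J (- z) = - partial j J z"
proof -
  have "partial j (\<lambda>z. J (- z)) z = - partial j J (- z)" by (rule partial_uminus[OF trigpoly_differentiable[OF assms(1)]])
  then show ?thesis using assms(2) by simp
qed

lemma transfer_conv_form:
  assumes J: "trigpoly J"
  shows "transfer J = - (\<Sum>i\<in>UNIV. \<Sum>j\<in>UNIV. conv_form (partial j J) (\<lambda>x. u x $ i * u x $ j) (\<lambda>x. u x $ i))"
proof -
  have "trigpoly (convolve J (\<lambda>y. u y $ i))" for i by (intro trigpoly_convolve J cper_integrable cper_u)
  from convection_by_parts[OF this] show ?thesis
    by (simp add: transfer_def conv_form_def sum_negf partial_convolve[OF J cper_integrable[OF cper_u]])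
qed

text \<open>The identity of Duchon and Robert. With \<open>a = u x\<close> and \<open>b = u y\<close>, the cubic expression
  \<open>(a\<^sub>j - b\<^sub>j)(a\<^sub>i - b\<^sub>i)\<^sup>2\<close> has six terms. Two depend on only one of the
  points and vanish because the derivative of \<open>J\<close> has mean zero; two contain \<open>a\<^sub>j\<close>
  or \<open>b\<^sub>j\<close> next to the square of the other value and vanish after summation over \<open>j\<close>
  because \<open>u\<close> is divergence-free; the last two agree because the derivative of \<open>J\<close> is odd,
  and give the transfer term.\<close>

lemma increment_integral_expand:
  assumes J: "trigpoly J" and even: "\<And>z. J (- z) = J z"
  shows "(LINT x|torus. LINT z|torus. (\<Sum>j\<in>UNIV. \<Sum>i\<in>UNIV. partial j J z * increment z x $ j * (increment z x $ i)\<^sup>2))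
    = - 4 * (\<Sum>i\<in>UNIV. \<Sum>j\<in>UNIV. conv_form (partial j J) (\<lambda>x. u x $ i * u x $ j) (\<lambda>x. u x $ i))"
proof -
  let ?a = "\<lambda>i x. u x $ i"
  let ?t = "\<lambda>j b x. convolve (partial j J) b x"
  let ?k = "\<lambda>j a b. conv_form (partial j J) a b"
  have tP: "trigpoly (partial j J)" for j by (rule trigpoly_partial[OF J])
  have ci: "integrable torus (\<lambda>_. c)" for c :: real by (rule cper_integrable[OF cper_const])
  have ii: "integrable torus (?a i)" "integrable torus (\<lambda>x. ?a i x * ?a j x)" "integrable torus (\<lambda>x. (?a i x)\<^sup>2)"
    "integrable torus (\<lambda>x. ?a j x * (?a i x)\<^sup>2)" for i j
    by (intro cper_integrable cper_mult cper_power cper_u)+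
  have inner: "(LINT z|torus. (\<Sum>j\<in>UNIV. \<Sum>i\<in>UNIV. partial j J z * increment z x $ j * (increment z x $ i)\<^sup>2))
     = (\<Sum>j\<in>UNIV. \<Sum>i\<in>UNIV. (?a j x * (?a i x)\<^sup>2) * ?t j (\<lambda>_. 1) x - 2 * ((?a i x * ?a j x) * ?t j (?a i) x) + ?a j x * ?t j (\<lambda>y. (?a i y)\<^sup>2) x
        - (?a i x)\<^sup>2 * ?t j (?a j) x + 2 * (?a i x * ?t j (\<lambda>y. ?a i y * ?a j y) x) - 1 * ?t j (\<lambda>y. ?a j y * (?a i y)\<^sup>2) x)" for x
  proof -
    define F where "F y = (\<Sum>j\<in>UNIV. \<Sum>i\<in>UNIV. partial j J (x - y) * (?a j x - ?a j y) * (?a i x - ?a i y)\<^sup>2)" for y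
    have cF: "cper F"
      unfolding F_def by (intro cper_sum cper_mult cper_power cper_diff cper_const cper_u cper_trigpoly trigpoly_reflect tP)
    have "(LINT z|torus. (\<Sum>j\<in>UNIV. \<Sum>i\<in>UNIV. partial j J z * increment z x $ j * (increment z x $ i)\<^sup>2)) = (LINT z|torus. F (z + x))"
    proof (rule Bochner_Integration.integral_cong[OF refl])
      fix z
      have "partial j J z * increment z x $ j * (increment z x $ i)\<^sup>2 = partial j J (x - (z + x)) * (?a j x - ?a j (z + x)) * (?a i x - ?a i (z + x))\<^sup>2" for i j
        using partial_odd[OF J even, of j z] by (simp add: increment_def add.commute power2_commute algebra_simps)
      then show "(\<Sum>j\<in>UNIV. \<Sum>i\<in>UNIV. partial j J z * increment z x $ j * (increment z x $ i)\<^sup>2) = F (z + x)"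
        by (simp add: F_def)
    qed
    also have "\<dots> = (LINT y|torus. F y)" by (rule cper_translate[OF cF])
    also have "\<dots> = (\<Sum>j\<in>UNIV. \<Sum>i\<in>UNIV. LINT y|torus. partial j J (x - y) * (?a j x - ?a j y) * (?a i x - ?a i y)\<^sup>2)"
      unfolding F_def
      by (subst Bochner_Integration.integral_sum, (intro Bochner_Integration.integrable_sum)?,
          (intro cper_integrable cper_mult cper_power cper_diff cper_const cper_u cper_trigpoly trigpoly_reflect tP)?,
          rule sum.cong[OF refl], subst Bochner_Integration.integral_sum,
          (intro cper_integrable cper_mult cper_power cper_diff cper_const cper_u cper_trigpoly trigpoly_reflect tP)?, rule refl)
    also have "\<dots> = (\<Sum>j\<in>UNIV. \<Sum>i\<in>UNIV. (?a j x * (?a i x)\<^sup>2) * ?t j (\<lambda>_. 1) x - 2 * ((?a i x * ?a j x) * ?t j (?a i) x) + ?a j x * ?t j (\<lambda>y. (?a i y)\<^sup>2) x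
        - (?a i x)\<^sup>2 * ?t j (?a j) x + 2 * (?a i x * ?t j (\<lambda>y. ?a i y * ?a j y) x) - 1 * ?t j (\<lambda>y. ?a j y * (?a i y)\<^sup>2) x)"
    proof (intro sum.cong refl)
      fix j i :: 3
      note tt = convolve_integrand[OF tP[of j], where x=x]
      have "(LINT y|torus. partial j J (x - y) * (?a j x - ?a j y) * (?a i x - ?a i y)\<^sup>2)
        = (LINT y|torus. (?a j x * (?a i x)\<^sup>2) * (partial j J (x - y) * 1) - 2 * ((?a i x * ?a j x) * (partial j J (x - y) * ?a i y)) + ?a j x * (partial j J (x - y) * (?a i y)\<^sup>2)
        - (?a i x)\<^sup>2 * (partial j J (x - y) * ?a j y) + 2 * (?a i x * (partial j J (x - y) * (?a i y * ?a j y))) - 1 * (partial j J (x - y) * (?a j y * (?a i y)\<^sup>2)))"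
        by (rule Bochner_Integration.integral_cong[OF refl]) (simp add: power2_eq_square algebra_simps)
      also have "\<dots> = (?a j x * (?a i x)\<^sup>2) * ?t j (\<lambda>_. 1) x - 2 * ((?a i x * ?a j x) * ?t j (?a i) x) + ?a j x * ?t j (\<lambda>y. (?a i y)\<^sup>2) x
        - (?a i x)\<^sup>2 * ?t j (?a j) x + 2 * (?a i x * ?t j (\<lambda>y. ?a i y * ?a j y) x) - 1 * ?t j (\<lambda>y. ?a j y * (?a i y)\<^sup>2) x"
        unfolding convolve_def
        using tt[OF ci[of 1]] tt[OF ii(1)[of i]] tt[OF ii(1)[of j]] tt[OF ii(2)[of i j]] tt[OF ii(3)[of i]] tt[OF ii(4)[of j i]]
        by (simp only: Bochner_Integration.integral_add Bochner_Integration.integral_diff Bochner_Integration.integral_mult_right_zero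
            Bochner_Integration.integrable_add Bochner_Integration.integrable_diff Bochner_Integration.integrable_mult_right)
      finally show "(LINT y|torus. partial j J (x - y) * (?a j x - ?a j y) * (?a i x - ?a i y)\<^sup>2)
        = (?a j x * (?a i x)\<^sup>2) * ?t j (\<lambda>_. 1) x - 2 * ((?a i x * ?a j x) * ?t j (?a i) x) + ?a j x * ?t j (\<lambda>y. (?a i y)\<^sup>2) x
        - (?a i x)\<^sup>2 * ?t j (?a j) x + 2 * (?a i x * ?t j (\<lambda>y. ?a i y * ?a j y) x) - 1 * ?t j (\<lambda>y. ?a j y * (?a i y)\<^sup>2) x" .
    qed
    finally show ?thesis .
  qed
  have "(LINT x|torus. LINT z|torus. (\<Sum>j\<in>UNIV. \<Sum>i\<in>UNIV. partial j J z * increment z x $ j * (increment z x $ i)\<^sup>2))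
    = (\<Sum>j\<in>UNIV. \<Sum>i\<in>UNIV. ?k j (\<lambda>x. ?a j x * (?a i x)\<^sup>2) (\<lambda>_. 1) - 2 * ?k j (\<lambda>x. ?a i x * ?a j x) (?a i) + ?k j (?a j) (\<lambda>y. (?a i y)\<^sup>2)
        - ?k j (\<lambda>x. (?a i x)\<^sup>2) (?a j) + 2 * ?k j (?a i) (\<lambda>y. ?a i y * ?a j y) - ?k j (\<lambda>_. 1) (\<lambda>y. ?a j y * (?a i y)\<^sup>2))"
    unfolding inner
    by (subst Bochner_Integration.integral_sum,
       intro Bochner_Integration.integrable_sum Bochner_Integration.integrable_add Bochner_Integration.integrable_diff Bochner_Integration.integrable_mult_right conv_form_integrable tP ii ci,
       rule sum.cong[OF refl], subst Bochner_Integration.integral_sum,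
       intro Bochner_Integration.integrable_sum Bochner_Integration.integrable_add Bochner_Integration.integrable_diff Bochner_Integration.integrable_mult_right conv_form_integrable tP ii ci,
       unfold conv_form_def, rule sum.cong[OF refl],
       simp only: Bochner_Integration.integral_add Bochner_Integration.integral_diff Bochner_Integration.integral_mult_right_zero
            Bochner_Integration.integrable_add Bochner_Integration.integrable_diff Bochner_Integration.integrable_mult_right
            conv_form_integrable[OF tP ii(1) ii(2)] conv_form_integrable[OF tP ii(1) ii(3)] conv_form_integrable[OF tP ii(3) ii(1)] conv_form_integrable[OF tP ii(2) ii(1)]
            conv_form_integrable[OF tP ii(4) ci] conv_form_integrable[OF tP ci ii(4)])
  also have "\<dots> = (\<Sum>j\<in>UNIV. \<Sum>i\<in>UNIV. 2 * ?k j (?a j) (\<lambda>y. (?a i y)\<^sup>2) - 4 * ?k j (\<lambda>x. ?a i x * ?a j x) (?a i))"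
  proof (intro sum.cong refl)
    fix j i :: 3
    have flip: "?k j a b = - ?k j b a" if "integrable torus a" "integrable torus b" for a b
      using conv_form_flip[OF tP that, of j] conv_form_scale_kernel[of "-1" "partial j J" b a] by (simp add: partial_odd[OF J even])
    have one: "?k j a (\<lambda>_. 1) = 0" if "integrable torus a" for a
      using conv_form_one[OF tP that, of j] integral_partial_trigpoly[OF J, of j] by (simp add: partial_odd[OF J even])
    show "?k j (\<lambda>x. ?a j x * (?a i x)\<^sup>2) (\<lambda>_. 1) - 2 * ?k j (\<lambda>x. ?a i x * ?a j x) (?a i) + ?k j (?a j) (\<lambda>y. (?a i y)\<^sup>2)
        - ?k j (\<lambda>x. (?a i x)\<^sup>2) (?a j) + 2 * ?k j (?a i) (\<lambda>y. ?a i y * ?a j y) - ?k j (\<lambda>_. 1) (\<lambda>y. ?a j y * (?a i y)\<^sup>2)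
       = 2 * ?k j (?a j) (\<lambda>y. (?a i y)\<^sup>2) - 4 * ?k j (\<lambda>x. ?a i x * ?a j x) (?a i)"
      using one[OF ii(4)[of j i]] flip[OF ci[of 1] ii(4)[of j i]] flip[OF ii(3)[of i] ii(1)[of j]] flip[OF ii(1)[of i] ii(2)[of i j]]
      by simp
  qed
  also have "\<dots> = 2 * (\<Sum>i\<in>UNIV. \<Sum>j\<in>UNIV. ?k j (?a j) (\<lambda>y. (?a i y)\<^sup>2)) - 4 * (\<Sum>i\<in>UNIV. \<Sum>j\<in>UNIV. ?k j (\<lambda>x. ?a i x * ?a j x) (?a i))"
    by (subst sum.swap) (simp add: sum_subtractf sum_distrib_left)
  finally have expand: "(LINT x|torus. LINT z|torus. (\<Sum>j\<in>UNIV. \<Sum>i\<in>UNIV. partial j J z * increment z x $ j * (increment z x $ i)\<^sup>2))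
    = 2 * (\<Sum>i\<in>UNIV. \<Sum>j\<in>UNIV. ?k j (?a j) (\<lambda>y. (?a i y)\<^sup>2)) - 4 * (\<Sum>i\<in>UNIV. \<Sum>j\<in>UNIV. ?k j (\<lambda>x. ?a i x * ?a j x) (?a i))" .
  have "(\<Sum>j\<in>UNIV. ?k j (?a j) (\<lambda>y. (?a i y)\<^sup>2)) = 0" for i
    using orth[OF trigpoly_convolve[OF J ii(3)[of i]]] by (simp add: conv_form_def partial_convolve[OF J ii(3)])
  with expand show ?thesis by simp
qed

lemma continuous_increment: "continuous_on UNIV (\<lambda>p. increment (snd p) (fst p) $ i)"
  unfolding increment_def
  by (intro continuous_intros continuous_on_compose2[OF continuous_u]) auto

lemma cper_increment: "cper (\<lambda>x. increment z x $ i)"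
  unfolding increment_def using cper_diff[OF cper_shift[OF cper_u[of i], of z] cper_u[of i]] by simp

lemma transfer_eq_increments:
  assumes J: "trigpoly J" and even: "\<And>z. J (- z) = J z"
  shows "4 * transfer J = (LINT z|torus. (\<Sum>j\<in>UNIV. partial j J z * (LINT x|torus. increment z x $ j * (norm (increment z x))\<^sup>2)))"
    and "continuous_on UNIV (\<lambda>z. LINT x|torus. increment z x $ j * (norm (increment z x))\<^sup>2)"
proof -
  have c: "continuous_on UNIV (\<lambda>p. partial j J (snd p))" for j
    by (rule continuous_on_compose2[OF trigpoly_continuous[OF trigpoly_partial[OF J], of UNIV]]) (auto intro!: continuous_intros)
  have cn: "continuous_on UNIV (\<lambda>p. (norm (increment (snd p) (fst p)))\<^sup>2)"
    unfolding square_norm_vec by (intro continuous_intros continuous_increment)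
  show "continuous_on UNIV (\<lambda>z. LINT x|torus. increment z x $ j * (norm (increment z x))\<^sup>2)"
    by (rule torus_swap(2)) (intro continuous_on_mult continuous_increment cn)
  have "4 * transfer J = (LINT x|torus. LINT z|torus. (\<Sum>j\<in>UNIV. \<Sum>i\<in>UNIV. partial j J z * increment z x $ j * (increment z x $ i)\<^sup>2))"
    using increment_integral_expand[OF assms] transfer_conv_form[OF J] by simp
  also have "\<dots> = (LINT z|torus. LINT x|torus. (\<Sum>j\<in>UNIV. \<Sum>i\<in>UNIV. partial j J z * increment z x $ j * (increment z x $ i)\<^sup>2))"
    by (rule torus_swap(1)) (intro continuous_on_sum continuous_on_mult continuous_on_power c continuous_increment)
  also have "\<dots> = (LINT z|torus. (\<Sum>j\<in>UNIV. partial j J z * (LINT x|torus. increment z x $ j * (norm (increment z x))\<^sup>2)))"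
  proof (rule Bochner_Integration.integral_cong[OF refl])
    fix z
    have "(LINT x|torus. (\<Sum>j\<in>UNIV. \<Sum>i\<in>UNIV. partial j J z * increment z x $ j * (increment z x $ i)\<^sup>2))
      = (LINT x|torus. (\<Sum>j\<in>UNIV. partial j J z * (increment z x $ j * (norm (increment z x))\<^sup>2)))"
      unfolding square_norm_vec sum_distrib_left by (simp add: mult.assoc)
    also have "\<dots> = (\<Sum>j\<in>UNIV. partial j J z * (LINT x|torus. increment z x $ j * (norm (increment z x))\<^sup>2))"
      by (subst Bochner_Integration.integral_sum, unfold square_norm_vec,
        intro Bochner_Integration.integrable_mult_right cper_integrable cper_mult cper_sum cper_power cper_increment, simp)
    finally show "(LINT x|torus. (\<Sum>j\<in>UNIV. \<Sum>i\<in>UNIV. partial j J z * increment z x $ j * (increment z x $ i)\<^sup>2))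
      = (\<Sum>j\<in>UNIV. partial j J z * (LINT x|torus. increment z x $ j * (norm (increment z x))\<^sup>2))" .
  qed
  finally show "4 * transfer J = (LINT z|torus. (\<Sum>j\<in>UNIV. partial j J z * (LINT x|torus. increment z x $ j * (norm (increment z x))\<^sup>2)))" .
qed

lemma norm_increment_le: "norm (increment z x) \<le> f * (4 * tdist z) powr \<alpha>"
proof -
  obtain w where w: "\<And>i. \<exists>n::int. w $ i = z $ i + 2 * pi * of_int n" "norm w \<le> 4 * tdist z" by (rule tdist_lift) (rule that)
  have "u (x + w) = u (x + z)"
    by (rule periodic_lattice[OF per]) (use w(1) in \<open>simp add: algebra_simps\<close>)
  then have "norm (increment z x) = norm (u (x + w) - u x)" by (simp add: increment_def)
  also have "\<dots> \<le> f * norm w powr \<alpha>" using holder[of "x + w" x] by simp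
  also have "\<dots> \<le> f * (4 * tdist z) powr \<alpha>"
    using w(2) alpha(1) f_nonneg by (intro mult_left_mono powr_mono2) auto
  finally show ?thesis .
qed

lemma increment_energy_le_gradient: "(LINT x|torus. (norm (increment z x))\<^sup>2) \<le> (4 * tdist z * L2_norm G)\<^sup>2"
proof -
  obtain w where w: "\<And>i. \<exists>n::int. w $ i = z $ i + 2 * pi * of_int n" "norm w \<le> 4 * tdist z" by (rule tdist_lift) (rule that)
  have "u (x + w) = u (x + z)" for x
    by (rule periodic_lattice[OF per]) (use w(1) in \<open>simp add: algebra_simps\<close>)
  then have "(LINT x|torus. (norm (increment z x))\<^sup>2) = (LINT x|torus. (norm (u (x + w) - u x))\<^sup>2)" by (simp add: increment_def)
  also have "\<dots> \<le> (norm w)\<^sup>2 * (L2_norm G)\<^sup>2" by (rule L2_translate_le)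
  also have "\<dots> \<le> (4 * tdist z)\<^sup>2 * (L2_norm G)\<^sup>2" by (intro mult_right_mono power_mono w(2)) auto
  finally show ?thesis by (simp add: power_mult_distrib)
qed

lemma cper_norm_sq_u: "cper (\<lambda>x. (norm (u x))\<^sup>2)"
  unfolding square_norm_vec by (intro cper_sum cper_power cper_u)

lemma cper_norm_sq_increment: "cper (\<lambda>x. (norm (increment z x))\<^sup>2)"
  unfolding square_norm_vec by (intro cper_sum cper_power cper_increment)

lemma increment_energy_le: "(LINT x|torus. (norm (increment z x))\<^sup>2) \<le> (2 * L2_norm u)\<^sup>2"
proof -
  have "(LINT x|torus. (norm (increment z x))\<^sup>2) \<le> (LINT x|torus. 2 * (norm (u (x + z)))\<^sup>2 + 2 * (norm (u x))\<^sup>2)"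
  proof (rule integral_mono)
    show "integrable torus (\<lambda>x. (norm (increment z x))\<^sup>2)" by (intro cper_integrable cper_norm_sq_increment)
    show "integrable torus (\<lambda>x. 2 * (norm (u (x + z)))\<^sup>2 + 2 * (norm (u x))\<^sup>2)"
      by (intro Bochner_Integration.integrable_add Bochner_Integration.integrable_mult_right cper_integrable cper_shift[OF cper_norm_sq_u] cper_norm_sq_u)
    fix x
    have "(norm (increment z x))\<^sup>2 \<le> (norm (u (x + z)) + norm (u x))\<^sup>2" unfolding increment_def by (intro power_mono norm_triangle_ineq4) simp
    also have "\<dots> \<le> 2 * (norm (u (x + z)))\<^sup>2 + 2 * (norm (u x))\<^sup>2"
      using sum_squares_bound[of "norm (u (x + z))" "norm (u x)"] by (simp add: power2_sum)
    finally show "(norm (increment z x))\<^sup>2 \<le> 2 * (norm (u (x + z)))\<^sup>2 + 2 * (norm (u x))\<^sup>2" .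
  qed
  also have "\<dots> = 2 * (LINT x|torus. (norm (u (x + z)))\<^sup>2) + 2 * (LINT x|torus. (norm (u x))\<^sup>2)"
    by (subst Bochner_Integration.integral_add)
      (auto intro!: cper_integrable cper_shift[OF cper_norm_sq_u] cper_norm_sq_u)
  also have "(LINT x|torus. (norm (u (x + z)))\<^sup>2) = (LINT x|torus. (norm (u x))\<^sup>2)" by (rule cper_translate[OF cper_norm_sq_u])
  finally show ?thesis by (simp add: L2_norm_sq[OF u_L2] power_mult_distrib)
qed

lemma cubic_increment_le:
  "\<bar>LINT x|torus. increment z x $ j * (norm (increment z x))\<^sup>2\<bar> \<le> f * (4 * tdist z) powr \<alpha> * (LINT x|torus. (norm (increment z x))\<^sup>2)"
proof -
  have "\<bar>LINT x|torus. increment z x $ j * (norm (increment z x))\<^sup>2\<bar> \<le> (LINT x|torus. \<bar>increment z x $ j * (norm (increment z x))\<^sup>2\<bar>)"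
    by (rule integral_abs_bound)
  also have "\<dots> \<le> (LINT x|torus. f * (4 * tdist z) powr \<alpha> * (norm (increment z x))\<^sup>2)"
  proof (rule integral_mono)
    show "integrable torus (\<lambda>x. \<bar>increment z x $ j * (norm (increment z x))\<^sup>2\<bar>)"
      by (intro Bochner_Integration.integrable_abs cper_integrable cper_mult cper_increment cper_norm_sq_increment)
    show "integrable torus (\<lambda>x. f * (4 * tdist z) powr \<alpha> * (norm (increment z x))\<^sup>2)"
      by (intro Bochner_Integration.integrable_mult_right cper_integrable cper_norm_sq_increment)
    fix x
    have "\<bar>increment z x $ j\<bar> \<le> f * (4 * tdist z) powr \<alpha>"
      using component_le_norm_cart[of "increment z x" j] norm_increment_le[of z x] by linarith
    then show "\<bar>increment z x $ j * (norm (increment z x))\<^sup>2\<bar> \<le> f * (4 * tdist z) powr \<alpha> * (norm (increment z x))\<^sup>2"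
      unfolding abs_mult by (simp add: mult_right_mono)
  qed
  finally show ?thesis by simp
qed

text \<open>The distance weights of the increments are paired with the slope of the kernel, so that only the moments of the
  kernel enter.\<close>

lemma transfer_kern_le:
  assumes Q: "\<And>j. trigpoly (Q j)" and c: "c \<ge> 0" and q: "\<And>j. (LINT z|torus. Q j z) \<le> q"
    and b: "\<And>z j. \<bar>partial j (kern N) z\<bar> * \<bar>LINT x|torus. increment z x $ j * (norm (increment z x))\<^sup>2\<bar> \<le> c * Q j z"
  shows "4 * \<bar>transfer (kern N)\<bar> \<le> 3 * c * q"
proof -
  let ?E = "\<lambda>j z. LINT x|torus. increment z x $ j * (norm (increment z x))\<^sup>2"
  have cE: "continuous_on UNIV (\<lambda>z. partial j (kern N) z * ?E j z)" for j
    by (intro continuous_on_mult transfer_eq_increments(2)[OF trigpoly_kern kern_even] trigpoly_continuous trigpoly_partial trigpoly_kern)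
  have iE: "integrable torus (\<lambda>z. \<Sum>j\<in>UNIV. partial j (kern N) z * ?E j z)"
    by (intro torus_integral_eq(1) continuous_on_sum cE)
  have "4 * \<bar>transfer (kern N)\<bar> = \<bar>4 * transfer (kern N)\<bar>" by simp
  also have "\<dots> \<le> (LINT z|torus. \<bar>\<Sum>j\<in>UNIV. partial j (kern N) z * ?E j z\<bar>)"
    unfolding transfer_eq_increments(1)[OF trigpoly_kern kern_even] by (rule integral_abs_bound)
  also have "\<dots> \<le> (LINT z|torus. (\<Sum>j\<in>UNIV. c * Q j z))"
  proof (rule integral_mono)
    show "integrable torus (\<lambda>z. \<bar>\<Sum>j\<in>UNIV. partial j (kern N) z * ?E j z\<bar>)" using iE by (rule Bochner_Integration.integrable_abs)
    show "integrable torus (\<lambda>z. \<Sum>j\<in>UNIV. c * Q j z)" by (intro integrable_trigpoly trigpoly_sum trigpoly.scale Q)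
    fix z
    have "\<bar>\<Sum>j\<in>UNIV. partial j (kern N) z * ?E j z\<bar> \<le> (\<Sum>j\<in>UNIV. \<bar>partial j (kern N) z * ?E j z\<bar>)" by (rule sum_abs)
    also have "\<dots> \<le> (\<Sum>j\<in>UNIV. c * Q j z)" by (intro sum_mono) (simp only: abs_mult b)
    finally show "\<bar>\<Sum>j\<in>UNIV. partial j (kern N) z * ?E j z\<bar> \<le> (\<Sum>j\<in>UNIV. c * Q j z)" .
  qed
  also have "\<dots> = (\<Sum>j\<in>UNIV. c * (LINT z|torus. Q j z))"
    by (subst Bochner_Integration.integral_sum, intro integrable_trigpoly trigpoly.scale Q, simp)
  also have "\<dots> \<le> (\<Sum>j\<in>(UNIV :: 3 set). c * q)" by (intro sum_mono mult_left_mono q c)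
  finally show ?thesis by simp
qed

text \<open>At a fixed time, the gradient bound for the increments leaves one power of the distance more than a bounded moment
  of the slope requires, and the transfer tends to zero. The factor \<open>f |G|\<^sup>2\<close>, however, may fail
  to be integrable in time.\<close>

lemma transfer_bound_small: "\<bar>transfer (kern N)\<bar> \<le> 4608 * (f * (L2_norm G)\<^sup>2) / sqrt (real N + 1)"
proof -
  have "4 * \<bar>transfer (kern N)\<bar> \<le> 3 * (192 * (f * (L2_norm G)\<^sup>2)) * (32 / sqrt (real N + 1))"
  proof (rule transfer_kern_le[where Q="slope_majorant2 N"])
    fix z j
    let ?D = "LINT x|torus. (norm (increment z x))\<^sup>2"
    have t: "0 \<le> 4 * tdist z" "4 * tdist z \<le> 12" using tdist_nonneg[of z] tdist_le_3[of z] by auto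
    have p: "(4 * tdist z) powr \<alpha> \<le> 12"
    proof -
      have "(4 * tdist z) powr \<alpha> \<le> 12 powr \<alpha>" using t alpha by (intro powr_mono2) auto
      also have "\<dots> \<le> 12 powr 1" using alpha by (intro powr_mono) auto
      finally show ?thesis by simp
    qed
    have "\<bar>LINT x|torus. increment z x $ j * (norm (increment z x))\<^sup>2\<bar> \<le> f * (4 * tdist z) powr \<alpha> * ?D" by (rule cubic_increment_le)
    also have "\<dots> \<le> f * 12 * (4 * tdist z * L2_norm G)\<^sup>2"
      using f_nonneg p by (intro mult_mono increment_energy_le_gradient mult_left_mono) auto
    also have "\<dots> = 192 * (f * (L2_norm G)\<^sup>2) * (tdist z)\<^sup>2" by (simp add: power_mult_distrib)
    finally have "\<bar>partial j (kern N) z\<bar> * \<bar>LINT x|torus. increment z x $ j * (norm (increment z x))\<^sup>2\<bar>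
      \<le> \<bar>partial j (kern N) z\<bar> * (192 * (f * (L2_norm G)\<^sup>2) * (tdist z)\<^sup>2)" by (intro mult_left_mono) auto
    also have "\<dots> = 192 * (f * (L2_norm G)\<^sup>2) * (\<bar>partial j (kern N) z\<bar> * (tdist z)\<^sup>2)" by (simp only: mult_ac)
    also have "\<dots> \<le> 192 * (f * (L2_norm G)\<^sup>2) * slope_majorant2 N j z" using f_nonneg by (intro mult_left_mono partial_kern_tdist2) auto
    finally show "\<bar>partial j (kern N) z\<bar> * \<bar>LINT x|torus. increment z x $ j * (norm (increment z x))\<^sup>2\<bar>
      \<le> 192 * (f * (L2_norm G)\<^sup>2) * slope_majorant2 N j z" .
  qed (use f_nonneg trigpoly_slope_majorant2 int_slope_majorant2 in auto)
  also have "\<dots> = 4 * (4608 * (f * (L2_norm G)\<^sup>2) / sqrt (real N + 1))" by simp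
  finally show ?thesis by linarith
qed

text \<open>The exponents \<open>2 / (1 + \<alpha>)\<close> and \<open>2 / (1 - \<alpha>)\<close> are conjugate.\<close>

lemma young_split:
  fixes a b :: real
  assumes "a \<ge> 0" "b \<ge> 0"
  shows "a * b powr (1 - \<alpha>) \<le> a powr (2 / (1 + \<alpha>)) + b\<^sup>2"
proof (cases "a \<le> b powr (1 + \<alpha>)")
  case True
  have "a * b powr (1 - \<alpha>) \<le> b powr (1 + \<alpha>) * b powr (1 - \<alpha>)" using True by (intro mult_right_mono) auto
  also have "\<dots> = b\<^sup>2" using assms(2) by (simp add: powr_add[symmetric])
  finally show ?thesis by (simp add: add_increasing)
next
  case False
  have e: "1 + (1 - \<alpha>) / (1 + \<alpha>) = 2 / (1 + \<alpha>)" using alpha by (simp add: field_simps)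
  have a: "a > 0" using False by (meson not_le order_trans powr_ge_zero)
  have "b = (b powr (1 + \<alpha>)) powr (1 / (1 + \<alpha>))" using assms alpha by (simp add: powr_powr)
  also have "\<dots> \<le> a powr (1 / (1 + \<alpha>))" using False alpha by (intro powr_mono2) auto
  finally have "b powr (1 - \<alpha>) \<le> (a powr (1 / (1 + \<alpha>))) powr (1 - \<alpha>)" using assms alpha by (intro powr_mono2) auto
  then have "b powr (1 - \<alpha>) \<le> a powr ((1 - \<alpha>) / (1 + \<alpha>))" by (simp add: powr_powr)
  then have "a * b powr (1 - \<alpha>) \<le> a powr 1 * a powr ((1 - \<alpha>) / (1 + \<alpha>))" using a by (simp add: mult_left_mono)
  also have "\<dots> = a powr (2 / (1 + \<alpha>))" using a by (simp only: powr_add[symmetric] e)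
  finally show ?thesis by (simp add: add_increasing2)
qed

text \<open>The energy of the increments is interpolated between \<open>(|z| |G|)\<^sup>2\<close> and
  \<open>(2 |u|)\<^sup>2\<close> such that, together with the Hoelder factor \<open>|z|\<^sup>\<alpha>\<close>,
  exactly one power of \<open>|z|\<close> remains. The slope of the kernel has a bounded moment of this order, and
  \<open>f |G|\<^sup>1\<^sup>-\<^sup>\<alpha>\<close> is integrable in time for \<open>f\<close> of class
  \<open>L\<^sup>p\<close> with \<open>p = 2 / (1 + \<alpha>)\<close>.\<close>

lemma transfer_bound_integrable:
  "\<bar>transfer (kern N)\<bar> \<le> 18 * (2 * L2_norm u) powr (1 + \<alpha>) * (f powr (2 / (1 + \<alpha>)) + (L2_norm G)\<^sup>2)"
proof -
  let ?g = "L2_norm G" and ?m = "2 * L2_norm u"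
  define Y where "Y = f powr (2 / (1 + \<alpha>)) + ?g\<^sup>2"
  have Y: "Y \<ge> 0" by (simp add: Y_def)
  have g: "?g \<ge> 0" and m: "?m \<ge> 0" using L2_norm_nonneg[of G] L2_norm_nonneg[of u] by auto
  have "4 * \<bar>transfer (kern N)\<bar> \<le> 3 * (4 * (?m powr (1 + \<alpha>) * Y)) * 6"
  proof (rule transfer_kern_le[where Q="slope_majorant1 N"])
    fix z j
    let ?t = "4 * tdist z"
    define D where "D = (LINT x|torus. (norm (increment z x))\<^sup>2)"
    have D0: "D \<ge> 0" by (simp add: D_def)
    have t: "0 \<le> ?t" using tdist_nonneg[of z] by simp
    have sq: "(y\<^sup>2) powr (r / 2) = y powr r" if "y \<ge> 0" for y r :: real
    proof -
      have "y\<^sup>2 = y powr 2" using that by simp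
      then show ?thesis by (simp add: powr_powr)
    qed
    (* interpolation between the two bounds for the energy of the increment *)
    have "D = D powr ((1 - \<alpha>) / 2) * D powr ((1 + \<alpha>) / 2)"
      using D0 by (simp add: powr_add[symmetric] add_divide_distrib[symmetric])
    also have "\<dots> \<le> ((?t * ?g)\<^sup>2) powr ((1 - \<alpha>) / 2) * (?m\<^sup>2) powr ((1 + \<alpha>) / 2)"
      using D0 alpha increment_energy_le_gradient[of z] increment_energy_le[of z]
      by (intro mult_mono powr_mono2) (auto simp: D_def)
    also have "\<dots> = (?t * ?g) powr (1 - \<alpha>) * ?m powr (1 + \<alpha>)"
      using t g m by (simp only: sq mult_nonneg_nonneg)
    finally have D: "D \<le> (?t * ?g) powr (1 - \<alpha>) * ?m powr (1 + \<alpha>)" .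
    have "\<bar>LINT x|torus. increment z x $ j * (norm (increment z x))\<^sup>2\<bar> \<le> f * ?t powr \<alpha> * D"
      unfolding D_def by (rule cubic_increment_le)
    also have "\<dots> \<le> f * ?t powr \<alpha> * ((?t * ?g) powr (1 - \<alpha>) * ?m powr (1 + \<alpha>))"
      using f_nonneg by (intro mult_left_mono D) auto
    also have "\<dots> = (?t powr \<alpha> * ?t powr (1 - \<alpha>)) * (f * ?g powr (1 - \<alpha>)) * ?m powr (1 + \<alpha>)"
      using t g by (simp only: powr_mult mult_ac)
    also have "?t powr \<alpha> * ?t powr (1 - \<alpha>) = ?t" using t by (simp add: powr_add[symmetric])
    also have "?t * (f * ?g powr (1 - \<alpha>)) * ?m powr (1 + \<alpha>) \<le> ?t * Y * ?m powr (1 + \<alpha>)"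
      unfolding Y_def using f_nonneg g t by (intro mult_right_mono mult_left_mono young_split) auto
    also have "\<dots> = 4 * (?m powr (1 + \<alpha>) * Y) * tdist z" by (simp only: mult_ac)
    finally have "\<bar>partial j (kern N) z\<bar> * \<bar>LINT x|torus. increment z x $ j * (norm (increment z x))\<^sup>2\<bar>
      \<le> \<bar>partial j (kern N) z\<bar> * (4 * (?m powr (1 + \<alpha>) * Y) * tdist z)" by (intro mult_left_mono) auto
    also have "\<dots> = 4 * (?m powr (1 + \<alpha>) * Y) * (\<bar>partial j (kern N) z\<bar> * tdist z)" by (simp only: mult_ac)
    also have "\<dots> \<le> 4 * (?m powr (1 + \<alpha>) * Y) * slope_majorant1 N j z" using Y by (intro mult_left_mono partial_kern_tdist) auto
    finally show "\<bar>partial j (kern N) z\<bar> * \<bar>LINT x|torus. increment z x $ j * (norm (increment z x))\<^sup>2\<bar>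
      \<le> 4 * (?m powr (1 + \<alpha>) * Y) * slope_majorant1 N j z" .
  qed (use Y trigpoly_slope_majorant1 int_slope_majorant1 in auto)
  then show ?thesis by (simp add: Y_def)
qed

end

section \<open>A smooth step function\<close>

text \<open>With \<open>y = 1 / (x (1 - x))\<close>, functions of the form \<open>P(x) y\<^sup>m exp (- y)\<close> are closed
  under differentiation and flat at both end points, where \<open>y\<close> tends to infinity.\<close>

definition bump :: "nat \<Rightarrow> real poly \<Rightarrow> real \<Rightarrow> real"
  where "bump m P x = (if 0 < x \<and> x < 1 then poly P x * (1 / (x * (1 - x))) ^ m * exp (- (1 / (x * (1 - x)))) else 0)"

lemma power_exp_le:
  fixes y :: real assumes "y \<ge> 0"
  shows "y ^ k * exp (- y) \<le> real k ^ k"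
proof (cases "k = 0")
  case True
  then show ?thesis using assms by simp
next
  case False
  have "y / real k \<le> exp (y / real k)" using exp_ge_add_one_self[of "y / real k"] by linarith
  then have "(y / real k) ^ k \<le> exp (y / real k) ^ k" using assms by (intro power_mono) auto
  also have "\<dots> = exp y" using False by (simp add: exp_of_nat_mult[symmetric])
  finally have "y ^ k \<le> real k ^ k * exp y" using False by (simp add: power_divide field_simps)
  then have "y ^ k * exp (- y) \<le> real k ^ k * exp y * exp (- y)" by (intro mult_right_mono) auto
  then show ?thesis by (simp add: exp_minus field_simps)
qed

text \<open>The exponential absorbs \<open>m + 2\<close> powers of \<open>y\<close>, so that a factor
  \<open>(x (1 - x))\<^sup>2\<close> remains.\<close>

lemma bump_flat: "\<exists>K. \<forall>x. \<bar>bump m P x\<bar> \<le> K * (min \<bar>x\<bar> \<bar>1 - x\<bar>)\<^sup>2"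
proof -
  have "compact (poly P ` {0..1})" by (intro compact_continuous_image continuous_intros) auto
  then have "bounded (poly P ` {0..1})" by (rule compact_imp_bounded)
  then obtain B where B: "\<forall>x\<in>{0..1}. \<bar>poly P x\<bar> \<le> B" by (auto simp: bounded_iff)
  have B0: "B \<ge> 0" using B by (metis abs_ge_zero atLeastAtMost_iff order_trans zero_le_one order_refl)
  define K where "K = B * real (m + 2) ^ (m + 2)"
  have K0: "K \<ge> 0" using B0 by (simp add: K_def)
  have "\<bar>bump m P x\<bar> \<le> K * (min \<bar>x\<bar> \<bar>1 - x\<bar>)\<^sup>2" for x
  proof (cases "0 < x \<and> x < 1")
    case True
    define q where "q = x * (1 - x)"
    have q: "q > 0" using True by (simp add: q_def)
    have qm: "q \<le> min \<bar>x\<bar> \<bar>1 - x\<bar>"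
    proof -
      have "x * (1 - x) \<le> x * 1" "x * (1 - x) \<le> 1 * (1 - x)" using True by (intro mult_left_mono mult_right_mono; simp)+
      then show ?thesis using True by (simp add: q_def)
    qed
    have "\<bar>bump m P x\<bar> = \<bar>poly P x\<bar> * ((1 / q) ^ m * exp (- (1 / q)))"
      using True q by (simp add: bump_def q_def[symmetric] abs_mult)
    also have "(1 / q) ^ m * exp (- (1 / q)) = q\<^sup>2 * ((1 / q) ^ (m + 2) * exp (- (1 / q)))"
      using q by (simp add: power_add power2_eq_square field_simps)
    also have "\<bar>poly P x\<bar> * (q\<^sup>2 * ((1 / q) ^ (m + 2) * exp (- (1 / q)))) \<le> B * (q\<^sup>2 * real (m + 2) ^ (m + 2))"
      using B B0 q True by (intro mult_mono power_exp_le mult_left_mono mult_nonneg_nonneg) auto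
    also have "\<dots> = K * q\<^sup>2" by (simp add: K_def)
    also have "\<dots> \<le> K * (min \<bar>x\<bar> \<bar>1 - x\<bar>)\<^sup>2" using q qm K0 by (intro mult_left_mono power_mono) auto
    finally show ?thesis .
  next
    case False
    then have "bump m P x = 0" unfolding bump_def by (simp only: if_False)
    then show ?thesis using K0 by simp
  qed
  then show ?thesis by blast
qed

lemma DERIV_zero_quadratic:
  fixes F :: "real \<Rightarrow> real"
  assumes "\<And>y. \<bar>F y\<bar> \<le> K * \<bar>y - x\<bar>\<^sup>2"
  shows "(F has_real_derivative 0) (at x)"
proof -
  have F0: "F x = 0" using assms[of x] by simp
  have "((\<lambda>y. (F y - F x) / (y - x)) \<longlongrightarrow> 0) (at x)"
  proof (rule Lim_null_comparison)
    show "\<forall>\<^sub>F y in at x. norm ((F y - F x) / (y - x)) \<le> K * \<bar>y - x\<bar>"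
    proof (rule eventually_at_topological[THEN iffD2], intro exI[of _ UNIV] conjI ballI impI)
      fix y assume "y \<noteq> x"
      then show "norm ((F y - F x) / (y - x)) \<le> K * \<bar>y - x\<bar>"
        using assms[of y] F0 by (simp add: divide_simps power2_eq_square mult.assoc)
    qed auto
    have "((\<lambda>y. K * \<bar>y - x\<bar>) \<longlongrightarrow> K * \<bar>x - x\<bar>) (at x)" by (intro tendsto_intros)
    then show "((\<lambda>y. K * \<bar>y - x\<bar>) \<longlongrightarrow> 0) (at x)" by simp
  qed
  then show ?thesis by (simp add: has_field_derivative_iff)
qed

lemma bump_DERIV:
  "(bump m P has_real_derivative
     bump (m + 2) (pderiv P * [:0, 1, -1:]\<^sup>2 - [:1, -2:] * P * (smult (real m) [:0, 1, -1:] - 1)) x) (at x)"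
proof -
  let ?R = "pderiv P * [:0, 1, -1:]\<^sup>2 - [:1, -2:] * P * (smult (real m) [:0, 1, -1:] - 1)"
  consider "0 < x \<and> x < 1" | "x < 0 \<or> 1 < x" | "x = 0 \<or> x = 1" by linarith
  then show ?thesis
  proof cases
    case 1
    define q where "q = x * (1 - x)"
    have q: "q > 0" using 1 by (simp add: q_def)
    have dq: "((\<lambda>x. x * (1 - x)) has_real_derivative (1 - 2 * x)) (at x)"
      by (auto intro!: derivative_eq_intros)
    have dy: "((\<lambda>x. 1 / (x * (1 - x))) has_real_derivative - (1 - 2 * x) / q\<^sup>2) (at x)"
      by (rule derivative_eq_intros dq refl)+ (use q in \<open>auto simp: q_def power2_eq_square\<close>)
    have dm: "((\<lambda>x. (1 / (x * (1 - x))) ^ m) has_real_derivative real m * (1 / q) ^ (m - 1) * (- (1 - 2 * x) / q\<^sup>2)) (at x)"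
      using DERIV_power[OF dy, of m] by (simp add: q_def mult_ac)
    have de: "((\<lambda>x. exp (- (1 / (x * (1 - x))))) has_real_derivative exp (- (1 / q)) * ((1 - 2 * x) / q\<^sup>2)) (at x)"
      by (rule DERIV_cong[OF DERIV_fun_exp[OF DERIV_minus[OF dy]]]) (simp only: q_def minus_divide_left minus_minus)
    have mm: "real m * (1 / q) ^ (m - 1) = real m * (1 / q) ^ m * q" using q by (cases m) auto
    have "((\<lambda>x. poly P x * (1 / (x * (1 - x))) ^ m * exp (- (1 / (x * (1 - x))))) has_real_derivative
      (poly (pderiv P) x * (1 / q) ^ m + real m * (1 / q) ^ (m - 1) * (- (1 - 2 * x) / q\<^sup>2) * poly P x) * exp (- (1 / q))
        + exp (- (1 / q)) * ((1 - 2 * x) / q\<^sup>2) * (poly P x * (1 / q) ^ m)) (at x)"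
      using DERIV_mult[OF DERIV_mult[OF poly_DERIV[of P x] dm] de] by (simp add: q_def)
    also have "(poly (pderiv P) x * (1 / q) ^ m + real m * (1 / q) ^ (m - 1) * (- (1 - 2 * x) / q\<^sup>2) * poly P x) * exp (- (1 / q))
        + exp (- (1 / q)) * ((1 - 2 * x) / q\<^sup>2) * (poly P x * (1 / q) ^ m)
      = (poly (pderiv P) x * q\<^sup>2 - (1 - 2 * x) * poly P x * (real m * q - 1)) * (1 / q) ^ (m + 2) * exp (- (1 / q))"
      unfolding mm using q by (simp add: power_add field_simps power2_eq_square)
    also have "\<dots> = bump (m + 2) ?R x"
    proof -
      have X: "poly [:0, 1, -1:] x = q" by (simp add: q_def algebra_simps)
      have L: "poly [:1, -2:] x = 1 - 2 * x" by simp
      have "poly ?R x = poly (pderiv P) x * q\<^sup>2 - (1 - 2 * x) * poly P x * (real m * q - 1)"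
        by (simp only: poly_diff poly_mult poly_power poly_smult poly_1 X L)
      then show ?thesis using 1 by (simp add: bump_def q_def)
    qed
    finally show ?thesis
      by (rule has_field_derivative_transform_within_open[where S="{0<..<1}"]) (use 1 in \<open>auto simp: bump_def\<close>)
  next
    case 2
    have "((\<lambda>_. 0) has_real_derivative bump (m + 2) ?R x) (at x)" using 2 by (auto simp: bump_def)
    then show ?thesis
      by (rule has_field_derivative_transform_within_open[where S="{..<0} \<union> {1<..}"]) (use 2 in \<open>auto simp: bump_def\<close>)
  next
    case 3
    obtain K where K: "\<And>y. \<bar>bump m P y\<bar> \<le> K * (min \<bar>y\<bar> \<bar>1 - y\<bar>)\<^sup>2" using bump_flat[of m P] by blast
    have "\<bar>bump m P y\<bar> \<le> \<bar>K\<bar> * \<bar>y - x\<bar>\<^sup>2" for y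
    proof -
      have "K * (min \<bar>y\<bar> \<bar>1 - y\<bar>)\<^sup>2 \<le> \<bar>K\<bar> * \<bar>y - x\<bar>\<^sup>2"
        using 3 by (intro mult_mono power_mono) auto
      with K[of y] show ?thesis by linarith
    qed
    then have "(bump m P has_real_derivative 0) (at x)" by (rule DERIV_zero_quadratic)
    moreover have "bump (m + 2) ?R x = 0" using 3 by (auto simp: bump_def)
    ultimately show ?thesis by simp
  qed
qed

text \<open>The normalised primitive of a bump, subtracted from one. The iterated derivatives are listed explicitly.\<close>

lemma smooth_step_exists:
  obtains D :: "nat \<Rightarrow> real \<Rightarrow> real"
  where "\<And>i t. (D i has_real_derivative D (Suc i) t) (at t)"
    "\<And>t. t \<le> 0 \<Longrightarrow> D 0 t = 1" "\<And>t. t \<ge> 1 \<Longrightarrow> D 0 t = 0" "\<And>t. t \<le> 0 \<or> t \<ge> 1 \<Longrightarrow> D 1 t = 0"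
proof -
  (* the pair (m, P) after one differentiation *)
  define R where "R = (\<lambda>(m, P). (m + 2, pderiv P * [:0, 1, -1:]\<^sup>2 - [:1, -2:] * P * (smult (real m) [:0, 1, -1:] - 1)))"
  define B where "B i = (\<lambda>(m, P). bump m P) ((R ^^ i) (0, 1))" for i
  have B: "(B i has_real_derivative B (Suc i) t) (at t)" for i t
    using bump_DERIV by (simp add: B_def R_def split_def)
  have B0: "B 0 = bump 0 1" by (simp add: B_def)
  have cB: "continuous_on S (B 0)" for S
    using B by (meson DERIV_isCont continuous_at_imp_continuous_on)
  (* An oriented integral is differentiable on the whole line. *)
  define F where "F u = (LBINT y=ereal 0..ereal u. B 0 y)" for u
  have F: "(F has_real_derivative B 0 t) (at t)" for t
  proof -
    define a b where "a = min t 0 - 1" and "b = max t 0 + 1"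
    have ab: "a < t" "t < b" "a \<le> 0" "0 \<le> b" by (auto simp: a_def b_def)
    have "((\<lambda>u. LBINT y=ereal 0..ereal u. B 0 y) has_vector_derivative B 0 t) (at t within {a..b})"
      by (rule interval_integral_FTC2) (use ab cB in auto)
    then have "(F has_real_derivative B 0 t) (at t within {a..b})"
      by (simp add: has_real_derivative_iff_has_vector_derivative F_def[abs_def])
    moreover have "at t within {a..b} = at t" using ab by (intro at_within_interior) auto
    ultimately show ?thesis by simp
  qed
  have F0: "F 0 = 0" by (simp add: F_def)
  have Fneg: "F t = 0" if "t \<le> 0" for t
  proof (cases "t = 0")
    case False
    then have "t < 0" using that by simp
    then obtain z where "t < z" "z < 0" "F 0 - F t = (0 - t) * B 0 z" using MVT2[of t 0 F "B 0"] F by blast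
    then show ?thesis using F0 by (simp add: B0 bump_def)
  qed (simp add: F0)
  have Fpos: "F t = F 1" if "t \<ge> 1" for t
  proof (cases "t = 1")
    case False
    then have "t > 1" using that by simp
    then obtain z where "1 < z" "z < t" "F t - F 1 = (t - 1) * B 0 z" using MVT2[of 1 t F "B 0"] F by blast
    then show ?thesis by (simp add: B0 bump_def)
  qed simp
  obtain z where "0 < z" "z < 1" "F 1 - F 0 = (1 - 0) * B 0 z" using MVT2[of 0 1 F "B 0"] F by force
  then have Z: "F 1 > 0" using F0 by (simp add: B0 bump_def)
  define D where "D i = (case i of 0 \<Rightarrow> (\<lambda>t. 1 - F t / F 1) | Suc j \<Rightarrow> (\<lambda>t. - (B j t / F 1)))" for i
  show ?thesis
  proof (rule that[of D])
    show "(D i has_real_derivative D (Suc i) t) (at t)" for i t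
      using Z by (cases i) (auto simp: D_def intro!: derivative_eq_intros F B)
    show "D 0 t = 1" if "t \<le> 0" for t using Fneg[OF that] by (simp add: D_def)
    show "D 0 t = 0" if "t \<ge> 1" for t using Fpos[OF that] Z by (simp add: D_def)
    show "D 1 t = 0" if "t \<le> 0 \<or> t \<ge> 1" for t using that by (auto simp: D_def B0 bump_def)
  qed
qed

section \<open>Test functions with a single spatial frequency\<close>

definition deriv_chain :: "(nat \<Rightarrow> real \<Rightarrow> real) \<Rightarrow> bool"
  where "deriv_chain E \<longleftrightarrow> (\<forall>i t. (E i has_real_derivative E (Suc i) t) (at t))"

text \<open>The products of a time profile and a plane wave, with all their derivatives: \<open>E i\<close> is the
  \<open>i\<close>-th derivative of the profile \<open>E 0\<close>, and a spatial derivative shifts the phase by a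
  quarter of a period.\<close>

inductive testspan :: "(nat \<Rightarrow> real \<Rightarrow> real) \<Rightarrow> (real \<times> (real^3) \<Rightarrow> real^3) \<Rightarrow> bool" for E where
  wave: "testspan E (\<lambda>(t, x). (E i t * cos (k \<bullet> x + c)) *\<^sub>R a)"
| add: "testspan E p \<Longrightarrow> testspan E q \<Longrightarrow> testspan E (\<lambda>z. p z + q z)"
| scale: "testspan E p \<Longrightarrow> testspan E (\<lambda>z. r *\<^sub>R p z)"

lemma testspan_deriv:
  assumes E: "deriv_chain E"
  shows "testspan E p \<Longrightarrow> \<exists>D. (\<forall>z. (p has_derivative D z) (at z)) \<and> (\<forall>h. testspan E (\<lambda>z. D z h))"
proof (induction rule: testspan.induct)
  case (wave i k c a)
  define D where "D = (\<lambda>(z :: real \<times> (real^3)) (h :: real \<times> (real^3)).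
    fst h *\<^sub>R ((E (Suc i) (fst z) * cos (k \<bullet> snd z + c)) *\<^sub>R a) + (k \<bullet> snd h) *\<^sub>R ((E i (fst z) * cos (k \<bullet> snd z + (c + pi / 2))) *\<^sub>R a))"
  have "((\<lambda>(t, x). (E i t * cos (k \<bullet> x + c)) *\<^sub>R a) has_derivative D z) (at z)" for z
  proof -
    have Ei: "(E i has_derivative (*) (E (Suc i) (fst z))) (at (fst z))"
      using E by (simp add: deriv_chain_def has_field_derivative_def)
    have 1: "((\<lambda>z. E i (fst z)) has_derivative (\<lambda>h. E (Suc i) (fst z) * fst h)) (at z)"
      by (rule has_derivative_compose[where f=fst and g="E i", OF _ Ei]) (rule has_derivative_fst[OF has_derivative_ident])
    have 2: "((\<lambda>z. cos (k \<bullet> snd z + c)) has_derivative (\<lambda>h. - (k \<bullet> snd h) * sin (k \<bullet> snd z + c))) (at z)"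
      by (auto intro!: derivative_eq_intros)
    have "((\<lambda>z. (E i (fst z) * cos (k \<bullet> snd z + c)) *\<^sub>R a) has_derivative
       (\<lambda>h. (E i (fst z) * (- (k \<bullet> snd h) * sin (k \<bullet> snd z + c)) + (E (Suc i) (fst z) * fst h) * cos (k \<bullet> snd z + c)) *\<^sub>R a)) (at z)"
      by (intro has_derivative_scaleR_left has_derivative_mult 1 2)
    moreover have "(\<lambda>h. (E i (fst z) * (- (k \<bullet> snd h) * sin (k \<bullet> snd z + c)) + (E (Suc i) (fst z) * fst h) * cos (k \<bullet> snd z + c)) *\<^sub>R a) = D z"
    proof
      fix h
      have "cos (k \<bullet> snd z + (c + pi / 2)) = - sin (k \<bullet> snd z + c)"
        by (simp only: add.assoc[symmetric] cos_add[of "k \<bullet> snd z + c" "pi / 2"]) simp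
      then have "D z h = (fst h * (E (Suc i) (fst z) * cos (k \<bullet> snd z + c))) *\<^sub>R a + ((k \<bullet> snd h) * (E i (fst z) * - sin (k \<bullet> snd z + c))) *\<^sub>R a"
        by (simp only: D_def scaleR_scaleR)
      also have "\<dots> = (fst h * (E (Suc i) (fst z) * cos (k \<bullet> snd z + c)) + (k \<bullet> snd h) * (E i (fst z) * - sin (k \<bullet> snd z + c))) *\<^sub>R a"
        by (rule scaleR_add_left[symmetric])
      also have "fst h * (E (Suc i) (fst z) * cos (k \<bullet> snd z + c)) + (k \<bullet> snd h) * (E i (fst z) * - sin (k \<bullet> snd z + c))
        = E i (fst z) * (- (k \<bullet> snd h) * sin (k \<bullet> snd z + c)) + (E (Suc i) (fst z) * fst h) * cos (k \<bullet> snd z + c)" by simp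
      finally show "(E i (fst z) * (- (k \<bullet> snd h) * sin (k \<bullet> snd z + c)) + (E (Suc i) (fst z) * fst h) * cos (k \<bullet> snd z + c)) *\<^sub>R a = D z h" ..
    qed
    ultimately show ?thesis by (simp add: split_def)
  qed
  moreover have "testspan E (\<lambda>z. D z h)" for h
    using testspan.add[OF testspan.scale[OF testspan.wave[of E "Suc i" k c a], of "fst h"] testspan.scale[OF testspan.wave[of E i k "c + pi/2" a], of "k \<bullet> snd h"]]
    by (simp add: D_def split_def)
  ultimately show ?case by blast
next
  case (add p q)
  then obtain D D' where "\<And>z. (p has_derivative D z) (at z)" "\<And>h. testspan E (\<lambda>z. D z h)"
    "\<And>z. (q has_derivative D' z) (at z)" "\<And>h. testspan E (\<lambda>z. D' z h)" by blast
  then show ?case by (intro exI[where x="\<lambda>z h. D z h + D' z h"]) (auto intro!: has_derivative_add testspan.add)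
next
  case (scale p r)
  then obtain D where "\<And>z. (p has_derivative D z) (at z)" "\<And>h. testspan E (\<lambda>z. D z h)" by blast
  then show ?case by (intro exI[where x="\<lambda>z h. r *\<^sub>R D z h"]) (auto intro!: has_derivative_scaleR_right testspan.scale)
qed

lemma testspan_smooth:
  assumes E: "deriv_chain E" and p: "testspan E p" and T: "T > 0"
  shows "smooth_on ({0..<T} \<times> UNIV) p"
proof (rule smooth_on_closed_family[of "testspan E", OF p])
  show "\<exists>D. (\<forall>z\<in>{0..<T} \<times> UNIV. (g has_derivative D z) (at z within {0..<T} \<times> UNIV)) \<and> (\<forall>h. testspan E (\<lambda>z. D z h))"
    if "testspan E g" for g
    using testspan_deriv[OF E that] has_derivative_at_withinI by blast
next
  fix g :: "real \<times> (real^3) \<Rightarrow> real^3" and z A B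
  assume z: "z \<in> {0..<T} \<times> UNIV" and A: "(g has_derivative A) (at z within {0..<T} \<times> UNIV)"
    and B: "(g has_derivative B) (at z within {0..<T} \<times> UNIV)"
  show "A = B"
  proof (rule frechet_derivative_unique_within[OF A B])
    fix i :: "real \<times> (real^3)" and e :: real assume i: "i \<in> Basis" and e: "e > 0"
    (* a step forward in time stays below T and is available at time zero as well *)
    define d where "d = min (e / 2) ((T - fst z) / 2)"
    have fz: "0 \<le> fst z" "fst z < T" using z by auto
    have d: "d > 0" "d < e" "d < T - fst z" using e fz by (auto simp: d_def min_def)
    have "fst i = 0 \<or> fst i = 1" using i by (auto simp: Basis_prod_def)
    then have "z + d *\<^sub>R i \<in> {0..<T} \<times> UNIV" using fz d by (cases z; cases i) auto
    with d show "\<exists>d. 0 < \<bar>d\<bar> \<and> \<bar>d\<bar> < e \<and> z + d *\<^sub>R i \<in> {0..<T} \<times> UNIV" by (intro exI[of _ d]) auto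
  qed
qed

section \<open>Weak derivatives in time and primitives\<close>

abbreviation itv :: "real \<Rightarrow> real measure" where "itv T \<equiv> lebesgue_on {0<..<T}"

lemma finite_measure_itv: "finite_measure (itv T)"
proof -
  have "{0<..<T} \<in> lmeasurable" using lmeasurable_box[of 0 T] by simp
  then show ?thesis by (rule finite_measure_lebesgue_on)
qed

lemma continuous_integrable_itv:
  fixes q :: "real \<Rightarrow> real"
  assumes "continuous_on {0..T} q"
  shows "integrable (itv T) q" "(LINT t|itv T. q t) = integral {0..T} q"
proof -
  have "q absolutely_integrable_on {0..T}" using absolutely_integrable_continuous[of 0 T q] assms by simp
  then have "q absolutely_integrable_on {0<..<T}" by (simp add: absolutely_integrable_on_Icc_iff_Ioo)
  then show *: "integrable (itv T) q"
    by (simp add: set_integrable_def integrable_restrict_space)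
  have "(LINT t|itv T. q t) = integral {0<..<T} q" by (rule lebesgue_integral_eq_integral[OF *]) simp
  then show "(LINT t|itv T. q t) = integral {0..T} q" using integral_open_interval_real[of 0 T q] by simp
qed

lemma indicator_measurable_itv: "A \<in> sets borel \<Longrightarrow> (indicator A :: real \<Rightarrow> real) \<in> borel_measurable (itv T)"
  by (intro borel_measurable_torus[THEN measurable_restrict_space1] measurable_restrict_space1 borel_measurable_indicator) (auto dest: sets_completionI_sets)

lemma integrable_indicator_itv:
  assumes "A \<in> sets borel" shows "integrable (itv T) (indicator A :: real \<Rightarrow> real)"
  by (rule finite_measure.integrable_const_bound[OF finite_measure_itv, of _ 1])
    (rule AE_I2, simp add: indicator_def, rule indicator_measurable_itv[OF assms])

lemma integrable_cut:
  fixes h :: "real \<Rightarrow> real"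
  assumes "integrable (itv T) h" shows "integrable (itv T) (\<lambda>t. indicator {..s} t * h t)"
proof (rule Bochner_Integration.integrable_bound[OF assms])
  show "(\<lambda>t. indicator {..s} t * h t) \<in> borel_measurable (itv T)"
    using assms by (intro borel_measurable_times indicator_measurable_itv) auto
qed (auto simp: indicator_def)

lemma primitive_limit:
  fixes h :: "real \<Rightarrow> real" and s :: "nat \<Rightarrow> real"
  assumes h: "integrable (itv T) h" and s: "\<And>t. (\<lambda>n. indicator {..s n} t :: real) \<longlonglongrightarrow> indicator {..t0} t \<or> t \<ge> t0 \<and> t0 \<ge> T"
  shows "(\<lambda>n. LINT t|itv T. indicator {..s n} t * h t) \<longlonglongrightarrow> (LINT t|itv T. indicator {..t0} t * h t)"
proof (rule integral_dominated_convergence)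
  show "integrable (itv T) (\<lambda>t. \<bar>h t\<bar>)" using h by simp
  show "AE t in itv T. (\<lambda>n. indicator {..s n} t * h t) \<longlonglongrightarrow> indicator {..t0} t * h t"
  proof (rule AE_I2)
    fix t assume "t \<in> space (itv T)"
    then have "(\<lambda>n. indicator {..s n} t :: real) \<longlonglongrightarrow> indicator {..t0} t" using s[of t] by auto
    then show "(\<lambda>n. indicator {..s n} t * h t) \<longlonglongrightarrow> indicator {..t0} t * h t" by (intro tendsto_intros)
  qed
  show "AE t in itv T. norm (indicator {..s n} t * h t) \<le> \<bar>h t\<bar>" for n
    by (rule AE_I2) (simp add: indicator_def)
qed (use integrable_cut[OF h] in auto)

text \<open>The profiles fall from one to zero on \<open>[t\<^sub>0, t\<^sub>0 + 1/n]\<close>. Their derivatives are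
  concentrated there with total mass \<open>-1\<close> and tend to minus the evaluation of the continuous function
  \<open>g\<close> at \<open>t\<^sub>0\<close>.\<close>

lemma weak_to_primitive_interior:
  fixes g h :: "real \<Rightarrow> real"
  assumes g: "continuous_on {0..T} g" and h: "integrable (itv T) h"
    and weak: "\<And>E. deriv_chain E \<Longrightarrow> (\<exists>T'\<in>{0..<T}. \<forall>t\<ge>T'. E 0 t = 0) \<Longrightarrow>
      (LINT t|itv T. E 1 t * g t + E 0 t * h t) = - (E 0 0 * g0)"
    and t0: "0 \<le> t0" "t0 < T"
  shows "g t0 = g0 + (LINT t|itv T. indicator {..t0} t * h t)"
proof -
  obtain D :: "nat \<Rightarrow> real \<Rightarrow> real"
    where D: "\<And>i t. (D i has_real_derivative D (Suc i) t) (at t)"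
    and D1: "\<And>t. t \<le> 0 \<Longrightarrow> D 0 t = 1" and D0: "\<And>t. t \<ge> 1 \<Longrightarrow> D 0 t = 0" and D': "\<And>t. t \<le> 0 \<or> t \<ge> 1 \<Longrightarrow> D 1 t = 0"
    by (rule smooth_step_exists) (rule that)
  have bounded: "\<exists>K\<ge>0. \<forall>t. \<bar>D i t\<bar> \<le> K" if i: "i = 0 \<or> i = 1" for i
  proof -
    have "continuous_on {0..1} (D i)" using D by (meson DERIV_isCont continuous_at_imp_continuous_on)
    then have "bounded (D i ` {0..1})" by (intro compact_imp_bounded compact_continuous_image) auto
    then obtain K where K: "\<forall>t\<in>{0..1}. \<bar>D i t\<bar> \<le> K" by (auto simp: bounded_iff)
    have "\<bar>D i t\<bar> \<le> max K 1" for t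
    proof (cases "t \<in> {0..1}")
      case True with K show ?thesis by (auto simp: le_max_iff_disj)
    next
      case False
      then show ?thesis using i D1[of t] D0[of t] D'[of t] by auto
    qed
    then show ?thesis by (intro exI[of _ "max K 1"]) auto
  qed
  obtain K where K: "K \<ge> 0" "\<And>t. \<bar>D 0 t\<bar> \<le> K" using bounded[of 0] by blast
  obtain L where L: "L \<ge> 0" "\<And>t. \<bar>D 1 t\<bar> \<le> L" using bounded[of 1] by blast
  define c where "c n = real (Suc n)" for n
  have c: "c n > 0" for n by (simp add: c_def)
  have clim: "(\<lambda>n. 1 / c n) \<longlonglongrightarrow> 0" using LIMSEQ_inverse_real_of_nat by (simp add: c_def inverse_eq_divide)
  have ev: "\<forall>\<^sub>F n in sequentially. 1 / c n < d" if "d > 0" for d using order_tendstoD(2)[OF clim that] .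
  define E where "E n i t = c n ^ i * D i (c n * (t - t0))" for n i t
  have E: "(E n i has_real_derivative E n (Suc i) t) (at t)" for n i t
  proof -
    have "((\<lambda>t. D i (c n * (t - t0))) has_real_derivative D (Suc i) (c n * (t - t0)) * c n) (at t)"
      by (rule DERIV_chain2[OF D]) (auto intro!: derivative_eq_intros)
    from DERIV_cmult[OF this, of "c n ^ i"] show ?thesis by (simp add: E_def[abs_def] mult_ac)
  qed
  have chain: "deriv_chain (E n)" for n using E by (simp add: deriv_chain_def)
  have contE: "continuous_on S (E n i)" for n i S using E by (meson DERIV_isCont continuous_at_imp_continuous_on)
  have E0_late: "E n 0 t = 0" if "t \<ge> t0 + 1 / c n" for n t
  proof -
    have "c n * (t - t0) \<ge> c n * (1 / c n)" using that c[of n] by (intro mult_left_mono) auto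
    then show ?thesis using c[of n] D0 by (simp add: E_def)
  qed
  have E0_early: "E n 0 t = 1" if "t \<le> t0" for n t
    using that c[of n] D1[of "c n * (t - t0)"] by (simp add: E_def mult_nonneg_nonpos)
  have E1_bound: "\<bar>E n 1 t\<bar> \<le> c n * L * indicator {t0..t0 + 1 / c n} t" for n t
  proof (cases "t \<in> {t0..t0 + 1 / c n}")
    case True
    then show ?thesis using c[of n] L by (simp add: E_def abs_mult mult_left_mono)
  next
    case False
    then have "c n * (t - t0) \<le> 0 \<or> c n * (t - t0) \<ge> 1"
    proof -
      have "t \<le> t0 \<or> t - t0 \<ge> 1 / c n" using False by auto
      then show ?thesis using c[of n] by (auto simp: mult_nonneg_nonpos field_simps)
    qed
    with D' show ?thesis using False by (simp add: E_def)
  qed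
  have w: "(LINT t|itv T. E n 1 t * g t) + (LINT t|itv T. E n 0 t * h t) = - g0" if n: "t0 + 1 / c n < T" for n
  proof -
    have "0 < 1 / c n" using c[of n] by simp
    then have "t0 + 1 / c n \<in> {0..<T}" using n t0 by auto
    then have "\<exists>T'\<in>{0..<T}. \<forall>t\<ge>T'. E n 0 t = 0" using E0_late by blast
    from weak[OF chain this] have "(LINT t|itv T. E n 1 t * g t + E n 0 t * h t) = - g0" using E0_early t0 by simp
    moreover have "integrable (itv T) (\<lambda>t. E n 1 t * g t)" by (intro continuous_integrable_itv continuous_intros contE g)
    moreover have "integrable (itv T) (\<lambda>t. E n 0 t * h t)"
    proof (rule Bochner_Integration.integrable_bound)
      show "integrable (itv T) (\<lambda>t. K * \<bar>h t\<bar>)" using h by simp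
      show "(\<lambda>t. E n 0 t * h t) \<in> borel_measurable (itv T)"
        using h continuous_integrable_itv(1)[OF contE] by simp
      show "AE t in itv T. norm (E n 0 t * h t) \<le> norm (K * \<bar>h t\<bar>)"
        using K by (intro AE_I2) (simp add: E_def abs_mult mult_right_mono)
    qed
    ultimately show ?thesis by simp
  qed
  have lim1: "(\<lambda>n. LINT t|itv T. E n 0 t * h t) \<longlonglongrightarrow> (LINT t|itv T. indicator {..t0} t * h t)"
  proof (rule integral_dominated_convergence)
    show "integrable (itv T) (\<lambda>t. K * \<bar>h t\<bar>)" using h by simp
    show "(\<lambda>t. E n 0 t * h t) \<in> borel_measurable (itv T)" for n
      using h continuous_integrable_itv(1)[OF contE] by simp
    show "AE t in itv T. norm (E n 0 t * h t) \<le> K * \<bar>h t\<bar>" for n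
      using K by (intro AE_I2) (simp add: E_def abs_mult mult_right_mono)
    show "AE t in itv T. (\<lambda>n. E n 0 t * h t) \<longlonglongrightarrow> indicator {..t0} t * h t"
    proof (rule AE_I2)
      fix t
      have "(\<lambda>n. E n 0 t) \<longlonglongrightarrow> indicator {..t0} t"
      proof (cases "t \<le> t0")
        case True then show ?thesis by (simp add: E0_early)
      next
        case False
        then have "\<forall>\<^sub>F n in sequentially. 1 / c n < t - t0" by (intro ev) simp
        then have "\<forall>\<^sub>F n in sequentially. E n 0 t = indicator {..t0} t"
          by eventually_elim (use False E0_late in \<open>auto simp: indicator_def\<close>)
        then show ?thesis by (rule tendsto_eventually)
      qed
      then show "(\<lambda>n. E n 0 t * h t) \<longlonglongrightarrow> indicator {..t0} t * h t" by (intro tendsto_intros)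
    qed
  qed (use integrable_cut[OF h] in auto)
  have lim2: "(\<lambda>n. LINT t|itv T. E n 1 t * g t) \<longlonglongrightarrow> - g t0"
  proof (rule tendstoI)
    fix e :: real assume e: "e > 0"
    define e' where "e' = e / (L + 1)"
    have e': "e' > 0" "L * e' < e" using e L(1) by (auto simp: e'_def field_simps)
    have "\<exists>d>0. \<forall>t\<in>{0..T}. dist t t0 < d \<longrightarrow> dist (g t) (g t0) < e'"
      using g e'(1) t0 unfolding continuous_on_iff by auto
    then obtain d where d: "d > 0" "\<And>t. t \<in> {0..T} \<Longrightarrow> dist t t0 < d \<Longrightarrow> dist (g t) (g t0) < e'" by blast
    have "\<forall>\<^sub>F n in sequentially. 1 / c n < d \<and> 1 / c n < T - t0" using ev[OF d(1)] ev[of "T - t0"] t0 by (intro eventually_conj) auto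
    then show "\<forall>\<^sub>F n in sequentially. dist (LINT t|itv T. E n 1 t * g t) (- g t0) < e"
    proof eventually_elim
      case (elim n)
      have i1: "integrable (itv T) (\<lambda>t. E n 1 t * g t)" "integrable (itv T) (\<lambda>t. E n 1 t)"
        by (intro continuous_integrable_itv continuous_intros contE g)+
      have "(E n 1 has_integral E n 0 T - E n 0 0) {0..T}"
        using E[of n 0] t0
        by (intro fundamental_theorem_of_calculus)
          (auto simp: has_real_derivative_iff_has_vector_derivative[symmetric] intro: has_field_derivative_at_within)
      moreover have "E n 0 T = 0" using elim by (intro E0_late) simp
      ultimately have "(LINT t|itv T. E n 1 t) = - 1"
        using continuous_integrable_itv(2)[OF contE, of T n 1] E0_early[of 0 n] t0 by (simp add: integral_unique)
      then have "(LINT t|itv T. E n 1 t * g t) - (- g t0) = (LINT t|itv T. E n 1 t * g t) - (LINT t|itv T. E n 1 t) * g t0" by simp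
      also have "\<dots> = (LINT t|itv T. E n 1 t * (g t - g t0))"
        using i1 by (simp add: right_diff_distrib)
      finally have "\<bar>(LINT t|itv T. E n 1 t * g t) - (- g t0)\<bar> \<le> (LINT t|itv T. \<bar>E n 1 t * (g t - g t0)\<bar>)"
        by (simp only: integral_abs_bound)
      also have "\<dots> \<le> (LINT t|itv T. c n * L * e' * indicator {t0..t0 + 1 / c n} t)"
      proof (rule integral_mono)
        show "integrable (itv T) (\<lambda>t. \<bar>E n 1 t * (g t - g t0)\<bar>)"
          using i1 by (simp add: right_diff_distrib)
        show "integrable (itv T) (\<lambda>t. c n * L * e' * indicator {t0..t0 + 1 / c n} t)"
          by (intro Bochner_Integration.integrable_mult_right integrable_indicator_itv) simp
        fix t assume "t \<in> space (itv T)"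
        then have t: "t \<in> {0..T}" by auto
        show "\<bar>E n 1 t * (g t - g t0)\<bar> \<le> c n * L * e' * indicator {t0..t0 + 1 / c n} t"
        proof (cases "t \<in> {t0..t0 + 1 / c n}")
          case True
          then have "dist t t0 < d" using elim by (auto simp: dist_real_def)
          from d(2)[OF t this] have "\<bar>g t - g t0\<bar> \<le> e'" by (simp add: dist_real_def)
          moreover have "\<bar>E n 1 t\<bar> \<le> c n * L" using E1_bound[of n t] True by simp
          ultimately have "\<bar>E n 1 t\<bar> * \<bar>g t - g t0\<bar> \<le> (c n * L) * e'" using c[of n] L(1) by (intro mult_mono) auto
          then show ?thesis using True by (simp add: abs_mult)
        next
          case False
          then have "E n 1 t = 0" using E1_bound[of n t] by simp
          then show ?thesis using False by simp
        qed
      qed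
      also have "\<dots> = c n * L * e' * measure (itv T) ({t0..t0 + 1 / c n} \<inter> space (itv T))"
        by simp
      also have "\<dots> \<le> c n * L * e' * (1 / c n)"
      proof (intro mult_left_mono)
        have "measure (itv T) ({t0..t0 + 1 / c n} \<inter> space (itv T)) = measure lebesgue ({t0..t0 + 1 / c n} \<inter> {0<..<T})"
          by (simp add: measure_restrict_space)
        also have "\<dots> \<le> measure lebesgue {t0..t0 + 1 / c n}"
          by (rule measure_mono_fmeasurable) (auto simp: lmeasurable_cbox[of t0 "t0 + 1 / c n", simplified])
        also have "\<dots> = 1 / c n" using c[of n] by simp
        finally show "measure (itv T) ({t0..t0 + 1 / c n} \<inter> space (itv T)) \<le> 1 / c n" .
      qed (use c[of n] L(1) e' in auto)
      also have "\<dots> = L * e'" using c[of n] by simp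
      finally show ?case using e'(2) by (simp add: dist_real_def)
    qed
  qed
  have "(\<lambda>n. (LINT t|itv T. E n 1 t * g t) + (LINT t|itv T. E n 0 t * h t)) \<longlonglongrightarrow> - g t0 + (LINT t|itv T. indicator {..t0} t * h t)"
    by (rule tendsto_add[OF lim2 lim1])
  moreover have "\<forall>\<^sub>F n in sequentially. (LINT t|itv T. E n 1 t * g t) + (LINT t|itv T. E n 0 t * h t) = - g0"
  proof -
    have "\<forall>\<^sub>F n in sequentially. 1 / c n < T - t0" using t0 by (intro ev) simp
    then show ?thesis by eventually_elim (rule w, simp)
  qed
  then have "(\<lambda>n. (LINT t|itv T. E n 1 t * g t) + (LINT t|itv T. E n 0 t * h t)) \<longlonglongrightarrow> - g0" by (rule tendsto_eventually)
  ultimately have "- g t0 + (LINT t|itv T. indicator {..t0} t * h t) = - g0" by (rule LIMSEQ_unique)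
  then show ?thesis by simp
qed

text \<open>Both sides are continuous in the time, so the end point \<open>T\<close> is reached as a limit.\<close>

lemma weak_to_primitive:
  fixes g h :: "real \<Rightarrow> real"
  assumes g: "continuous_on {0..T} g" and h: "integrable (itv T) h" and T: "T > 0"
    and weak: "\<And>E. deriv_chain E \<Longrightarrow> (\<exists>T'\<in>{0..<T}. \<forall>t\<ge>T'. E 0 t = 0) \<Longrightarrow>
      (LINT t|itv T. E 1 t * g t + E 0 t * h t) = - (E 0 0 * g0)"
    and t0: "t0 \<in> {0..T}"
  shows "g t0 = g0 + (LINT t|itv T. indicator {..t0} t * h t)"
proof (cases "t0 < T")
  case True
  then show ?thesis using weak_to_primitive_interior[OF g h weak] t0 by auto
next
  case False
  then have t0: "t0 = T" using t0 by simp
  define s where "s n = T - T / real (Suc n)" for n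
  have s: "0 \<le> s n" "s n < T" for n using T by (auto simp: s_def field_simps)
  have sT: "s \<longlonglongrightarrow> T"
  proof -
    have "(\<lambda>n. T - T * inverse (real (Suc n))) \<longlonglongrightarrow> T - T * 0"
      by (intro tendsto_intros LIMSEQ_inverse_real_of_nat)
    then show ?thesis by (simp add: s_def[abs_def] divide_inverse)
  qed
  have "(\<lambda>n. g (s n)) \<longlonglongrightarrow> g T"
    using continuous_on_tendsto_compose[OF g sT] s T by (auto simp: less_imp_le)
  moreover have "(\<lambda>n. LINT t|itv T. indicator {..s n} t * h t) \<longlonglongrightarrow> (LINT t|itv T. indicator {..T} t * h t)"
  proof (rule primitive_limit[OF h])
    fix t
    show "(\<lambda>n. indicator {..s n} t :: real) \<longlonglongrightarrow> indicator {..T} t \<or> T \<le> t \<and> T \<le> T"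
    proof (cases "t < T")
      case True
      from order_tendstoD(1)[OF sT True] have "\<forall>\<^sub>F n in sequentially. (indicator {..s n} t :: real) = indicator {..T} t"
        by eventually_elim (use True in \<open>auto simp: indicator_def\<close>)
      then show ?thesis by (intro disjI1 tendsto_eventually)
    qed auto
  qed
  ultimately have "(\<lambda>n. g0 + (LINT t|itv T. indicator {..s n} t * h t)) \<longlonglongrightarrow> g0 + (LINT t|itv T. indicator {..T} t * h t)"
    "(\<lambda>n. g0 + (LINT t|itv T. indicator {..s n} t * h t)) \<longlonglongrightarrow> g T"
    using weak_to_primitive_interior[OF g h weak s] by (auto intro!: tendsto_intros)
  then show ?thesis unfolding t0 using LIMSEQ_unique by blast
qed

section \<open>The square of a primitive\<close>

text \<open>The square \<open>(0, T)\<^sup>2\<close> consists of two triangles, which are exchanged by reflection in the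
  diagonal.\<close>

lemma square_integral_triangle:
  fixes k :: "real \<Rightarrow> real"
  assumes k: "integrable (itv T) k"
  shows "2 * (LINT a|itv T. k a * (LINT b|itv T. indicator {..a} b * k b)) = (LINT a|itv T. k a)\<^sup>2"
proof -
  interpret finite_measure "itv T" by (rule finite_measure_itv)
  interpret pair_sigma_finite "itv T" "itv T" ..
  have km[measurable]: "k \<in> borel_measurable (itv T)" using k by simp
  have idm[measurable]: "(\<lambda>x. x) \<in> borel_measurable (itv T)"
    using continuous_integrable_itv(1)[of T "\<lambda>x. x"] by (auto intro: continuous_intros)
  have cut2: "integrable (itv T) (\<lambda>b. indicator {a..} b * k b)" for a
  proof (rule Bochner_Integration.integrable_bound[OF k])
    show "(\<lambda>b. indicator {a..} b * k b) \<in> borel_measurable (itv T)"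
      using k by (intro borel_measurable_times indicator_measurable_itv) auto
  qed (auto simp: indicator_def)
  note cut1 = integrable_cut[OF k]
  have ind: "(\<lambda>p. indicator {..fst p} (snd p) :: real) \<in> borel_measurable (itv T \<Otimes>\<^sub>M itv T)"
  proof -
    have eq: "(\<lambda>p :: real \<times> real. indicator {..fst p} (snd p)) = (\<lambda>p. if snd p \<le> fst p then 1 else (0::real))" by (auto simp: indicator_def)
    have "(\<lambda>p :: real \<times> real. if snd p \<le> fst p then 1 else (0::real)) \<in> borel_measurable (itv T \<Otimes>\<^sub>M itv T)" by measurable
    then show ?thesis unfolding eq .
  qed
  have int: "integrable (itv T \<Otimes>\<^sub>M itv T) (\<lambda>(a, b). indicator {..a} b * (k a * k b))"
  proof (rule Fubini_integrable)
    show "(\<lambda>(a, b). indicator {..a} b * (k a * k b)) \<in> borel_measurable (itv T \<Otimes>\<^sub>M itv T)"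
      unfolding split_def by (intro borel_measurable_times ind) measurable
    have "integrable (itv T) (\<lambda>a. \<bar>k a\<bar> * (LINT b|itv T. indicator {..a} b * \<bar>k b\<bar>))"
    proof (rule Bochner_Integration.integrable_bound)
      show "integrable (itv T) (\<lambda>a. \<bar>k a\<bar> * (LINT b|itv T. \<bar>k b\<bar>))" using k by simp
      have "(\<lambda>p. indicator {..fst p} (snd p) * \<bar>k (snd p)\<bar>) \<in> borel_measurable (itv T \<Otimes>\<^sub>M itv T)"
        by (intro borel_measurable_times ind) measurable
      then have "(\<lambda>(a, b). indicator {..a} b * \<bar>k b\<bar>) \<in> borel_measurable (itv T \<Otimes>\<^sub>M itv T)" by (simp add: split_def)
      from sigma_finite_measure.borel_measurable_lebesgue_integral[OF finite_measure.axioms(1)[OF finite_measure_itv] this]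
      show "(\<lambda>a. \<bar>k a\<bar> * (LINT b|itv T. indicator {..a} b * \<bar>k b\<bar>)) \<in> borel_measurable (itv T)" by simp
      show "AE a in itv T. norm (\<bar>k a\<bar> * (LINT b|itv T. indicator {..a} b * \<bar>k b\<bar>)) \<le> norm (\<bar>k a\<bar> * (LINT b|itv T. \<bar>k b\<bar>))"
      proof (rule AE_I2)
        fix a
        have "(LINT b|itv T. indicator {..a} b * \<bar>k b\<bar>) \<le> (LINT b|itv T. \<bar>k b\<bar>)"
          by (rule integral_mono) (use integrable_cut[of T "\<lambda>b. \<bar>k b\<bar>" a] k in \<open>auto simp: indicator_def\<close>)
        moreover have "0 \<le> (LINT b|itv T. indicator {..a} b * \<bar>k b\<bar>)" by simp
        ultimately show "norm (\<bar>k a\<bar> * (LINT b|itv T. indicator {..a} b * \<bar>k b\<bar>)) \<le> norm (\<bar>k a\<bar> * (LINT b|itv T. \<bar>k b\<bar>))"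
          by (simp add: abs_mult mult_left_mono)
      qed
    qed
    moreover have "(LINT b|itv T. norm (case (a, b) of (a, b) \<Rightarrow> indicator {..a} b * (k a * k b))) = \<bar>k a\<bar> * (LINT b|itv T. indicator {..a} b * \<bar>k b\<bar>)" for a
    proof -
      have "(\<lambda>b. norm (case (a, b) of (a, b) \<Rightarrow> indicator {..a} b * (k a * k b))) = (\<lambda>b. \<bar>k a\<bar> * (indicator {..a} b * \<bar>k b\<bar>))"
        by (auto simp: abs_mult)
      then show ?thesis by simp
    qed
    ultimately show "integrable (itv T) (\<lambda>a. LINT b|itv T. norm (case (a, b) of (a, b) \<Rightarrow> indicator {..a} b * (k a * k b)))" by simp
    show "AE a in itv T. integrable (itv T) (\<lambda>b. case (a, b) of (a, b) \<Rightarrow> indicator {..a} b * (k a * k b))"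
    proof (rule AE_I2)
      fix a
      have "integrable (itv T) (\<lambda>b. k a * (indicator {..a} b * k b))" using cut1 by (rule Bochner_Integration.integrable_mult_right)
      then show "integrable (itv T) (\<lambda>b. case (a, b) of (a, b) \<Rightarrow> indicator {..a} b * (k a * k b))" by (simp add: mult_ac)
    qed
  qed
  define X where "X = (LINT a|itv T. k a * (LINT b|itv T. indicator {..a} b * k b))"
  have X1: "X = (LINT a|itv T. LINT b|itv T. indicator {..a} b * (k a * k b))"
    unfolding X_def by (simp add: mult.left_commute[of _ "k _"])
  also have "\<dots> = (LINT b|itv T. LINT a|itv T. indicator {..a} b * (k a * k b))"
    by (rule Fubini_integral[OF int, symmetric])
  also have "\<dots> = (LINT b|itv T. k b * (LINT a|itv T. indicator {b..} a * k a))"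
  proof (rule Bochner_Integration.integral_cong[OF refl])
    fix b
    have "(\<lambda>a. indicator {..a} b * (k a * k b)) = (\<lambda>a. k b * (indicator {b..} a * k a))" by (auto simp: indicator_def)
    then show "(LINT a|itv T. indicator {..a} b * (k a * k b)) = k b * (LINT a|itv T. indicator {b..} a * k a)" by simp
  qed
  finally have X2: "X = (LINT b|itv T. k b * (LINT a|itv T. indicator {b..} a * k a))" .
  have Xi: "integrable (itv T) (\<lambda>a. k a * (LINT b|itv T. indicator {..a} b * k b))"
  proof -
    have "integrable (itv T) (\<lambda>a. LINT b|itv T. indicator {..a} b * (k a * k b))" using integrable_fst[OF int] .
    then show ?thesis by (simp add: mult.left_commute[of _ "k _"])
  qed
  have split: "(LINT a|itv T. indicator {b..} a * k a) = (LINT a|itv T. k a) - (LINT a|itv T. indicator {..b} a * k a)" for b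
  proof -
    have "(LINT a|itv T. indicator {b..} a * k a) = (LINT a|itv T. k a - indicator {..b} a * k a)"
    proof (rule integral_cong_AE)
      have "AE a in itv T. a \<noteq> b"
      proof -
        have "AE a in lebesgue. a \<noteq> b" by (rule AE_I[of _ _ "{b}"]) auto
        then show ?thesis by (auto simp: AE_restrict_space_iff elim: eventually_mono)
      qed
      then show "AE a in itv T. indicator {b..} a * k a = k a - indicator {..b} a * k a"
        by eventually_elim (auto simp: indicator_def)
    qed (use cut1 cut2 k in auto)
    also have "\<dots> = (LINT a|itv T. k a) - (LINT a|itv T. indicator {..b} a * k a)" using cut1 k by simp
    finally show ?thesis .
  qed
  have "X = (LINT b|itv T. k b * (LINT a|itv T. k a) - k b * (LINT a|itv T. indicator {..b} a * k a))"
    unfolding X2 split by (simp add: right_diff_distrib)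
  also have "\<dots> = (LINT a|itv T. k a) * (LINT a|itv T. k a) - X"
    using Xi k by (simp add: X_def)
  finally have "2 * X = (LINT a|itv T. k a)\<^sup>2" by (simp add: power2_eq_square)
  then show ?thesis by (simp add: X_def)
qed

text \<open>The chain rule for the square of an absolutely continuous function.\<close>

lemma primitive_square:
  fixes g h :: "real \<Rightarrow> real"
  assumes h: "integrable (itv T) h" and g: "\<And>t. t \<in> {0..T} \<Longrightarrow> g t = c + (LINT s|itv T. indicator {..t} s * h s)"
    and t: "t \<in> {0..T}" and gh: "integrable (itv T) (\<lambda>s. g s * h s)"
  shows "(g t)\<^sup>2 = c\<^sup>2 + 2 * (LINT s|itv T. indicator {..t} s * (g s * h s))"
proof -
  define k where "k s = indicator {..t} s * h s" for s
  have k: "integrable (itv T) k" unfolding k_def by (rule integrable_cut[OF h])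
  have eq: "indicator {..t} s * (g s * h s) = c * k s + k s * (LINT b|itv T. indicator {..s} b * k b)" if "s \<in> space (itv T)" for s
  proof (cases "s \<le> t")
    case True
    have "(\<lambda>b. indicator {..s} b * k b) = (\<lambda>b. indicator {..s} b * h b)" using True by (auto simp: k_def indicator_def)
    then show ?thesis using g[of s] that True by (simp add: k_def algebra_simps)
  qed (simp add: k_def)
  have "integrable (itv T) (\<lambda>s. indicator {..t} s * (g s * h s) - c * k s)" using integrable_cut[OF gh, of t] k by simp
  then have i: "integrable (itv T) (\<lambda>s. k s * (LINT b|itv T. indicator {..s} b * k b))"
    by (rule Bochner_Integration.integrable_cong[THEN iffD1, rotated 2]) (use eq in auto)
  have "(LINT s|itv T. indicator {..t} s * (g s * h s)) = (LINT s|itv T. c * k s + k s * (LINT b|itv T. indicator {..s} b * k b))"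
    by (rule Bochner_Integration.integral_cong) (use eq in auto)
  also have "\<dots> = c * (LINT s|itv T. k s) + (LINT s|itv T. k s * (LINT b|itv T. indicator {..s} b * k b))"
    using i k by simp
  finally have "2 * (LINT s|itv T. indicator {..t} s * (g s * h s)) = 2 * c * (LINT s|itv T. k s) + (LINT s|itv T. k s)\<^sup>2"
    using square_integral_triangle[OF k] by simp
  moreover have "g t = c + (LINT s|itv T. k s)" using g[OF t] by (simp add: k_def)
  ultimately show ?thesis by (simp add: power2_sum)
qed

section \<open>Null sets of times\<close>

lemma measurable_itv_AE:
  fixes p q :: "real \<Rightarrow> real"
  assumes p: "p \<in> borel_measurable (itv T)" and ae: "AE t in itv T. p t = q t"
  shows "q \<in> borel_measurable (itv T)"
proof -
  have "(\<lambda>t. p t * indicator {0<..<T} t) \<in> borel_measurable lebesgue"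
    using p by (simp add: borel_measurable_restrict_space_iff mult.commute)
  moreover have "AE t in lebesgue. p t * indicator {0<..<T} t = q t * indicator {0<..<T} t"
    using ae by (auto simp: AE_restrict_space_iff indicator_def elim: eventually_mono)
  ultimately have "(\<lambda>t. q t * indicator {0<..<T} t) \<in> borel_measurable lebesgue"
    by (rule borel_measurable_AE)
  then show ?thesis by (simp add: borel_measurable_restrict_space_iff mult.commute)
qed

text \<open>As Lebesgue measure is complete, convergence outside a null set is enough. This makes quantities measurable in time
  that are defined through an arbitrary choice of weak gradients.\<close>

lemma measurable_itv_limit:
  fixes q :: "real \<Rightarrow> real"
  assumes p: "\<And>n. p n \<in> borel_measurable (itv T)" and ae: "AE t in itv T. (\<lambda>n. p n t) \<longlonglongrightarrow> q t"
  shows "q \<in> borel_measurable (itv T)"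
proof (rule measurable_itv_AE)
  show "(\<lambda>t. lim (\<lambda>n. p n t)) \<in> borel_measurable (itv T)" using p by (rule borel_measurable_lim_metric)
  show "AE t in itv T. lim (\<lambda>n. p n t) = q t" using ae by eventually_elim (rule limI)
qed

lemma AE_itv_dense:
  assumes ae: "AE t in itv T. P t" and pq: "0 \<le> p" "p < q" "q \<le> T"
  shows "\<exists>t. p < t \<and> t < q \<and> P t"
proof (rule ccontr)
  assume n: "\<not> ?thesis"
  have "AE t in lebesgue. t \<in> {0<..<T} \<longrightarrow> P t" using ae by (simp add: AE_restrict_space_iff)
  then obtain N where N: "{t. \<not> (t \<in> {0<..<T} \<longrightarrow> P t)} \<subseteq> N" "N \<in> null_sets lebesgue" by (auto elim!: AE_E simp: null_sets_def)
  have "{p<..<q} \<subseteq> N" using N(1) n pq by auto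
  then have "{p<..<q} \<in> null_sets lebesgue" by (rule null_sets_subset[OF N(2), rotated]) auto
  then have "measure lebesgue {p<..<q} = 0" by (simp add: measure_eq_0_null_sets)
  then show False using pq by simp
qed

lemma integral_closed_interval:
  fixes \<phi> :: "real \<Rightarrow> real"
  assumes i: "integrable (itv T) \<phi>" and t: "t \<in> {0..T}"
  shows "(LINT s|lebesgue_on {0..t}. \<phi> s) = (LINT s|itv T. indicator {..t} s * \<phi> s)"
proof -
  have 1: "integrable lebesgue (\<lambda>s. indicator {0<..<T} s * (indicator {..t} s * \<phi> s))"
    using integrable_cut[OF i, of t] by (simp add: integrable_restrict_space)
  have "AE s in lebesgue. s \<noteq> a" for a :: real by (rule AE_I[of _ _ "{a}"]) auto
  from this[of 0] this[of T]
  have ae: "AE s in lebesgue. indicator {0<..<T} s * (indicator {..t} s * \<phi> s) = indicator {0..t} s * \<phi> s"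
    by eventually_elim (use t in \<open>auto simp: indicator_def\<close>)
  have 2: "(\<lambda>s. indicator {0..t} s * \<phi> s) \<in> borel_measurable lebesgue"
    by (rule borel_measurable_AE[OF _ ae]) (use 1 in auto)
  have "(LINT s|itv T. indicator {..t} s * \<phi> s) = (LINT s|lebesgue. indicator {0<..<T} s * (indicator {..t} s * \<phi> s))"
    by (simp add: integral_restrict_space)
  also have "\<dots> = (LINT s|lebesgue. indicator {0..t} s * \<phi> s)"
    by (rule integral_cong_AE[OF _ 2 ae]) (use 1 in auto)
  also have "\<dots> = (LINT s|lebesgue_on {0..t}. \<phi> s)" by (simp add: integral_restrict_space)
  finally show ?thesis ..
qed

section \<open>Leray--Hopf solutions with Hoelder continuous time slices\<close>

text \<open>The hypotheses of the theorem, with one Hoelder constant \<open>f t\<close> fixed for every time \<open>t\<close>.\<close>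

locale leray_solution =
  fixes T \<nu> \<alpha> :: real and v0 :: "real^3 \<Rightarrow> real^3" and v :: "real \<Rightarrow> real^3 \<Rightarrow> real^3" and f :: "real \<Rightarrow> real"
  assumes T: "T > 0" and nu: "\<nu> > 0" and alpha: "0 < \<alpha>" "\<alpha> < 1"
    and v0_H: "v0 \<in> H_space"
    and lh: "leray_hopf T \<nu> v0 v"
    and wcr: "weakly_continuous_representative T v0 v"
    and f_nonneg: "\<forall>t\<in>{0..T}. 0 \<le> f t"
    and f_holder: "AE t in lebesgue_on {0<..T}. \<forall>x y. norm (v t x - v t y) \<le> f t * norm (x - y) powr \<alpha>"
    and f_Lp: "\<forall>l\<in>{0<..<T}. Lp_on (2 / (1 + \<alpha>)) {l<..<T} f"
begin

abbreviation "G t \<equiv> wgrad (v t)"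
abbreviation "good t \<equiv> regular_field (v t) (G t) \<alpha> (f t)"
definition "dissipation t = (L2_norm (G t))\<^sup>2"
text \<open>The moment of the \<open>i\<close>-th velocity component against \<open>e\<close>, and the rate of change that the
  equation prescribes for it up to the pressure gradient.\<close>

definition "moment e i t = (LINT x|torus. v t x $ i * e x)"
definition "rate e i t = - \<nu> * (\<Sum>j\<in>UNIV. LINT x|torus. G t x $ i $ j * partial j e x) - (\<Sum>j\<in>UNIV. LINT x|torus. G t x $ i $ j * v t x $ j * e x)"

lemma AE_good: "AE t in itv T. good t"
proof -
  have 1: "AE t in itv T. v t \<in> H_space" "AE t in itv T. v t \<in> V_space"
    and p: "\<forall>t\<in>{0<..<T}. periodic (v t)"
    using lh by (auto simp: leray_hopf_def Linfty_H_def L2_V_def)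
  have 2: "AE t in itv T. \<forall>x y. norm (v t x - v t y) \<le> f t * norm (x - y) powr \<alpha>"
    using f_holder by (auto simp: AE_restrict_space_iff elim: eventually_mono)
  have 3: "AE t in itv T. t \<in> {0<..<T}" by (rule AE_I2) simp
  from 1 2 3 show ?thesis
  proof eventually_elim
    case (elim t)
    have "\<exists>G. has_weak_gradient (v t) G" using elim(2) by (simp add: V_space_def W12_def)
    then have w: "has_weak_gradient (v t) (G t)" unfolding wgrad_def by (rule someI_ex)
    show ?case
      by unfold_locales (use alpha p elim w f_nonneg H_space_orth_gradient[OF elim(1)] in auto)
  qed
qed

lemma v_L2: "t \<in> {0..T} \<Longrightarrow> v t \<in> L2"
  using wcr by (simp add: weakly_continuous_representative_def)

lemma v0_L2: "v0 \<in> L2" using v0_H by (simp add: H_space_def)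

lemma cont_moment: assumes e: "trigpoly e" shows "continuous_on {0..T} (moment e i)"
proof -
  have "(\<lambda>x. e x *\<^sub>R axis i 1 :: real^3) \<in> L2"
    using trigpoly_periodic[OF e] by (intro continuous_periodic_L2) (auto simp: periodic_def intro!: continuous_intros trigpoly_continuous[OF e])
  then have "continuous_on {0..T} (\<lambda>t. L2_inner (v t) (\<lambda>x. e x *\<^sub>R axis i 1))"
    using wcr by (simp add: weakly_continuous_representative_def)
  moreover have "L2_inner (v t) (\<lambda>x. e x *\<^sub>R axis i 1) = moment e i t" for t
    by (simp add: L2_inner_def moment_def inner_axis mult.commute)
  ultimately show ?thesis by simp
qed

lemma moment_initial: "moment e i 0 = (LINT x|torus. v0 x $ i * e x)" if e: "trigpoly e"
proof -
  have "AE x in torus. v 0 x = v0 x"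
    using wcr by (auto simp: weakly_continuous_representative_def AE_restrict_space_iff elim: eventually_mono)
  then show ?thesis unfolding moment_def
    by (intro integral_cong_AE)
      (use T v_L2[of 0, THEN L2_component(1)] L2_component(1)[OF v0_L2] trigpoly_measurable_torus[OF e] in \<open>auto elim: eventually_mono\<close>)
qed

lemma norm_v_le: "t \<in> {0..T} \<Longrightarrow> L2_norm (v t) \<le> L2_norm v0"
proof -
  assume t: "t \<in> {0..T}"
  have "1/2 * (L2_norm (v t))\<^sup>2 + \<nu> * (LINT s|lebesgue_on {0..t}. (L2_norm (G s))\<^sup>2) \<le> 1/2 * (L2_norm v0)\<^sup>2"
    using lh t unfolding leray_hopf_def by blast
  moreover have "0 \<le> \<nu> * (LINT s|lebesgue_on {0..t}. (L2_norm (G s))\<^sup>2)" using nu by simp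
  ultimately have "(L2_norm (v t))\<^sup>2 \<le> (L2_norm v0)\<^sup>2" by linarith
  then show ?thesis by (rule power2_le_imp_le) (rule L2_norm_nonneg)
qed

text \<open>The kernel is separated into finitely many products, which reduces the claim to weak continuity.\<close>

lemma cont_conv_form:
  assumes p: "trigpoly p" and a: "trigpoly a"
  shows "continuous_on {0..T} (\<lambda>t. conv_form p (\<lambda>x. v t x $ i * a x) (\<lambda>x. v t x $ j))"
proof -
  obtain n :: nat and \<beta> \<gamma> where 1: "\<forall>m<n. trigpoly (\<beta> m) \<and> trigpoly (\<gamma> m)" "\<forall>x y. p (x - y) = (\<Sum>m<n. \<beta> m x * \<gamma> m y)"
    using trigpoly_separate[OF p] by blast
  have eq: "conv_form p (\<lambda>x. v t x $ i * a x) (\<lambda>x. v t x $ j) = (\<Sum>m<n. moment (\<lambda>x. a x * \<beta> m x) i t * moment (\<gamma> m) j t)" if "t \<in> {0..T}" for t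
    using conv_form_separated[OF 1 integrable_mult_trigpoly[OF L2_component(3)[OF v_L2[OF that]] a] L2_component(3)[OF v_L2[OF that]], of i j]
    by (simp add: moment_def mult.assoc)
  have "continuous_on {0..T} (\<lambda>t. \<Sum>m<n. moment (\<lambda>x. a x * \<beta> m x) i t * moment (\<gamma> m) j t)"
    using 1(1) by (intro continuous_on_sum continuous_on_mult cont_moment trigpoly_mult a) auto
  then show ?thesis by (rule continuous_on_eq) (simp only: eq)
qed

lemma cont_meas: "continuous_on {0..T} q \<Longrightarrow> q \<in> borel_measurable (itv T)" for q :: "real \<Rightarrow> real"
  using continuous_integrable_itv(1) by blast

text \<open>The norm in \<open>V\<close> is square integrable in time by assumption. The \<open>L\<^sup>2\<close> norm of the
  velocity is measurable as a limit of continuous mollified energies, and so is the difference of the squares.\<close>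

lemma dissipation_integrable: "integrable (itv T) dissipation"
proof -
  have W: "(\<lambda>t. W12_norm (v t)) \<in> borel_measurable (itv T)" "integrable (itv T) (\<lambda>t. \<bar>W12_norm (v t)\<bar> powr 2)"
    using lh by (auto simp: leray_hopf_def L2_V_def Lp_on_def)
  have kk: "(\<lambda>t. \<Sum>i\<in>UNIV. conv_form (kern N) (\<lambda>x. v t x $ i) (\<lambda>x. v t x $ i)) \<in> borel_measurable (itv T)" for N
    using cont_conv_form[OF trigpoly_kern trigpoly_const[of 1]] by (intro cont_meas continuous_on_sum) simp
  have nv: "(\<lambda>t. (L2_norm (v t))\<^sup>2) \<in> borel_measurable (itv T)"
  proof (rule measurable_itv_limit[OF kk])
    show "AE t in itv T. (\<lambda>N. \<Sum>i\<in>UNIV. conv_form (kern N) (\<lambda>x. v t x $ i) (\<lambda>x. v t x $ i)) \<longlonglongrightarrow> (L2_norm (v t))\<^sup>2"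
      using AE_good
    proof eventually_elim
      case (elim t)
      then interpret regular_field "v t" "G t" \<alpha> "f t" .
      show ?case unfolding norm_sq_u unfolding power2_eq_square
        by (intro tendsto_sum conv_form_kern_limit cper_integrable cper_u)
    qed
  qed
  have eq: "(W12_norm (v t))\<^sup>2 = (L2_norm (v t))\<^sup>2 + dissipation t" for t
    by (simp add: W12_norm_def dissipation_def)
  have "(\<lambda>t. (W12_norm (v t))\<^sup>2 - (L2_norm (v t))\<^sup>2) \<in> borel_measurable (itv T)" using W(1) nv by measurable
  then have dm: "dissipation \<in> borel_measurable (itv T)" by (simp add: eq)
  show ?thesis
  proof (rule Bochner_Integration.integrable_bound[OF W(2) dm])
    show "AE t in itv T. norm (dissipation t) \<le> norm (\<bar>W12_norm (v t)\<bar> powr 2)"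
    proof (rule AE_I2)
      fix t
      have "\<bar>W12_norm (v t)\<bar> powr 2 = (W12_norm (v t))\<^sup>2" by (cases "W12_norm (v t) = 0") auto
      then show "norm (dissipation t) \<le> norm (\<bar>W12_norm (v t)\<bar> powr 2)" by (simp add: eq) (simp add: dissipation_def)
    qed
  qed
qed

text \<open>After integration by parts, only moments of \<open>v\<close> and of \<open>v\<^sub>i v\<^sub>j\<close> remain; the
  latter are limits of forms that are continuous in time.\<close>

lemma rate_measurable: assumes e: "trigpoly e" shows "rate e i \<in> borel_measurable (itv T)"
proof (rule measurable_itv_limit)
  let ?p = "\<lambda>N t. \<nu> * (\<Sum>j\<in>UNIV. moment (partial j (partial j e)) i t) + (\<Sum>j\<in>UNIV. conv_form (kern N) (\<lambda>x. v t x $ i * partial j e x) (\<lambda>x. v t x $ j))"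
  show "?p N \<in> borel_measurable (itv T)" for N
    by (intro cont_meas continuous_on_add continuous_on_sum continuous_on_mult continuous_on_const cont_moment cont_conv_form trigpoly_kern trigpoly_partial e)
  show "AE t in itv T. (\<lambda>N. ?p N t) \<longlonglongrightarrow> rate e i t"
    using AE_good
  proof eventually_elim
    case (elim t)
    then interpret regular_field "v t" "G t" \<alpha> "f t" .
    have "rate e i t = \<nu> * (\<Sum>j\<in>UNIV. moment (partial j (partial j e)) i t) + (\<Sum>j\<in>UNIV. LINT x|torus. (v t x $ i * partial j e x) * v t x $ j)"
      unfolding rate_def convection_by_parts[OF e]
      using weak_gradient_trigpoly[OF wg trigpoly_partial[OF e], of i] by (simp add: moment_def sum_negf mult_ac)
    moreover have "(\<lambda>N. ?p N t) \<longlonglongrightarrow> \<nu> * (\<Sum>j\<in>UNIV. moment (partial j (partial j e)) i t) + (\<Sum>j\<in>UNIV. LINT x|torus. (v t x $ i * partial j e x) * v t x $ j)"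
      by (intro tendsto_intros conv_form_kern_limit integrable_mult_trigpoly cper_integrable cper_u trigpoly_partial e)
    ultimately show ?case by simp
  qed
qed

lemma gradient_entry_le:
  assumes "good t" shows "(LINT x|torus. (G t x $ i $ j)\<^sup>2) \<le> dissipation t"
proof -
  interpret regular_field "v t" "G t" \<alpha> "f t" by fact
  have "(LINT x|torus. (G t x $ i $ j)\<^sup>2) \<le> (LINT x|torus. (norm (G t x))\<^sup>2)"
  proof (rule integral_mono)
    show "integrable torus (\<lambda>x. (G t x $ i $ j)\<^sup>2)" by (rule L2_component(2)[OF L2_matrix_row[OF G_L2]])
    show "integrable torus (\<lambda>x. (norm (G t x))\<^sup>2)" using G_L2 by (simp add: L2_def)
    fix x
    have "\<bar>G t x $ i $ j\<bar> \<le> norm (G t x $ i)" by (rule component_le_norm_cart)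
    also have "\<dots> \<le> norm (G t x)" by (rule Finite_Cartesian_Product.norm_nth_le)
    finally show "(G t x $ i $ j)\<^sup>2 \<le> (norm (G t x))\<^sup>2" by (simp add: abs_le_square_iff[symmetric])
  qed
  then show ?thesis by (simp add: dissipation_def L2_norm_sq[OF G_L2])
qed

lemma rate_bound:
  assumes e: "trigpoly e"
  obtains C where "C \<ge> 0" "\<And>t. t \<in> {0..T} \<Longrightarrow> good t \<Longrightarrow> \<bar>rate e i t\<bar> \<le> C * (1 + dissipation t)"
proof -
  define V where "V = (LINT x|torus. 1::real)"
  define m where "m = (L2_norm v0)\<^sup>2"
  have V: "V \<ge> 0" "m \<ge> 0" by (auto simp: V_def m_def)
  obtain B where B: "B \<ge> 0" "\<And>x. \<bar>e x\<bar> \<le> B" using trigpoly_bounded[OF e] by blast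
  have "\<forall>j. \<exists>B\<ge>0. \<forall>x. \<bar>partial j e x\<bar> \<le> B" using trigpoly_bounded[OF trigpoly_partial[OF e]] by blast
  then obtain K where K: "\<And>j. K j \<ge> 0" "\<And>j x. \<bar>partial j e x\<bar> \<le> K j" by metis
  define C where "C = (\<Sum>j\<in>UNIV. \<nu> * (K j * (V + 1)) + B * (m + 1))"
  show ?thesis
  proof (rule that[of C])
    show "C \<ge> 0" unfolding C_def using nu K(1) B(1) V by (intro sum_nonneg add_nonneg_nonneg mult_nonneg_nonneg) auto
    fix t assume t: "t \<in> {0..T}" and g: "good t"
    interpret regular_field "v t" "G t" \<alpha> "f t" by (rule g)
    have d0: "dissipation t \<ge> 0" by (simp add: dissipation_def)
    have i2: "integrable torus (\<lambda>x. (G t x $ i $ j)\<^sup>2)" for j by (rule L2_component(2)[OF L2_matrix_row[OF G_L2]])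
    have 1: "\<bar>LINT x|torus. G t x $ i $ j * partial j e x\<bar> \<le> K j * (V + 1) * (1 + dissipation t)" for j
    proof -
      have "\<bar>LINT x|torus. G t x $ i $ j * partial j e x\<bar> \<le> (LINT x|torus. \<bar>G t x $ i $ j * partial j e x\<bar>)" by (rule integral_abs_bound)
      also have "\<dots> \<le> (LINT x|torus. K j * (1 + (G t x $ i $ j)\<^sup>2))"
      proof (rule integral_mono)
        show "integrable torus (\<lambda>x. \<bar>G t x $ i $ j * partial j e x\<bar>)"
          by (intro Bochner_Integration.integrable_abs integrable_mult_trigpoly G_integrable trigpoly_partial e)
        show "integrable torus (\<lambda>x. K j * (1 + (G t x $ i $ j)\<^sup>2))"
          using i2[of j] cper_integrable[OF cper_const[of 1]] by simp
        fix x
        have "2 * \<bar>G t x $ i $ j\<bar> \<le> 1 + (G t x $ i $ j)\<^sup>2" using sum_squares_bound[of "\<bar>G t x $ i $ j\<bar>" 1] by simp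
        then have "\<bar>G t x $ i $ j\<bar> \<le> 1 + (G t x $ i $ j)\<^sup>2" by (smt (verit) zero_le_power2)
        then have "\<bar>partial j e x\<bar> * \<bar>G t x $ i $ j\<bar> \<le> K j * (1 + (G t x $ i $ j)\<^sup>2)" by (intro mult_mono K) auto
        then show "\<bar>G t x $ i $ j * partial j e x\<bar> \<le> K j * (1 + (G t x $ i $ j)\<^sup>2)" by (simp add: abs_mult mult.commute)
      qed
      also have "\<dots> = K j * (V + (LINT x|torus. (G t x $ i $ j)\<^sup>2))"
        using i2[of j] cper_integrable[OF cper_const[of 1]] by (simp add: V_def)
      also have "\<dots> \<le> K j * ((V + 1) * (1 + dissipation t))"
      proof (intro mult_left_mono K(1))
        show "V + (LINT x|torus. (G t x $ i $ j)\<^sup>2) \<le> (V + 1) * (1 + dissipation t)"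
          using gradient_entry_le[OF g, of i j] mult_nonneg_nonneg[OF V(1) d0] by (simp add: distrib_left distrib_right)
      qed
      finally show ?thesis by simp
    qed
    have 2: "\<bar>LINT x|torus. G t x $ i $ j * v t x $ j * e x\<bar> \<le> B * (m + 1) * (1 + dissipation t)" for j
    proof -
      have "\<bar>LINT x|torus. G t x $ i $ j * v t x $ j * e x\<bar> \<le> (LINT x|torus. \<bar>G t x $ i $ j * v t x $ j * e x\<bar>)" by (rule integral_abs_bound)
      also have "\<dots> \<le> (LINT x|torus. B * ((G t x $ i $ j)\<^sup>2 + (v t x $ j)\<^sup>2))"
      proof (rule integral_mono)
        show "integrable torus (\<lambda>x. \<bar>G t x $ i $ j * v t x $ j * e x\<bar>)"
          by (intro Bochner_Integration.integrable_abs integrable_mult_trigpoly integrable_mult_cper cper_u G_integrable e)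
        show "integrable torus (\<lambda>x. B * ((G t x $ i $ j)\<^sup>2 + (v t x $ j)\<^sup>2))"
          using i2[of j] cper_integrable[OF cper_power[OF cper_u]] by simp
        fix x
        have "2 * (\<bar>G t x $ i $ j\<bar> * \<bar>v t x $ j\<bar>) \<le> (G t x $ i $ j)\<^sup>2 + (v t x $ j)\<^sup>2"
          using sum_squares_bound[of "\<bar>G t x $ i $ j\<bar>" "\<bar>v t x $ j\<bar>"] by simp
        moreover have "0 \<le> \<bar>G t x $ i $ j\<bar> * \<bar>v t x $ j\<bar>" by simp
        ultimately have "\<bar>G t x $ i $ j\<bar> * \<bar>v t x $ j\<bar> \<le> (G t x $ i $ j)\<^sup>2 + (v t x $ j)\<^sup>2" by linarith
        then have "\<bar>e x\<bar> * (\<bar>G t x $ i $ j\<bar> * \<bar>v t x $ j\<bar>) \<le> B * ((G t x $ i $ j)\<^sup>2 + (v t x $ j)\<^sup>2)" using B by (intro mult_mono) auto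
        then show "\<bar>G t x $ i $ j * v t x $ j * e x\<bar> \<le> B * ((G t x $ i $ j)\<^sup>2 + (v t x $ j)\<^sup>2)" by (simp add: abs_mult mult_ac)
      qed
      also have "\<dots> = B * ((LINT x|torus. (G t x $ i $ j)\<^sup>2) + (LINT x|torus. (v t x $ j)\<^sup>2))"
        using i2[of j] cper_integrable[OF cper_power[OF cper_u]] by simp
      also have "(LINT x|torus. (v t x $ j)\<^sup>2) \<le> m"
      proof -
        have "(LINT x|torus. (v t x $ j)\<^sup>2) \<le> (L2_norm (v t))\<^sup>2"
          unfolding norm_sq_u by (rule member_le_sum) auto
        also have "\<dots> \<le> m" unfolding m_def using norm_v_le[OF t] L2_norm_nonneg by (intro power_mono) auto
        finally show ?thesis .
      qed
      then have "B * ((LINT x|torus. (G t x $ i $ j)\<^sup>2) + (LINT x|torus. (v t x $ j)\<^sup>2)) \<le> B * (dissipation t + m)"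
        using gradient_entry_le[OF g, of i j] B(1) by (intro mult_left_mono add_mono) auto
      also have "\<dots> \<le> B * ((m + 1) * (1 + dissipation t))"
        using V d0 B(1) by (intro mult_left_mono) (auto simp: algebra_simps)
      finally show ?thesis by simp
    qed
    have "\<bar>rate e i t\<bar> \<le> \<nu> * \<bar>\<Sum>j\<in>UNIV. LINT x|torus. G t x $ i $ j * partial j e x\<bar> + \<bar>\<Sum>j\<in>UNIV. LINT x|torus. G t x $ i $ j * v t x $ j * e x\<bar>"
      unfolding rate_def using abs_triangle_ineq4[of "- \<nu> * (\<Sum>j\<in>UNIV. LINT x|torus. G t x $ i $ j * partial j e x)"] nu by (simp add: abs_mult)
    also have "\<dots> \<le> \<nu> * (\<Sum>j\<in>UNIV. K j * (V + 1) * (1 + dissipation t)) + (\<Sum>j\<in>(UNIV :: 3 set). B * (m + 1) * (1 + dissipation t))"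
      using nu by (intro add_mono mult_left_mono order_trans[OF sum_abs] sum_mono 1 2) auto
    also have "\<dots> = C * (1 + dissipation t)"
      unfolding C_def by (simp only: sum_distrib_right sum_distrib_left sum.distrib[symmetric] distrib_right mult.assoc)
    finally show "\<bar>rate e i t\<bar> \<le> C * (1 + dissipation t)" .
  qed
qed

lemma rate_integrable: assumes e: "trigpoly e" shows "integrable (itv T) (rate e i)"
proof -
  obtain C where C: "C \<ge> 0" "\<And>t. t \<in> {0..T} \<Longrightarrow> good t \<Longrightarrow> \<bar>rate e i t\<bar> \<le> C * (1 + dissipation t)" by (rule rate_bound[OF e]) (rule that)
  have "AE t in itv T. t \<in> {0..T}" by (rule AE_I2) simp
  with AE_good have ae: "AE t in itv T. norm (rate e i t) \<le> norm (C * (1 + dissipation t))"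
    by eventually_elim (use C in fastforce)
  have "integrable (itv T) (\<lambda>t. C * (1 + dissipation t))"
    using dissipation_integrable continuous_integrable_itv(1)[of T "\<lambda>_. 1"] by simp
  then show ?thesis by (rule Bochner_Integration.integrable_bound[OF _ rate_measurable[OF e] ae])
qed

lemma moment_bounded: assumes e: "trigpoly e" obtains B where "B \<ge> 0" "\<And>t. t \<in> {0..T} \<Longrightarrow> \<bar>moment e i t\<bar> \<le> B"
proof -
  have "bounded (moment e i ` {0..T})" by (intro compact_imp_bounded compact_continuous_image cont_moment e) simp
  then obtain B where B: "\<forall>t\<in>{0..T}. \<bar>moment e i t\<bar> \<le> B" by (auto simp: bounded_iff)
  show ?thesis by (rule that[of "max 0 B"]) (use B in \<open>auto simp: le_max_iff_disj\<close>)
qed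

lemma moment_rate_integrable: assumes e: "trigpoly e" "trigpoly e'" shows "integrable (itv T) (\<lambda>t. moment e i t * rate e' j t)"
proof -
  obtain B where B: "B \<ge> 0" "\<And>t. t \<in> {0..T} \<Longrightarrow> \<bar>moment e i t\<bar> \<le> B" by (rule moment_bounded[OF e(1), of i]) (rule that)
  show ?thesis
  proof (rule Bochner_Integration.integrable_bound)
    show "integrable (itv T) (\<lambda>t. B * \<bar>rate e' j t\<bar>)" using rate_integrable[OF e(2)] by simp
    show "(\<lambda>t. moment e i t * rate e' j t) \<in> borel_measurable (itv T)"
      using rate_measurable[OF e(2)] cont_meas[OF cont_moment[OF e(1)]] by (rule borel_measurable_times[rotated])
    show "AE t in itv T. norm (moment e i t * rate e' j t) \<le> norm (B * \<bar>rate e' j t\<bar>)"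
    proof (rule AE_I2)
      fix t assume "t \<in> space (itv T)"
      then have "\<bar>moment e i t\<bar> \<le> B" by (intro B(2)) auto
      then show "norm (moment e i t * rate e' j t) \<le> norm (B * \<bar>rate e' j t\<bar>)" using B(1) by (simp add: abs_mult mult_right_mono)
    qed
  qed
qed

section \<open>The equation for a single Fourier mode\<close>

text \<open>The test function is a profile in time times a plane wave with constant direction \<open>a\<close>, which is
  solenoidal because \<open>a\<close> is orthogonal to the frequency.\<close>

lemma weak_mode:
  fixes k :: "real^3" and c :: real
  assumes k: "\<And>i. k $ i \<in> \<int>" and a: "k \<bullet> a = 0"
    and E: "deriv_chain E" and late: "\<exists>T'\<in>{0..<T}. \<forall>t\<ge>T'. E 0 t = 0"
  defines "e \<equiv> \<lambda>x. cos (k \<bullet> x + c)"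
  shows "(LINT t|itv T. E 1 t * (\<Sum>i\<in>UNIV. a $ i * moment e i t) + E 0 t * (\<Sum>i\<in>UNIV. a $ i * rate e i t)) = - (E 0 0 * (\<Sum>i\<in>UNIV. a $ i * moment e i 0))"
proof -
  have te: "trigpoly e" unfolding e_def by (rule trigpoly.wave[OF k])
  define \<phi> where "\<phi> t x = (E 0 t * e x) *\<^sub>R a" for t x
  have dphi: "(\<phi> t has_derivative (\<lambda>h. (E 0 t * (\<Sum>j\<in>UNIV. h $ j * partial j e x)) *\<^sub>R a)) (at x)" for t x
    unfolding \<phi>_def by (intro has_derivative_scaleR_left has_derivative_mult_right has_derivative_partial trigpoly_differentiable te)
  have cg: "cgrad (\<phi> t) x $ i $ j = E 0 t * partial j e x * a $ i" for t x i j
    unfolding cgrad_def jacobian_def frechet_derivative_at[OF dphi, symmetric] matrix_def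
    by (simp add: axis_def if_distrib[of "\<lambda>y. y * _"] sum.delta cong: if_cong)
  have div: "divergence (\<phi> t) x = 0" for t x
  proof -
    have "divergence (\<phi> t) x = (\<Sum>i\<in>UNIV. E 0 t * partial i e x * a $ i)" by (simp add: divergence_def trace_def cg)
    also have "\<dots> = (\<Sum>i\<in>UNIV. - (E 0 t * sin (k \<bullet> x + c)) * (k $ i * a $ i))"
      by (rule sum.cong) (simp_all add: e_def partial_wave)
    also have "\<dots> = - (E 0 t * sin (k \<bullet> x + c)) * (k \<bullet> a)"
      unfolding sum_distrib_left[symmetric] by (simp only: inner_vec_def[of k a] inner_real_def)
    finally show ?thesis using a by simp
  qed
  have test: "\<phi> \<in> test_functions T"
  proof -
    have "testspan E (\<lambda>(t, x). (E 0 t * cos (k \<bullet> x + c)) *\<^sub>R a)" by (rule testspan.wave)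
    from testspan_smooth[OF E this T] have "smooth_on ({0..<T} \<times> UNIV) (\<lambda>(t, x). \<phi> t x)" by (simp add: \<phi>_def e_def)
    moreover have "periodic (\<phi> t)" for t using trigpoly_periodic[OF te] by (simp add: periodic_def \<phi>_def)
    moreover have "\<exists>T'\<in>{0..<T}. \<forall>t\<in>{T'..<T}. \<forall>x. \<phi> t x = 0" using late by (force simp: \<phi>_def)
    ultimately show ?thesis using div by (simp add: test_functions_def)
  qed
  have td: "time_deriv \<phi> t x = (E 1 t * e x) *\<^sub>R a" for t x
  proof -
    have "(E 0 has_real_derivative E 1 t) (at t)" using E by (simp add: deriv_chain_def)
    then have "((\<lambda>s. E 0 s * e x) has_real_derivative E 1 t * e x) (at t)" by (rule DERIV_cmult_right)
    then have "((\<lambda>s. (E 0 s * e x) *\<^sub>R a) has_vector_derivative (E 1 t * e x) *\<^sub>R a) (at t)"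
      using has_vector_derivative_scaleR[OF _ has_vector_derivative_const[of a]] by fastforce
    then show ?thesis unfolding time_deriv_def \<phi>_def by (rule vector_derivative_at)
  qed
  have inner_wave: "L2_inner w (\<lambda>x. (r * e x) *\<^sub>R a) = r * (\<Sum>i\<in>UNIV. a $ i * (LINT x|torus. w x $ i * e x))" if w: "w \<in> L2" for w :: "real^3 \<Rightarrow> real^3" and r
  proof -
    have "L2_inner w (\<lambda>x. (r * e x) *\<^sub>R a) = (LINT x|torus. (\<Sum>i\<in>UNIV. (r * a $ i) * (w x $ i * e x)))"
      unfolding L2_inner_def by (simp add: inner_vec_def sum_distrib_left mult_ac)
    also have "\<dots> = (\<Sum>i\<in>UNIV. (r * a $ i) * (LINT x|torus. w x $ i * e x))"
      by (subst Bochner_Integration.integral_sum, intro Bochner_Integration.integrable_mult_right integrable_mult_trigpoly te L2_component(3)[OF w], simp)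
    finally show ?thesis by (simp add: sum_distrib_left mult_ac)
  qed
  let ?L = "\<lambda>t. L2_inner (v t) (time_deriv \<phi> t) - \<nu> * L2_inner (G t) (cgrad (\<phi> t)) - L2_inner (convection (v t)) (\<phi> t)"
  let ?R = "\<lambda>t. E 1 t * (\<Sum>i\<in>UNIV. a $ i * moment e i t) + E 0 t * (\<Sum>i\<in>UNIV. a $ i * rate e i t)"
  have "AE t in itv T. t \<in> {0..T}" by (rule AE_I2) simp
  with AE_good have ae: "AE t in itv T. ?R t = ?L t"
  proof eventually_elim
    case (elim t)
    interpret regular_field "v t" "G t" \<alpha> "f t" by (rule elim)
    have 1: "L2_inner (v t) (time_deriv \<phi> t) = E 1 t * (\<Sum>i\<in>UNIV. a $ i * moment e i t)"
      unfolding td[abs_def] inner_wave[OF v_L2[OF elim(2)]] moment_def by simp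
    have "L2_inner (G t) (cgrad (\<phi> t)) = (LINT x|torus. (\<Sum>i\<in>UNIV. \<Sum>j\<in>UNIV. (E 0 t * a $ i) * (G t x $ i $ j * partial j e x)))"
      unfolding L2_inner_def by (simp add: inner_vec_def cg mult_ac)
    also have "\<dots> = (\<Sum>i\<in>UNIV. \<Sum>j\<in>UNIV. (E 0 t * a $ i) * (LINT x|torus. G t x $ i $ j * partial j e x))"
      by (subst Bochner_Integration.integral_sum, intro Bochner_Integration.integrable_sum Bochner_Integration.integrable_mult_right integrable_mult_trigpoly trigpoly_partial te G_integrable,
          rule sum.cong[OF refl], subst Bochner_Integration.integral_sum, intro Bochner_Integration.integrable_mult_right integrable_mult_trigpoly trigpoly_partial te G_integrable, simp)
    finally have 2: "L2_inner (G t) (cgrad (\<phi> t)) = E 0 t * (\<Sum>i\<in>UNIV. a $ i * (\<Sum>j\<in>UNIV. LINT x|torus. G t x $ i $ j * partial j e x))"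
      by (simp add: sum_distrib_left mult_ac)
    have "L2_inner (convection (v t)) (\<phi> t) = (LINT x|torus. (\<Sum>i\<in>UNIV. \<Sum>j\<in>UNIV. (E 0 t * a $ i) * (G t x $ i $ j * v t x $ j * e x)))"
      unfolding L2_inner_def by (simp add: inner_vec_def convection_def matrix_vector_mult_def \<phi>_def sum_distrib_right sum_distrib_left mult_ac)
    also have "\<dots> = (\<Sum>i\<in>UNIV. \<Sum>j\<in>UNIV. (E 0 t * a $ i) * (LINT x|torus. G t x $ i $ j * v t x $ j * e x))"
      by (subst Bochner_Integration.integral_sum, intro Bochner_Integration.integrable_sum Bochner_Integration.integrable_mult_right integrable_mult_trigpoly te integrable_mult_cper cper_u G_integrable,
          rule sum.cong[OF refl], subst Bochner_Integration.integral_sum, intro Bochner_Integration.integrable_mult_right integrable_mult_trigpoly te integrable_mult_cper cper_u G_integrable, simp)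
    finally have 3: "L2_inner (convection (v t)) (\<phi> t) = E 0 t * (\<Sum>i\<in>UNIV. a $ i * (\<Sum>j\<in>UNIV. LINT x|torus. G t x $ i $ j * v t x $ j * e x))"
      by (simp add: sum_distrib_left mult_ac)
    show ?case unfolding 1 2 3 rate_def
      by (simp add: right_diff_distrib sum_subtractf sum_negf sum_distrib_left mult_ac)
  qed
  have contE: "continuous_on {0..T} (E n)" for n
    using E unfolding deriv_chain_def by (meson DERIV_isCont continuous_at_imp_continuous_on)
  have mR: "?R \<in> borel_measurable (itv T)"
    by (intro borel_measurable_add borel_measurable_times borel_measurable_sum borel_measurable_const cont_meas contE cont_moment rate_measurable te)
  have "(LINT t|itv T. ?R t) = (LINT t|itv T. ?L t)"
    by (rule integral_cong_AE[OF mR measurable_itv_AE[OF mR ae] ae])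
  also have "\<dots> = - L2_inner v0 (\<phi> 0)"
    using lh test by (simp add: leray_hopf_def)
  also have "L2_inner v0 (\<phi> 0) = E 0 0 * (\<Sum>i\<in>UNIV. a $ i * moment e i 0)"
    unfolding \<phi>_def[abs_def] inner_wave[OF v0_L2] by (simp add: moment_initial[OF te])
  finally show ?thesis .
qed

lemma mode_primitive:
  fixes k :: "real^3" and c :: real
  assumes k: "\<And>i. k $ i \<in> \<int>" and a: "k \<bullet> a = 0" and t: "t \<in> {0..T}"
  defines "e \<equiv> \<lambda>x. cos (k \<bullet> x + c)"
  shows "(\<Sum>i\<in>UNIV. a $ i * moment e i t) = (\<Sum>i\<in>UNIV. a $ i * moment e i 0) + (LINT s|itv T. indicator {..t} s * (\<Sum>i\<in>UNIV. a $ i * rate e i s))"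
proof (rule weak_to_primitive[OF _ _ T _ t])
  have te: "trigpoly e" unfolding e_def by (rule trigpoly.wave[OF k])
  show "continuous_on {0..T} (\<lambda>t. \<Sum>i\<in>UNIV. a $ i * moment e i t)"
    by (intro continuous_on_sum continuous_on_mult continuous_on_const cont_moment te)
  show "integrable (itv T) (\<lambda>s. \<Sum>i\<in>UNIV. a $ i * rate e i s)"
    by (intro Bochner_Integration.integrable_sum Bochner_Integration.integrable_mult_right rate_integrable te)
qed (unfold e_def, rule weak_mode[OF k a])

text \<open>For almost every time this holds because the velocity is orthogonal to the gradient of a wave; by continuity it
  holds always.\<close>

lemma moment_orth:
  fixes k :: "real^3" and c :: real
  assumes k: "\<And>i. k $ i \<in> \<int>" and t: "t \<in> {0..T}"
  defines "e \<equiv> \<lambda>x. cos (k \<bullet> x + c)"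
  shows "(\<Sum>i\<in>UNIV. k $ i * moment e i t) = 0"
proof -
  have te: "trigpoly e" unfolding e_def by (rule trigpoly.wave[OF k])
  let ?\<xi> = "\<lambda>t. \<Sum>i\<in>UNIV. k $ i * moment e i t"
  have c: "continuous_on {0..T} ?\<xi>" by (intro continuous_on_sum continuous_on_mult continuous_on_const cont_moment te)
  have ae: "AE t in itv T. ?\<xi> t = 0"
    using AE_good
  proof eventually_elim
    case (elim t)
    then interpret regular_field "v t" "G t" \<alpha> "f t" .
    have tp: "trigpoly (\<lambda>x. cos (k \<bullet> x + (c - pi / 2)))" by (rule trigpoly.wave[OF k])
    have "partial j (\<lambda>x. cos (k \<bullet> x + (c - pi / 2))) x = k $ j * e x" for j x
    proof -
      have "sin (k \<bullet> x + (c - pi / 2)) = - cos (k \<bullet> x + c)"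
        by (simp only: add_diff_eq sin_diff) simp
      then show ?thesis by (simp add: partial_wave e_def)
    qed
    moreover have "(LINT x|torus. v t x $ j * (k $ j * e x)) = k $ j * moment e j t" for j
    proof -
      have "(\<lambda>x. v t x $ j * (k $ j * e x)) = (\<lambda>x. k $ j * (v t x $ j * e x))" by auto
      then show ?thesis by (simp add: moment_def)
    qed
    ultimately show ?case using orth[OF tp] by simp
  qed
  show ?thesis
  proof (rule ccontr)
    assume n: "?\<xi> t \<noteq> 0"
    then have "\<bar>?\<xi> t\<bar> > 0" by simp
    then obtain d where d: "d > 0" "\<And>s. s \<in> {0..T} \<Longrightarrow> dist s t < d \<Longrightarrow> dist (?\<xi> s) (?\<xi> t) < \<bar>?\<xi> t\<bar>"
      using c t unfolding continuous_on_iff by blast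
    define p q where "p = max 0 (t - d)" and "q = min T (t + d)"
    have "0 \<le> p" "p < q" "q \<le> T" using t d(1) T by (auto simp: p_def q_def)
    from AE_itv_dense[OF ae this] obtain s where s: "p < s" "s < q" "?\<xi> s = 0" by blast
    then have "s \<in> {0..T}" "dist s t < d" by (auto simp: p_def q_def dist_real_def)
    from d(2)[OF this] s(3) show False by (simp add: dist_real_def)
  qed
qed

text \<open>The equation determines only the moments in directions orthogonal to \<open>k\<close>, but the vector of moments is
  itself orthogonal to \<open>k\<close>. Hence its components agree with their projections, and the pressure does
  not contribute.\<close>

lemma mode_energy:
  fixes k :: "real^3" and c :: real
  assumes k: "\<And>i. k $ i \<in> \<int>"
  defines "e \<equiv> \<lambda>x. cos (k \<bullet> x + c)"
  shows "\<exists>C. \<forall>t\<in>{0..T}. (\<Sum>i\<in>UNIV. (moment e i t)\<^sup>2) = C + 2 * (LINT s|itv T. indicator {..t} s * (\<Sum>i\<in>UNIV. moment e i s * rate e i s))"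
proof -
  have te: "trigpoly e" unfolding e_def by (rule trigpoly.wave[OF k])
  (* The projection of the i-th unit vector to the plane orthogonal to k. For k = 0 the quotient is zero and
     the projection is the identity, as it should be for the mean value. *)
  define a :: "3 \<Rightarrow> real^3" where "a i = axis i 1 - (k $ i / (k \<bullet> k)) *\<^sub>R k" for i
  have ak: "k \<bullet> a i = 0" for i
    by (cases "k = 0") (simp_all add: a_def inner_diff_right inner_axis)
  have proj: "(\<Sum>l\<in>UNIV. a i $ l * moment e l t) = moment e i t" if "t \<in> {0..T}" for i t
  proof -
    have "(\<Sum>l\<in>UNIV. a i $ l * moment e l t) = (\<Sum>l\<in>UNIV. axis i 1 $ l * moment e l t) - (k $ i / (k \<bullet> k)) * (\<Sum>l\<in>UNIV. k $ l * moment e l t)"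
    proof -
      have "a i $ l * moment e l t = axis i 1 $ l * moment e l t - (k $ i / (k \<bullet> k)) * (k $ l * moment e l t)" for l
        by (simp add: a_def left_diff_distrib)
      then show ?thesis by (simp only: sum_subtractf sum_distrib_left)
    qed
    also have "(\<Sum>l\<in>UNIV. axis i 1 $ l * moment e l t) = moment e i t"
      by (simp add: axis_def if_distrib[of "\<lambda>y. y * _"] sum.delta' cong: if_cong)
    finally show ?thesis using moment_orth[OF k that, of c] by (simp add: e_def)
  qed
  have sym: "a i $ l = a l $ i" for i l by (simp add: a_def axis_def mult.commute)
  define R where "R i s = (\<Sum>l\<in>UNIV. a i $ l * rate e l s)" for i s
  have R: "integrable (itv T) (R i)" for i
    unfolding R_def by (intro Bochner_Integration.integrable_sum Bochner_Integration.integrable_mult_right rate_integrable te)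
  have MR: "integrable (itv T) (\<lambda>s. moment e i s * R i s)" for i
  proof -
    have "integrable (itv T) (\<lambda>s. \<Sum>l\<in>UNIV. a i $ l * (moment e i s * rate e l s))"
      by (intro Bochner_Integration.integrable_sum Bochner_Integration.integrable_mult_right moment_rate_integrable te)
    then show ?thesis by (simp add: R_def sum_distrib_left mult_ac)
  qed
  have prim: "moment e i t = moment e i 0 + (LINT s|itv T. indicator {..t} s * R i s)" if "t \<in> {0..T}" for i t
    using mode_primitive[OF k ak that, of i c] proj[OF that, of i] proj[of 0 i] T by (simp add: e_def R_def)
  have sq: "(moment e i t)\<^sup>2 = (moment e i 0)\<^sup>2 + 2 * (LINT s|itv T. indicator {..t} s * (moment e i s * R i s))" if t: "t \<in> {0..T}" for i t
    by (rule primitive_square[OF R prim t MR])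
  have "(\<Sum>i\<in>UNIV. (moment e i t)\<^sup>2) = (\<Sum>i\<in>UNIV. (moment e i 0)\<^sup>2) + 2 * (LINT s|itv T. indicator {..t} s * (\<Sum>i\<in>UNIV. moment e i s * rate e i s))"
    if t: "t \<in> {0..T}" for t
  proof -
    have "(\<Sum>i\<in>UNIV. (moment e i t)\<^sup>2) = (\<Sum>i\<in>UNIV. (moment e i 0)\<^sup>2) + 2 * (\<Sum>i\<in>UNIV. LINT s|itv T. indicator {..t} s * (moment e i s * R i s))"
      by (simp add: sq[OF t] sum.distrib sum_distrib_left)
    also have "(\<Sum>i\<in>UNIV. LINT s|itv T. indicator {..t} s * (moment e i s * R i s)) = (LINT s|itv T. (\<Sum>i\<in>UNIV. indicator {..t} s * (moment e i s * R i s)))"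
      by (rule Bochner_Integration.integral_sum[symmetric]) (rule integrable_cut[OF MR])
    also have "\<dots> = (LINT s|itv T. indicator {..t} s * (\<Sum>i\<in>UNIV. moment e i s * rate e i s))"
    proof (rule Bochner_Integration.integral_cong[OF refl])
      fix s assume "s \<in> space (itv T)"
      then have s: "s \<in> {0..T}" by auto
      have "(\<Sum>i\<in>UNIV. moment e i s * R i s) = (\<Sum>l\<in>UNIV. rate e l s * (\<Sum>i\<in>UNIV. a l $ i * moment e i s))"
        unfolding R_def sum_distrib_left by (subst sum.swap) (simp add: sym mult_ac)
      also have "\<dots> = (\<Sum>i\<in>UNIV. moment e i s * rate e i s)" by (simp add: proj[OF s] mult.commute)
      finally show "(\<Sum>i\<in>UNIV. indicator {..t} s * (moment e i s * R i s)) = indicator {..t} s * (\<Sum>i\<in>UNIV. moment e i s * rate e i s)"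
        by (simp add: sum_distrib_left[symmetric])
    qed
    finally show ?thesis .
  qed
  then show ?thesis by blast
qed

section \<open>Energy balance of the mollified field\<close>

text \<open>The rate of change of half the mollified energy. The weak gradient is a meaningful function only for almost every
  time, so all statements hold up to null sets of times.\<close>

definition "production J t = - \<nu> * (\<Sum>i\<in>UNIV. \<Sum>j\<in>UNIV. conv_form J (\<lambda>x. G t x $ i $ j) (\<lambda>x. G t x $ i $ j)) - regular_field.transfer (v t) (G t) J"

lemma conv_form_cos:
  assumes k: "\<And>i. k $ i \<in> \<int>" and "integrable torus p" "integrable torus q"
  shows "conv_form (\<lambda>z. cos (k \<bullet> z)) p q = (LINT x|torus. p x * cos (k \<bullet> x + 0)) * (LINT x|torus. q x * cos (k \<bullet> x + 0))
    + (LINT x|torus. p x * cos (k \<bullet> x + (- pi / 2))) * (LINT x|torus. q x * cos (k \<bullet> x + (- pi / 2)))"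
proof -
  define \<beta> where "\<beta> = (\<lambda>m::nat. if m = 0 then (\<lambda>x. cos (k \<bullet> x + 0)) else (\<lambda>x. cos (k \<bullet> x + (- pi / 2))))"
  have "\<forall>m<2. trigpoly (\<beta> m) \<and> trigpoly (\<beta> m)" by (auto simp only: \<beta>_def split: if_splits intro!: trigpoly.wave k)
  moreover have "\<forall>x y. cos (k \<bullet> (x - y)) = (\<Sum>m<2. \<beta> m x * \<beta> m y)"
    by (simp add: \<beta>_def numeral_2_eq_2 inner_diff_right cos_diff cos_add)
  ultimately have "conv_form (\<lambda>z. cos (k \<bullet> z)) p q = (\<Sum>m<2. (LINT x|torus. p x * \<beta> m x) * (LINT y|torus. q y * \<beta> m y))"
    by (rule conv_form_separated) (use assms in auto)
  then show ?thesis by (simp add: \<beta>_def numeral_2_eq_2)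
qed

text \<open>Both sides are linear in the kernel, so the balance follows from the energy of the single modes. For a wave, the
  products of the moments of the gradient are rewritten by means of the weak gradient twice.\<close>

lemma mollified_energy:
  "cospoly J \<Longrightarrow> \<exists>N C. integrable (itv T) N \<and> (AE t in itv T. N t = production J t) \<and>
    (\<forall>t\<in>{0..T}. (\<Sum>i\<in>UNIV. conv_form J (\<lambda>x. v t x $ i) (\<lambda>x. v t x $ i)) = C + 2 * (LINT s|itv T. indicator {..t} s * N s))"
proof (induction rule: cospoly.induct)
  case (wave k)
  let ?c = "\<lambda>x. cos (k \<bullet> x + 0)" and ?s = "\<lambda>x. cos (k \<bullet> x + (- pi / 2))"
  have tc: "trigpoly ?c" "trigpoly ?s" by (rule trigpoly.wave[OF wave])+
  define N where "N t = (\<Sum>i\<in>UNIV. moment ?c i t * rate ?c i t) + (\<Sum>i\<in>UNIV. moment ?s i t * rate ?s i t)" for t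
  have Ni: "integrable (itv T) (\<lambda>t. \<Sum>i\<in>UNIV. moment ?c i t * rate ?c i t)" "integrable (itv T) (\<lambda>t. \<Sum>i\<in>UNIV. moment ?s i t * rate ?s i t)"
    by (intro Bochner_Integration.integrable_sum moment_rate_integrable tc)+
  obtain C1 where C1: "\<forall>t\<in>{0..T}. (\<Sum>i\<in>UNIV. (moment ?c i t)\<^sup>2) = C1 + 2 * (LINT s|itv T. indicator {..t} s * (\<Sum>i\<in>UNIV. moment ?c i s * rate ?c i s))"
    using mode_energy[OF wave, of 0] by blast
  obtain C2 where C2: "\<forall>t\<in>{0..T}. (\<Sum>i\<in>UNIV. (moment ?s i t)\<^sup>2) = C2 + 2 * (LINT s|itv T. indicator {..t} s * (\<Sum>i\<in>UNIV. moment ?s i s * rate ?s i s))"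
    using mode_energy[OF wave, of "- pi / 2"] by blast
  have "(\<Sum>i\<in>UNIV. conv_form (\<lambda>z. cos (k \<bullet> z)) (\<lambda>x. v t x $ i) (\<lambda>x. v t x $ i)) = (C1 + C2) + 2 * (LINT s|itv T. indicator {..t} s * N s)"
    if t: "t \<in> {0..T}" for t
  proof -
    have "(\<Sum>i\<in>UNIV. conv_form (\<lambda>z. cos (k \<bullet> z)) (\<lambda>x. v t x $ i) (\<lambda>x. v t x $ i)) = (\<Sum>i\<in>UNIV. (moment ?c i t)\<^sup>2) + (\<Sum>i\<in>UNIV. (moment ?s i t)\<^sup>2)"
      by (simp only: conv_form_cos[OF wave L2_component(3)[OF v_L2[OF t]] L2_component(3)[OF v_L2[OF t]]] moment_def[symmetric] sum.distrib power2_eq_square)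
    moreover have "(LINT s|itv T. indicator {..t} s * N s) = (LINT s|itv T. indicator {..t} s * (\<Sum>i\<in>UNIV. moment ?c i s * rate ?c i s)) + (LINT s|itv T. indicator {..t} s * (\<Sum>i\<in>UNIV. moment ?s i s * rate ?s i s))"
      unfolding N_def distrib_left by (rule Bochner_Integration.integral_add[OF integrable_cut[OF Ni(1)] integrable_cut[OF Ni(2)]])
    ultimately show ?thesis using bspec[OF C1 t] bspec[OF C2 t] by linarith
  qed
  moreover have "integrable (itv T) N" unfolding N_def using Ni by (rule Bochner_Integration.integrable_add)
  moreover have "AE t in itv T. N t = production (\<lambda>z. cos (k \<bullet> z)) t"
    using AE_good
  proof eventually_elim
    case (elim t)
    then interpret regular_field "v t" "G t" \<alpha> "f t" .
    have pc: "partial j ?c = (\<lambda>x. - (k $ j) * ?s x)" for j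
    proof
      fix x have "sin (k \<bullet> x + 0) = cos (k \<bullet> x + (- pi / 2))" using cos_diff[of "k \<bullet> x" "pi / 2"] by simp
      then show "partial j ?c x = - (k $ j) * ?s x" by (simp only: partial_wave)
    qed
    have ps: "partial j ?s = (\<lambda>x. k $ j * ?c x)" for j
    proof
      fix x have "sin (k \<bullet> x + (- pi / 2)) = - cos (k \<bullet> x + 0)" using sin_diff[of "k \<bullet> x" "pi / 2"] by simp
      then show "partial j ?s x = k $ j * ?c x" by (simp only: partial_wave)
    qed
    define Gc Gs where "Gc i j = (LINT x|torus. G t x $ i $ j * ?c x)" and "Gs i j = (LINT x|torus. G t x $ i $ j * ?s x)" for i j
    have Gc: "Gc i j = k $ j * moment ?s i t" for i j
      using weak_gradient_trigpoly[OF wg tc(1), of i j] unfolding pc Gc_def moment_def by (simp add: mult.left_commute)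
    have Gs: "Gs i j = - k $ j * moment ?c i t" for i j
      using weak_gradient_trigpoly[OF wg tc(2), of i j] unfolding ps Gs_def moment_def by (simp add: mult.left_commute)
    have dc: "(LINT x|torus. G t x $ i $ j * partial j ?c x) = - k $ j * Gs i j" for i j
      unfolding pc Gs_def by (simp add: mult.left_commute)
    have ds: "(LINT x|torus. G t x $ i $ j * partial j ?s x) = k $ j * Gc i j" for i j
      unfolding ps Gc_def by (simp add: mult.left_commute)
    have igu: "integrable torus (\<lambda>x. G t x $ i $ j * v t x $ j)" for i j
      by (intro integrable_mult_cper cper_u G_integrable)
    have kG: "conv_form (\<lambda>z. cos (k \<bullet> z)) (\<lambda>x. G t x $ i $ j) (\<lambda>x. G t x $ i $ j) = Gc i j * Gc i j + Gs i j * Gs i j" for i j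
      unfolding conv_form_cos[OF wave G_integrable G_integrable] Gc_def Gs_def ..
    define Tc Ts where "Tc i j = (LINT x|torus. G t x $ i $ j * v t x $ j * ?c x)" and "Ts i j = (LINT x|torus. G t x $ i $ j * v t x $ j * ?s x)" for i j
    have tr: "transfer (\<lambda>z. cos (k \<bullet> z)) = (\<Sum>i\<in>UNIV. \<Sum>j\<in>UNIV. Tc i j * moment ?c i t + Ts i j * moment ?s i t)"
      unfolding transfer_def conv_form_def[symmetric] Tc_def Ts_def moment_def
        conv_form_cos[OF wave igu cper_integrable[OF cper_u]] ..
    have "N t = (\<Sum>i\<in>UNIV. \<Sum>j\<in>UNIV. moment ?c i t * (- \<nu> * (- k $ j * Gs i j) - Tc i j) + moment ?s i t * (- \<nu> * (k $ j * Gc i j) - Ts i j))"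
      unfolding N_def rate_def dc ds Tc_def[symmetric] Ts_def[symmetric] 
      by (simp only: sum.distrib[symmetric] sum_distrib_left sum_subtractf[symmetric])
    also have "\<dots> = (\<Sum>i\<in>UNIV. \<Sum>j\<in>UNIV. - \<nu> * (Gc i j * Gc i j + Gs i j * Gs i j) - (Tc i j * moment ?c i t + Ts i j * moment ?s i t))"
      by (intro sum.cong refl) (simp only: Gc Gs, simp add: algebra_simps)
    also have "\<dots> = production (\<lambda>z. cos (k \<bullet> z)) t"
      unfolding production_def tr kG by (simp only: sum_subtractf sum_distrib_left)
    finally show ?case .
  qed
  ultimately show ?case by blast
next
  case (add p q)
  obtain N1 C1 where 1: "integrable (itv T) N1" "AE t in itv T. N1 t = production p t"
    "\<forall>t\<in>{0..T}. (\<Sum>i\<in>UNIV. conv_form p (\<lambda>x. v t x $ i) (\<lambda>x. v t x $ i)) = C1 + 2 * (LINT s|itv T. indicator {..t} s * N1 s)" using add.IH(1) by blast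
  obtain N2 C2 where 2: "integrable (itv T) N2" "AE t in itv T. N2 t = production q t"
    "\<forall>t\<in>{0..T}. (\<Sum>i\<in>UNIV. conv_form q (\<lambda>x. v t x $ i) (\<lambda>x. v t x $ i)) = C2 + 2 * (LINT s|itv T. indicator {..t} s * N2 s)" using add.IH(2) by blast
  note tp = cospoly_trigpoly[OF add.hyps(1)] cospoly_trigpoly[OF add.hyps(2)]
  have "AE t in itv T. N1 t + N2 t = production (\<lambda>z. p z + q z) t"
    using AE_good 1(2) 2(2)
  proof eventually_elim
    case (elim t)
    then interpret regular_field "v t" "G t" \<alpha> "f t" by simp
    have igu: "integrable torus (\<lambda>x. G t x $ i $ j * v t x $ j)" for i j
      by (intro integrable_mult_cper cper_u G_integrable)
    show ?case unfolding elim(2,3) production_def transfer_def conv_form_def[symmetric]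
        conv_form_add_kernel[OF tp igu cper_integrable[OF cper_u]] conv_form_add_kernel[OF tp G_integrable G_integrable]
      by (simp add: sum.distrib algebra_simps)
  qed
  moreover have "(\<Sum>i\<in>UNIV. conv_form (\<lambda>z. p z + q z) (\<lambda>x. v t x $ i) (\<lambda>x. v t x $ i)) = (C1 + C2) + 2 * (LINT s|itv T. indicator {..t} s * (N1 s + N2 s))"
    if t: "t \<in> {0..T}" for t
  proof -
    have "(LINT s|itv T. indicator {..t} s * (N1 s + N2 s)) = (LINT s|itv T. indicator {..t} s * N1 s) + (LINT s|itv T. indicator {..t} s * N2 s)"
      unfolding distrib_left by (rule Bochner_Integration.integral_add[OF integrable_cut[OF 1(1)] integrable_cut[OF 2(1)]])
    then show ?thesis using 1(3) 2(3) t
      by (simp add: conv_form_add_kernel[OF tp L2_component(3)[OF v_L2[OF t]] L2_component(3)[OF v_L2[OF t]]] sum.distrib)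
  qed
  ultimately show ?case using Bochner_Integration.integrable_add[OF 1(1) 2(1)] by blast
next
  case (scale p r)
  obtain N1 C1 where 1: "integrable (itv T) N1" "AE t in itv T. N1 t = production p t"
    "\<forall>t\<in>{0..T}. (\<Sum>i\<in>UNIV. conv_form p (\<lambda>x. v t x $ i) (\<lambda>x. v t x $ i)) = C1 + 2 * (LINT s|itv T. indicator {..t} s * N1 s)" using scale.IH by blast
  have "AE t in itv T. r * N1 t = production (\<lambda>z. r * p z) t"
    using AE_good 1(2)
  proof eventually_elim
    case (elim t)
    then interpret regular_field "v t" "G t" \<alpha> "f t" by simp
    show ?case unfolding elim(2) production_def transfer_def conv_form_def[symmetric] conv_form_scale_kernel
      by (simp add: sum_distrib_left right_diff_distrib mult_ac)
  qed
  moreover have "(\<Sum>i\<in>UNIV. conv_form (\<lambda>z. r * p z) (\<lambda>x. v t x $ i) (\<lambda>x. v t x $ i)) = r * C1 + 2 * (LINT s|itv T. indicator {..t} s * (r * N1 s))"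
    if t: "t \<in> {0..T}" for t
  proof -
    have "(LINT s|itv T. indicator {..t} s * (r * N1 s)) = r * (LINT s|itv T. indicator {..t} s * N1 s)"
      by (simp add: mult.left_commute)
    then show ?thesis using 1(3) t by (simp add: conv_form_scale_kernel sum_distrib_left[symmetric] algebra_simps)
  qed
  moreover have "integrable (itv T) (\<lambda>t. r * N1 t)" using 1(1) by simp
  ultimately show ?case by blast
qed

section \<open>The energy equality\<close>

lemma dissipation_sum: "good t \<Longrightarrow> dissipation t = (\<Sum>i\<in>UNIV. \<Sum>j\<in>UNIV. LINT x|torus. (G t x $ i $ j)\<^sup>2)"
proof -
  assume "good t"
  then interpret regular_field "v t" "G t" \<alpha> "f t" .
  have i2: "integrable torus (\<lambda>x. (G t x $ i $ j)\<^sup>2)" for i j by (rule L2_component(2)[OF L2_matrix_row[OF G_L2]])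
  have "(norm A)\<^sup>2 = (\<Sum>i\<in>UNIV. \<Sum>j\<in>UNIV. (A $ i $ j)\<^sup>2)" for A :: "real^3^3"
    unfolding power2_norm_eq_inner inner_vec_def by (simp add: power2_eq_square)
  then have "dissipation t = (LINT x|torus. (\<Sum>i\<in>UNIV. \<Sum>j\<in>UNIV. (G t x $ i $ j)\<^sup>2))"
    by (simp add: dissipation_def L2_norm_sq[OF G_L2])
  also have "\<dots> = (\<Sum>i\<in>UNIV. \<Sum>j\<in>UNIV. LINT x|torus. (G t x $ i $ j)\<^sup>2)"
    by (subst Bochner_Integration.integral_sum, intro Bochner_Integration.integrable_sum i2,
        rule sum.cong[OF refl], rule Bochner_Integration.integral_sum, rule i2)
  finally show ?thesis .
qed

text \<open>Mollifying the gradient does not increase its norm, so the mollified dissipation is at most the true one.\<close>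

lemma production_ge:
  assumes g: "good t" and t: "t \<in> {0..T}"
  shows "production (kern N) t \<ge> - \<nu> * dissipation t - \<bar>regular_field.transfer (v t) (G t) (kern N)\<bar>"
proof -
  interpret regular_field "v t" "G t" \<alpha> "f t" by (rule g)
  have "(\<Sum>i\<in>UNIV. \<Sum>j\<in>UNIV. conv_form (kern N) (\<lambda>x. G t x $ i $ j) (\<lambda>x. G t x $ i $ j)) \<le> dissipation t"
    unfolding dissipation_sum[OF g]
    by (intro sum_mono conv_form_le_square trigpoly_kern kern_nonneg kern_even int_kern G_integrable L2_component(2)[OF L2_matrix_row[OF G_L2]])
  then have "\<nu> * (\<Sum>i\<in>UNIV. \<Sum>j\<in>UNIV. conv_form (kern N) (\<lambda>x. G t x $ i $ j) (\<lambda>x. G t x $ i $ j)) \<le> \<nu> * dissipation t"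
    using nu by (intro mult_left_mono) auto
  then show ?thesis unfolding production_def by linarith
qed

text \<open>Letting the kernel concentrate in the balance between \<open>s\<close> and \<open>t\<close>. At \<open>s\<close> the
  mollified energy converges because the velocity is continuous there, at \<open>t\<close> it is at most the energy,
  and the transfer vanishes in the limit by dominated convergence.\<close>

lemma energy_from_good_time:
  assumes s: "0 < s" "s < t" "good s" and t: "t \<le> T"
  shows "1/2 * (L2_norm (v s))\<^sup>2 \<le> 1/2 * (L2_norm (v t))\<^sup>2 + \<nu> * (LINT \<tau>|itv T. indicator {..t} \<tau> * dissipation \<tau>)"
proof -
  define p where "p = 2 / (1 + \<alpha>)"
  define K1 where "K1 = 18 * (2 * L2_norm v0) powr (1 + \<alpha>)"
  define late where "late = (indicator {s<..} :: real \<Rightarrow> real)"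
  have sT: "s \<in> {0<..<T}" and st: "s \<in> {0..T}" "t \<in> {0..T}" using s t by auto
  have K1: "K1 \<ge> 0" by (simp add: K1_def)
  have d0: "dissipation \<tau> \<ge> 0" for \<tau> by (simp add: dissipation_def)
  have Lp: "f \<in> borel_measurable (lebesgue_on {s<..<T})" "integrable (lebesgue_on {s<..<T}) (\<lambda>\<tau>. \<bar>f \<tau>\<bar> powr p)"
    using f_Lp sT by (auto simp: Lp_on_def p_def)
  have late01: "late \<tau> = 0 \<or> late \<tau> = 1" for \<tau> by (simp add: late_def indicator_def)
  have fi: "integrable (itv T) (\<lambda>\<tau>. late \<tau> * f \<tau> powr p)"
  proof -
    have "(\<lambda>\<tau>. indicator {s<..<T} \<tau> * \<bar>f \<tau>\<bar> powr p) = (\<lambda>\<tau>. indicator {0<..<T} \<tau> * (late \<tau> * f \<tau> powr p))"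
      using sT f_nonneg by (auto simp: late_def indicator_def)
    moreover have "integrable lebesgue (\<lambda>\<tau>. indicator {s<..<T} \<tau> * \<bar>f \<tau>\<bar> powr p)"
      using Lp(2) by (simp add: integrable_restrict_space)
    ultimately show ?thesis by (simp add: integrable_restrict_space)
  qed
  have fm: "(\<lambda>\<tau>. late \<tau> * f \<tau>) \<in> borel_measurable (itv T)"
  proof -
    have "(\<lambda>\<tau>. f \<tau> * indicator {s<..<T} \<tau>) = (\<lambda>\<tau>. (late \<tau> * f \<tau>) * indicator {0<..<T} \<tau>)"
      using sT by (auto simp: late_def indicator_def)
    moreover have "(\<lambda>\<tau>. f \<tau> * indicator {s<..<T} \<tau>) \<in> borel_measurable lebesgue"
      using Lp(1) by (simp add: borel_measurable_restrict_space_iff mult.commute)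
    ultimately show ?thesis by (simp add: borel_measurable_restrict_space_iff mult.commute)
  qed
  have latem: "late \<in> borel_measurable (itv T)" unfolding late_def by (rule indicator_measurable_itv) simp
  have lated: "integrable (itv T) (\<lambda>\<tau>. late \<tau> * dissipation \<tau>)"
  proof (rule Bochner_Integration.integrable_bound[OF dissipation_integrable])
    show "(\<lambda>\<tau>. late \<tau> * dissipation \<tau>) \<in> borel_measurable (itv T)" using latem dissipation_integrable by (intro borel_measurable_times) auto
  qed (auto simp: late_def indicator_def)
  define A where "A \<tau> = K1 * (late \<tau> * f \<tau> powr p + late \<tau> * dissipation \<tau>)" for \<tau>
  define B where "B N \<tau> = 4608 * ((late \<tau> * f \<tau>) * dissipation \<tau>) / sqrt (real N + 1)" for N :: nat and \<tau>
  (* A is integrable but does not depend on N, and B tends to zero pointwise but may fail to be integrable; their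
     minimum has both properties and is measurable, whichever weak gradients are chosen. *)
  define \<beta> where "\<beta> N \<tau> = min (A \<tau>) (B N \<tau>)" for N \<tau>
  have Ai: "integrable (itv T) A" unfolding A_def using fi lated by simp
  have Bm: "B N \<in> borel_measurable (itv T)" for N unfolding B_def using fm dissipation_integrable by measurable
  have \<beta>m: "\<beta> N \<in> borel_measurable (itv T)" for N unfolding \<beta>_def using Ai Bm by measurable
  have pos: "0 \<le> A \<tau>" "0 \<le> B N \<tau>" if "\<tau> \<in> space (itv T)" for N \<tau>
  proof -
    have "f \<tau> \<ge> 0" using that f_nonneg by auto
    then show "0 \<le> A \<tau>" "0 \<le> B N \<tau>" using K1 d0[of \<tau>] late01[of \<tau>] by (auto simp: A_def B_def)
  qed
  have bA: "AE \<tau> in itv T. norm (\<beta> N \<tau>) \<le> A \<tau>" for N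
  proof (rule AE_I2)
    fix \<tau> assume "\<tau> \<in> space (itv T)"
    from pos(1)[OF this] pos(2)[OF this, of N] show "norm (\<beta> N \<tau>) \<le> A \<tau>" by (simp add: \<beta>_def)
  qed
  have \<beta>i: "integrable (itv T) (\<beta> N)" for N
  proof (rule Bochner_Integration.integrable_bound[OF Ai \<beta>m])
    show "AE \<tau> in itv T. norm (\<beta> N \<tau>) \<le> norm (A \<tau>)" using bA[of N] by eventually_elim auto
  qed
  have \<beta>lim: "(\<lambda>N. LINT \<tau>|itv T. \<beta> N \<tau>) \<longlonglongrightarrow> (LINT \<tau>|itv T. 0)"
  proof (rule integral_dominated_convergence[OF _ \<beta>m Ai _ bA])
    show "AE \<tau> in itv T. (\<lambda>N. \<beta> N \<tau>) \<longlonglongrightarrow> 0"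
    proof (rule AE_I2)
      fix \<tau> assume \<tau>: "\<tau> \<in> space (itv T)"
      have "(\<lambda>N. sqrt (inverse (real (Suc N)))) \<longlonglongrightarrow> sqrt 0" by (intro tendsto_real_sqrt LIMSEQ_inverse_real_of_nat)
      then have "(\<lambda>N. 4608 * ((late \<tau> * f \<tau>) * dissipation \<tau>) * sqrt (inverse (real (Suc N)))) \<longlonglongrightarrow> 4608 * ((late \<tau> * f \<tau>) * dissipation \<tau>) * sqrt 0"
        by (intro tendsto_mult tendsto_const)
      then have "(\<lambda>N. B N \<tau>) \<longlonglongrightarrow> 0" by (simp add: B_def real_sqrt_inverse divide_inverse add.commute)
      then show "(\<lambda>N. \<beta> N \<tau>) \<longlonglongrightarrow> 0"
        by (rule tendsto_sandwich[OF _ _ tendsto_const, rotated 2]) (use pos[OF \<tau>] in \<open>auto simp: \<beta>_def\<close>)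
    qed
  qed auto
  let ?D = "LINT \<tau>|itv T. indicator {..t} \<tau> * dissipation \<tau>"
  let ?q = "\<lambda>N t. \<Sum>i\<in>UNIV. conv_form (kern N) (\<lambda>x. v t x $ i) (\<lambda>x. v t x $ i)"
  have main: "1/2 * ?q N s - (LINT \<tau>|itv T. \<beta> N \<tau>) \<le> 1/2 * (L2_norm (v t))\<^sup>2 + \<nu> * ?D" for N
  proof -
    obtain P C where P: "integrable (itv T) P" "AE \<tau> in itv T. P \<tau> = production (kern N) \<tau>"
      "\<forall>t\<in>{0..T}. ?q N t = C + 2 * (LINT \<tau>|itv T. indicator {..t} \<tau> * P \<tau>)"
      using mollified_energy[OF cospoly_kern] by blast
    have "AE \<tau> in itv T. \<tau> \<in> space (itv T)" by (rule AE_space)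
    with AE_good P(2) have ae: "AE \<tau> in itv T. - (\<nu> * (indicator {..t} \<tau> * dissipation \<tau>)) - \<beta> N \<tau> \<le> indicator {..t} \<tau> * P \<tau> - indicator {..s} \<tau> * P \<tau>"
    proof eventually_elim
      case (elim \<tau>)
      have \<beta>0: "\<beta> N \<tau> \<ge> 0" using pos[OF elim(3)] by (simp add: \<beta>_def)
      have nd: "\<nu> * dissipation \<tau> \<ge> 0" using nu d0 by simp
      have \<tau>: "\<tau> \<in> {0..T}" using elim(3) by auto
      show ?case
      proof (cases "s < \<tau> \<and> \<tau> \<le> t")
        case True
        interpret regular_field "v \<tau>" "G \<tau>" \<alpha> "f \<tau>" by (rule elim)
        have c1: "late \<tau> = 1" using True by (simp add: late_def)
        have "\<bar>transfer (kern N)\<bar> \<le> B N \<tau>"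
          using transfer_bound_small[of N] by (simp add: B_def c1 dissipation_def)
        moreover have "\<bar>transfer (kern N)\<bar> \<le> A \<tau>"
        proof -
          have "\<bar>transfer (kern N)\<bar> \<le> 18 * (2 * L2_norm (v \<tau>)) powr (1 + \<alpha>) * (f \<tau> powr p + dissipation \<tau>)"
            using transfer_bound_integrable[of N] by (simp add: p_def dissipation_def)
          also have "\<dots> \<le> K1 * (f \<tau> powr p + dissipation \<tau>)"
            unfolding K1_def using norm_v_le[OF \<tau>] L2_norm_nonneg[of "v \<tau>"] alpha d0[of \<tau>]
            by (intro mult_right_mono mult_left_mono powr_mono2) auto
          finally show ?thesis by (simp add: A_def c1)
        qed
        ultimately have "\<bar>transfer (kern N)\<bar> \<le> \<beta> N \<tau>" by (simp add: \<beta>_def)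
        with production_ge[OF elim(1) \<tau>, of N] elim(2) True show ?thesis by (simp add: indicator_def)
      next
        case False
        then have "indicator {..t} \<tau> * P \<tau> - indicator {..s} \<tau> * P \<tau> = 0" using s(2) by (auto simp: indicator_def)
        moreover have "\<nu> * (indicator {..t} \<tau> * dissipation \<tau>) \<ge> 0" using nd by (simp add: indicator_def)
        ultimately show ?thesis using \<beta>0 by linarith
      qed
    qed
    have iD: "integrable (itv T) (\<lambda>\<tau>. indicator {..t} \<tau> * dissipation \<tau>)" by (rule integrable_cut[OF dissipation_integrable])
    note iP = integrable_cut[OF P(1)]
    have "(LINT \<tau>|itv T. - (\<nu> * (indicator {..t} \<tau> * dissipation \<tau>)) - \<beta> N \<tau>) \<le> (LINT \<tau>|itv T. indicator {..t} \<tau> * P \<tau> - indicator {..s} \<tau> * P \<tau>)"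
      by (rule integral_mono_AE) (use iD iP \<beta>i ae in auto)
    also have "(LINT \<tau>|itv T. - (\<nu> * (indicator {..t} \<tau> * dissipation \<tau>)) - \<beta> N \<tau>) = - \<nu> * ?D - (LINT \<tau>|itv T. \<beta> N \<tau>)"
      using iD \<beta>i by simp
    also have "(LINT \<tau>|itv T. indicator {..t} \<tau> * P \<tau> - indicator {..s} \<tau> * P \<tau>) = (LINT \<tau>|itv T. indicator {..t} \<tau> * P \<tau>) - (LINT \<tau>|itv T. indicator {..s} \<tau> * P \<tau>)"
      using iP by simp
    finally have "- \<nu> * ?D - (LINT \<tau>|itv T. \<beta> N \<tau>) \<le> 1/2 * ?q N t - 1/2 * ?q N s"
      using bspec[OF P(3) st(1)] bspec[OF P(3) st(2)] by linarith
    moreover have "?q N t \<le> (L2_norm (v t))\<^sup>2"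
    proof -
      note vt = v_L2[OF st(2)]
      have "?q N t \<le> (\<Sum>i\<in>UNIV. LINT x|torus. (v t x $ i)\<^sup>2)"
        by (intro sum_mono conv_form_le_square trigpoly_kern kern_nonneg kern_even int_kern L2_component[OF vt])
      also have "\<dots> = (LINT x|torus. (\<Sum>i\<in>UNIV. (v t x $ i)\<^sup>2))"
        by (rule Bochner_Integration.integral_sum[symmetric]) (rule L2_component(2)[OF vt])
      also have "\<dots> = (L2_norm (v t))\<^sup>2" by (simp only: L2_norm_sq[OF vt] square_norm_vec)
      finally show ?thesis .
    qed
    ultimately show ?thesis by linarith
  qed
  have qlim: "(\<lambda>N. ?q N s) \<longlonglongrightarrow> (L2_norm (v s))\<^sup>2"
  proof -
    interpret regular_field "v s" "G s" \<alpha> "f s" by (rule s(3))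
    show ?thesis unfolding norm_sq_u unfolding power2_eq_square
      by (intro tendsto_sum conv_form_kern_limit cper_integrable cper_u)
  qed
  have "(\<lambda>N. 1/2 * ?q N s - (LINT \<tau>|itv T. \<beta> N \<tau>)) \<longlonglongrightarrow> 1/2 * (L2_norm (v s))\<^sup>2 - (LINT \<tau>|itv T. 0)"
    by (intro tendsto_diff tendsto_mult tendsto_const qlim \<beta>lim)
  then have "1/2 * (L2_norm (v s))\<^sup>2 - (LINT \<tau>|itv T. 0) \<le> 1/2 * (L2_norm (v t))\<^sup>2 + \<nu> * ?D"
    by (rule LIMSEQ_le_const2) (use main in auto)
  then show ?thesis by simp
qed

text \<open>Expanding the square of \<open>w + (u - w)\<close>; this passes strong convergence on to the energy.\<close>

lemma L2_norm_sq_ge: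
  fixes u w :: "real^3 \<Rightarrow> real^3"
  assumes u: "u \<in> L2" and w: "w \<in> L2"
  shows "(L2_norm w)\<^sup>2 - 2 * (L2_norm (\<lambda>x. u x - w x) * L2_norm w) \<le> (L2_norm u)\<^sup>2"
proof -
  have d: "(\<lambda>x. u x - w x) \<in> L2" by (rule L2_diff[OF u w])
  have i: "integrable torus (\<lambda>x. (norm (w x))\<^sup>2)" "integrable torus (\<lambda>x. (norm (u x))\<^sup>2)" using u w by (auto simp: L2_def)
  have id: "integrable torus (\<lambda>x. (u x - w x) \<bullet> w x)"
    using d w by (intro integrable_inner_L2 L2_measurable) (auto simp: L2_def)
  have "(L2_norm w)\<^sup>2 + 2 * L2_inner (\<lambda>x. u x - w x) w = (LINT x|torus. (norm (w x))\<^sup>2 + 2 * ((u x - w x) \<bullet> w x))"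
    using i id by (simp add: L2_norm_sq[OF w] L2_inner_def)
  also have "\<dots> \<le> (LINT x|torus. (norm (u x))\<^sup>2)"
  proof (rule integral_mono)
    fix x
    have "0 \<le> (u x - w x) \<bullet> (u x - w x)" by simp
    then show "(norm (w x))\<^sup>2 + 2 * ((u x - w x) \<bullet> w x) \<le> (norm (u x))\<^sup>2"
      unfolding power2_norm_eq_inner by (simp add: inner_diff_left inner_diff_right inner_commute)
  qed (use i id in auto)
  finally have "(L2_norm w)\<^sup>2 + 2 * L2_inner (\<lambda>x. u x - w x) w \<le> (L2_norm u)\<^sup>2" by (simp add: L2_norm_sq[OF u])
  moreover have "\<bar>L2_inner (\<lambda>x. u x - w x) w\<bar> \<le> L2_norm (\<lambda>x. u x - w x) * L2_norm w" by (rule L2_inner_CS[OF d w])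
  ultimately show ?thesis by linarith
qed

text \<open>Times with a Hoelder continuous velocity accumulate at zero, where the velocity converges strongly to
  \<open>v\<^sub>0\<close>.\<close>

lemma energy_equality:
  assumes t: "t \<in> {0..T}"
  shows "1/2 * (L2_norm (v t))\<^sup>2 + \<nu> * (LINT \<tau>|lebesgue_on {0..t}. (L2_norm (G \<tau>))\<^sup>2) = 1/2 * (L2_norm v0)\<^sup>2"
proof -
  have D: "(LINT \<tau>|lebesgue_on {0..t}. (L2_norm (G \<tau>))\<^sup>2) = (LINT \<tau>|itv T. indicator {..t} \<tau> * dissipation \<tau>)"
    using integral_closed_interval[OF dissipation_integrable t] by (simp add: dissipation_def)
  have le: "1/2 * (L2_norm (v t))\<^sup>2 + \<nu> * (LINT \<tau>|lebesgue_on {0..t}. (L2_norm (G \<tau>))\<^sup>2) \<le> 1/2 * (L2_norm v0)\<^sup>2"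
    using lh t unfolding leray_hopf_def by blast
  show ?thesis
  proof (cases "t = 0")
    case True
    have "AE x in torus. v 0 x = v0 x"
      using wcr by (auto simp: weakly_continuous_representative_def AE_restrict_space_iff elim: eventually_mono)
    then have "(LINT x|torus. (norm (v 0 x))\<^sup>2) = (LINT x|torus. (norm (v0 x))\<^sup>2)"
      using L2_measurable[OF v_L2[of 0]] L2_measurable[OF v0_L2] T by (intro integral_cong_AE) (auto elim: eventually_mono)
    then have n: "(L2_norm (v 0))\<^sup>2 = (L2_norm v0)\<^sup>2"
      using L2_norm_sq[OF v_L2[of 0]] L2_norm_sq[OF v0_L2] T by simp
    have "(LINT \<tau>|itv T. indicator {..t} \<tau> * dissipation \<tau>) = (LINT \<tau>|itv T. 0)"
      by (rule Bochner_Integration.integral_cong) (auto simp: True indicator_def)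
    then show ?thesis unfolding D using n True by simp
  next
    case False
    have "1/2 * (L2_norm v0)\<^sup>2 \<le> 1/2 * (L2_norm (v t))\<^sup>2 + \<nu> * (LINT \<tau>|itv T. indicator {..t} \<tau> * dissipation \<tau>) + e" if e: "e > 0" for e
    proof -
      let ?n = "L2_norm v0 + 1"
      have n: "?n > 0" using L2_norm_nonneg[of v0] by simp
      have "((\<lambda>s. L2_norm (\<lambda>x. v s x - v0 x)) \<longlongrightarrow> 0) (at_right 0)" using lh by (simp add: leray_hopf_def)
      then have "\<forall>\<^sub>F s in at_right 0. L2_norm (\<lambda>x. v s x - v0 x) < e / ?n" using e n by (intro order_tendstoD(2)) auto
      then obtain b where b: "b > 0" "\<And>s. 0 < s \<Longrightarrow> s < b \<Longrightarrow> L2_norm (\<lambda>x. v s x - v0 x) < e / ?n"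
        by (auto simp: eventually_at_right_field)
      have "0 < min b t" "min b t \<le> T" using b(1) t False by auto
      with AE_itv_dense[OF AE_good order_refl, of "min b t"] obtain s where s: "0 < s" "s < min b t" "good s" by blast
      have sL: "v s \<in> L2" using s t by (intro v_L2) auto
      have "L2_norm (\<lambda>x. v s x - v0 x) * L2_norm v0 \<le> e / ?n * ?n"
        using b(2)[of s] s L2_norm_nonneg e n by (intro mult_mono) auto
      then have "L2_norm (\<lambda>x. v s x - v0 x) * L2_norm v0 \<le> e" using n by simp
      with L2_norm_sq_ge[OF sL v0_L2] have "1/2 * (L2_norm v0)\<^sup>2 - e \<le> 1/2 * (L2_norm (v s))\<^sup>2" by linarith
      moreover have "1/2 * (L2_norm (v s))\<^sup>2 \<le> 1/2 * (L2_norm (v t))\<^sup>2 + \<nu> * (LINT \<tau>|itv T. indicator {..t} \<tau> * dissipation \<tau>)"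
        using s t by (intro energy_from_good_time) auto
      ultimately show ?thesis by linarith
    qed
    then have "1/2 * (L2_norm v0)\<^sup>2 \<le> 1/2 * (L2_norm (v t))\<^sup>2 + \<nu> * (LINT \<tau>|itv T. indicator {..t} \<tau> * dissipation \<tau>)"
      by (rule field_le_epsilon)
    with le show ?thesis unfolding D by linarith
  qed
qed

end

theorem theorem5p1:
  fixes T \<nu> \<alpha> :: real
    and v0 :: "real^3 \<Rightarrow> real^3"
    and v :: "real \<Rightarrow> real^3 \<Rightarrow> real^3"
  assumes "T > 0" and "\<nu> > 0" and "0 < \<alpha>" and "\<alpha> < 1"
    and "v0 \<in> H_space"
    and "leray_hopf T \<nu> v0 v"
    and "weakly_continuous_representative T v0 v"
    and "holder_away_from_0 T (2 / (1 + \<alpha>)) \<alpha> v"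
  shows "\<forall>t\<in>{0..T}.
    1/2 * (L2_norm (v t))\<^sup>2 + \<nu> * (LINT \<tau>|lebesgue_on {0..t}. (L2_norm (wgrad (v \<tau>)))\<^sup>2)
      = 1/2 * (L2_norm v0)\<^sup>2"
proof -
  obtain f where "\<forall>t\<in>{0..T}. 0 \<le> f t"
    "AE t in lebesgue_on {0<..T}. \<forall>x y. norm (v t x - v t y) \<le> f t * norm (x - y) powr \<alpha>"
    "\<forall>l\<in>{0<..<T}. Lp_on (2 / (1 + \<alpha>)) {l<..<T} f"
    using assms(8) unfolding holder_away_from_0_def by blast
  then interpret leray_solution T \<nu> \<alpha> v0 v f
    using assms(1-7) by unfold_locales
  show ?thesis using energy_equality by blast
qed

end
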